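(* If $\lambda\in\Lambda_4$, then the bi-center of system (S) at $(\pm1,0)$ is a weak center of order at most $3$. Moreover, it is a weak center of order $3$ if and only if $\gamma^{(4)}=(a_3,a_6,a_2,a_4)$ belongs to $$\Gamma_4=\left\{\gamma^{(4)}\in\mathbb{R}^4:\tau_1^{(4)}=\tau_2^{(4)}=\tau_3^{(4)}=0\right\}.$$
   Context: System (S), with parameter $\lambda=(a_2,a_3,a_4,a_6,a_7,a_8,a_9,a_{10})\in\mathbb{R}^8$, is $$\dot x=-x^4y+a_2x^3y^2+a_3x^2y^3+a_4xy^4,$$ $$\dot y=-\tfrac14x-a_6y+\tfrac14x^5+a_6x^4y+a_7x^3y^2+a_8x^2y^3+a_9xy^4+a_{10}y^5.$$ It is invariant under $(x,y)\mapsto(-x,-y)$ and has singular points $(\pm1,0)$. A bi-center at $(\pm1,0)$ means that both points are centers. The set $$\Lambda_4=\left\{\lambda\in\mathbb{R}^8: a_7=-1,\ a_8=a_2,\ a_9=a_3,\ a_{10}=a_4\right\}$$ is a family of parameters for which (S) is known to have a bi-center at $(\pm1,0)$; it is coordinatized by $\gamma^{(4)}=(a_3,a_6,a_2,a_4)\in\mathbb{R}^4$. Period function. Replacing $x$ by $x+1$ moves $(1,0)$ to the origin and gives a system $\dot x=-y+\cdots$, $\dot y=x+\cdots$. Let $P(h,\lambda)$ be the period of the orbit through $(h,0)$ for small $h>0$; it extends analytically to $h=0$ with $P(0,\lambda)=2\pi$. Put $\phi(h,\lambda)=P(h,\lambda)-2\pi$. The center (equivalently, by symmetry, the bi-center)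 is a weak center of order $k\ge0$ if $\phi(0,\lambda)=\phi'(0,\lambda)=\cdots=\phi^{(2k+1)}(0,\lambda)=0$ and $\phi^{(2k+2)}(0,\lambda)\ne0$ (derivatives in $h$). Complex period constants. In the translated system put $z=x+iy$, $w=x-iy$, $T=it$, giving $dz/dT=z+\cdots$, $dw/dT=-w-\cdots$. There are unique formal series $\xi=z+\sum_{k+j\ge2}c_{kj}z^kw^j$, $\eta=w+\sum_{k+j\ge2}d_{kj}w^kz^j$ with $c_{k+1,k}=d_{k+1,k}=0$ for $k\ge1$ such that $d\xi/dT=\xi+\sum_{j\ge1}p_j\xi^{j+1}\eta^j$ and $d\eta/dT=-\eta-\sum_{j\ge1}q_j\eta^{j+1}\xi^j$. Put $\tau_k=p_k+q_k$, and let $\tau_k^{(4)}$ be $\tau_k$ restricted to $\Lambda_4$, as a polynomial in $\gamma^{(4)}$. (Each $\tau_k^{(4)}$ may be simplified by subtracting polynomial multiples of $\tau_1^{(4)},\dots,\tau_{k-1}^{(4)}$; this does not change the common zero sets.) *)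

theory Defs
  imports "HOL-Analysis.Analysis"
begin

text \<open>A parameter is the tuple \<open>(a2, a3, a4, a6, a7, a8, a9, a10)\<close>.\<close>

type_synonym params = "real \<times> real \<times> real \<times> real \<times> real \<times> real \<times> real \<times> real"

text \<open>The right-hand sides are stated over an arbitrary commutative ring, into which the real
  coefficients are embedded by \<open>e\<close>. They are evaluated both at real numbers and at bivariate
  formal power series over the complex numbers.\<close>

fun rhs_x :: "(real \<Rightarrow> 'a::comm_ring_1) \<Rightarrow> params \<Rightarrow> 'a \<Rightarrow> 'a \<Rightarrow> 'a" where
  "rhs_x e (a2, a3, a4, a6, a7, a8, a9, a10) x y =
     - (x^4 * y) + e a2 * x^3 * y^2 + e a3 * x^2 * y^3 + e a4 * x * y^4"

fun rhs_y :: "(real \<Rightarrow> 'a::comm_ring_1) \<Rightarrow> params \<Rightarrow> 'a \<Rightarrow> 'a \<Rightarrow> 'a" where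
  "rhs_y e (a2, a3, a4, a6, a7, a8, a9, a10) x y =
     - (e (1/4) * x) - e a6 * y + e (1/4) * x^5 + e a6 * x^4 * y + e a7 * x^3 * y^2
     + e a8 * x^2 * y^3 + e a9 * x * y^4 + e a10 * y^5"

definition system_S :: "params \<Rightarrow> real \<times> real \<Rightarrow> real \<times> real" where
  "system_S lam = (\<lambda>(x, y). (rhs_x (\<lambda>c. c) lam x y, rhs_y (\<lambda>c. c) lam x y))"

definition translated_S :: "params \<Rightarrow> real \<times> real \<Rightarrow> real \<times> real" where
  "translated_S lam = (\<lambda>(x, y). system_S lam (x + 1, y))"

definition Lambda4 :: "params set" where
  "Lambda4 = {(a2, a3, a4, a6, a7, a8, a9, a10). a7 = -1 \<and> a8 = a2 \<and> a9 = a3 \<and> a10 = a4}"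

fun gamma4 :: "params \<Rightarrow> real \<times> real \<times> real \<times> real" where
  "gamma4 (a2, a3, a4, a6, a7, a8, a9, a10) = (a3, a6, a2, a4)"

subsection \<open>Centers and the period function\<close>

definition is_solution :: "(real \<times> real \<Rightarrow> real \<times> real) \<Rightarrow> (real \<Rightarrow> real \<times> real) \<Rightarrow> bool" where
  "is_solution V g \<longleftrightarrow> (\<forall>t. (g has_vector_derivative V (g t)) (at t))"

definition minimal_period :: "(real \<Rightarrow> 'a) \<Rightarrow> real \<Rightarrow> bool" where
  "minimal_period g T \<longleftrightarrow> T > 0 \<and> (\<forall>t. g (t + T) = g t) \<and>
     (\<forall>s. 0 < s \<and> s < T \<longrightarrow> \<not> (\<forall>t. g (t + s) = g t))"

text \<open>Constant functions have no minimal period, so the orbits below are never singular points.\<close>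

definition is_center :: "(real \<times> real \<Rightarrow> real \<times> real) \<Rightarrow> real \<times> real \<Rightarrow> bool" where
  "is_center V p \<longleftrightarrow> V p = 0 \<and>
     (\<exists>U. open U \<and> p \<in> U \<and>
        (\<forall>q\<in>U - {p}. \<exists>g T. is_solution V g \<and> g 0 = q \<and> minimal_period g T \<and> range g \<subseteq> U - {p}))"

definition is_bicenter :: "params \<Rightarrow> bool" where
  "is_bicenter lam \<longleftrightarrow> is_center (system_S lam) (1, 0) \<and> is_center (system_S lam) (-1, 0)"

text \<open>\<open>period h lam\<close> is meaningful if the orbit through \<open>(h, 0)\<close> is periodic, which holds for
  small \<open>h > 0\<close> if there is a center.\<close>

definition period :: "real \<Rightarrow> params \<Rightarrow> real" where
  "period h lam =
     (THE T. \<exists>g. is_solution (translated_S lam) g \<and> g 0 = (h, 0) \<and> minimal_period g T)"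

text \<open>Here \<open>\<phi>\<close> is the real-analytic extension of \<open>h \<mapsto> period h lam - 2 * pi\<close> to a
  neighbourhood of 0; its germ at 0 is unique, hence so are the derivatives at 0.\<close>

definition weak_bicenter :: "params \<Rightarrow> nat \<Rightarrow> bool" where
  "weak_bicenter lam k \<longleftrightarrow> is_bicenter lam \<and>
     (\<exists>\<phi> :: real \<Rightarrow> real. (\<exists>F. \<phi> has_fps_expansion F) \<and>
        (\<forall>\<^sub>F h in at_right 0. \<phi> h = period h lam - 2 * pi) \<and>
        (\<forall>j\<le>2 * k + 1. (deriv ^^ j) \<phi> 0 = 0) \<and> (deriv ^^ (2 * k + 2)) \<phi> 0 \<noteq> 0)"

subsection \<open>Complex period constants\<close>

text \<open>\<open>F $ k $ j\<close> is the coefficient of \<open>z^k * w^j\<close> in \<open>F\<close>.\<close>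

type_synonym series2 = "complex fps fps"

definition cst :: "complex \<Rightarrow> series2" where
  "cst c = fps_const (fps_const c)"

definition var_z :: series2 where "var_z = fps_X"

definition var_w :: series2 where "var_w = fps_const fps_X"

definition deriv_z :: "series2 \<Rightarrow> series2" where
  "deriv_z F = fps_deriv F"

definition deriv_w :: "series2 \<Rightarrow> series2" where
  "deriv_w F = Abs_fps (\<lambda>k. fps_deriv (fps_nth F k))"

text \<open>The translated vector field at \<open>x = (z + w)/2\<close>, \<open>y = (z - w)/(2i)\<close>.\<close>

definition cplx_x :: "params \<Rightarrow> series2" where
  "cplx_x lam = rhs_x (\<lambda>c. cst (of_real c)) lam
     (cst (1/2) * (var_z + var_w) + 1) (cst (1 / (2 * \<i>)) * (var_z - var_w))"

definition cplx_y :: "params \<Rightarrow> series2" where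
  "cplx_y lam = rhs_y (\<lambda>c. cst (of_real c)) lam
     (cst (1/2) * (var_z + var_w) + 1) (cst (1 / (2 * \<i>)) * (var_z - var_w))"

text \<open>Since \<open>T = i t\<close>, we have \<open>d/dT = -i d/dt\<close>.\<close>

definition field_z :: "params \<Rightarrow> series2" where
  "field_z lam = cst (-\<i>) * (cplx_x lam + cst \<i> * cplx_y lam)"

definition field_w :: "params \<Rightarrow> series2" where
  "field_w lam = cst (-\<i>) * (cplx_x lam - cst \<i> * cplx_y lam)"

definition deriv_T :: "params \<Rightarrow> series2 \<Rightarrow> series2" where
  "deriv_T lam F = deriv_z F * field_z lam + deriv_w F * field_w lam"

text \<open>The infinite sum of \<open>p j * F^(j+1) * G^j\<close> over \<open>j \<ge> 1\<close>. It is used for series without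
  constant term, for which the \<open>j\<close>-th summand has no terms of total degree below \<open>2 * j + 1\<close>;
  the coefficient at \<open>(k, l)\<close> thus only receives contributions from \<open>j \<le> k + l\<close>.\<close>

definition resonant_sum :: "(nat \<Rightarrow> complex) \<Rightarrow> series2 \<Rightarrow> series2 \<Rightarrow> series2" where
  "resonant_sum p F G = Abs_fps (\<lambda>k. Abs_fps (\<lambda>l.
     \<Sum>j=1..k+l. p j * fps_nth (fps_nth (F ^ (j + 1) * G ^ j) k) l))"

definition normal_form ::
    "params \<Rightarrow> series2 \<Rightarrow> series2 \<Rightarrow> (nat \<Rightarrow> complex) \<Rightarrow> (nat \<Rightarrow> complex) \<Rightarrow> bool" where
  "normal_form lam xi eta p q \<longleftrightarrow>
     fps_nth (fps_nth xi 0) 0 = 0 \<and> fps_nth (fps_nth xi 1) 0 = 1 \<and> fps_nth (fps_nth xi 0) 1 = 0 \<and>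
     fps_nth (fps_nth eta 0) 0 = 0 \<and> fps_nth (fps_nth eta 1) 0 = 0 \<and> fps_nth (fps_nth eta 0) 1 = 1 \<and>
     (\<forall>k\<ge>1. fps_nth (fps_nth xi (k + 1)) k = 0 \<and> fps_nth (fps_nth eta k) (k + 1) = 0) \<and>
     deriv_T lam xi = xi + resonant_sum p xi eta \<and>
     deriv_T lam eta = - eta - resonant_sum q eta xi"

text \<open>Meaningful for \<open>k \<ge> 1\<close> only: \<open>p 0\<close> and \<open>q 0\<close> are not constrained.\<close>

definition tau :: "nat \<Rightarrow> params \<Rightarrow> complex" where
  "tau k lam = (THE s. \<exists>xi eta p q. normal_form lam xi eta p q \<and> s = p k + q k)"

fun tau4 :: "nat \<Rightarrow> real \<times> real \<times> real \<times> real \<Rightarrow> complex" where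
  "tau4 k (a3, a6, a2, a4) = tau k (a2, a3, a4, a6, -1, a2, a3, a4)"

definition Gamma4 :: "(real \<times> real \<times> real \<times> real) set" where
  "Gamma4 = {c. tau4 1 c = 0 \<and> tau4 2 c = 0 \<and> tau4 3 c = 0}"

end

theory Submission
  imports Defs "HOL-Complex_Analysis.Complex_Analysis"
begin

text \<open>On \<open>Lambda4\<close> the variables \<open>l = 4 * ln x\<close> and \<open>v = 4 * y / x\<close> satisfy
  \<open>l' = - exp l * f v\<close> and \<open>v' = (exp l - 1) * (1 + a * v)\<close> with a quartic \<open>f\<close>, so the system has
  a first integral with separated variables. Morse coordinates \<open>p\<close> and \<open>q\<close>, functions of \<open>l\<close> and \<open>v\<close>
  alone, make it \<open>p^2 + q^2\<close>, and the period of the orbit of radius \<open>R\<close> becomes the integral of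
  \<open>al (R cos t) * be (R sin t)\<close> over the circle, with explicit Taylor coefficients. If the
  coefficients of \<open>R^2\<close>, \<open>R^4\<close>, \<open>R^6\<close> all vanished, then eliminating \<open>c\<close> and \<open>d\<close> would give a
  zero of a polynomial in \<open>a\<close> and \<open>b\<close> that is a sum of squares plus a positive constant. Hence the
  order is in fact at most \<open>2\<close>. The first nonvanishing coefficient is a nonzero multiple of the first
  nonvanishing period constant, as one sees by following \<open>xi / eta\<close> along an orbit. Hence \<open>Gamma4\<close>
  is empty, and both sides of the equivalence are false.\<close>

unbundle no vec_syntax
unbundle fps_syntax

subsection \<open>The elimination polynomial\<close>

text \<open>The series \<open>xi\<close> and \<open>eta\<close> are only formal and may diverge, so
  they meet the actual orbits through Taylor polynomials with remainder estimates on the plane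
  \<open>w = cnj z\<close>. What is compared is winding: over one turn the argument of
  \<open>xi / eta\<close> grows by 4 pi, while its rate of change is
  \<open>2 + (p j + q j) * (z * cnj z)^j\<close> up to higher order once the sums of lower index
  vanish. In the Morse chart \<open>z\<close> is about \<open>Z / 4\<close> with
  \<open>|Z| = R\<close>, so the rate is nearly constant on each orbit, and the coefficient of
  \<open>R^(2 * j)\<close> in the period comes out as \<open>- pi * (p j + q j) / 16^j\<close>. The
  period constants are thus located without being expanded as polynomials in the parameters.

  A first coefficient in degree \<open>2 * k\<close> means order \<open>k - 1\<close>. The bound on
  the order asks that three polynomial equations in the four unknowns \<open>a\<close>,
  \<open>b\<close>, \<open>c\<close>, \<open>d\<close> have no common zero. A dimension count cannot
  exclude one; positivity over the reals does.\<close>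

lemma resultant_positive:
  fixes a b :: real
  shows "5496*a^8 + 2120*a^7*b + 37565*a^6*b^2 + 14625*a^6 + 635280*a^5*b^3 + 22480*a^5*b
    + 2482060*a^4*b^4 + 17045*a^4*b^2 + 12882*a^4 + 3119200*a^3*b^5 + 524650*a^3*b^3 + 32420*a^3*b
    + 9298800*a^2*b^6 + 3200050*a^2*b^4 + 11340*a^2*b^2 + 4089*a^2 + 16150400*a*b^7
    + 3479000*a*b^5 - 187320*a*b^3 + 11844*a*b + 12622400*b^8 + 2401000*b^6 + 95060*b^4
    + 27636*b^2 + 336 > 0"
proof -
  \<comment> \<open>The terms are grouped by degree. The quartic part is negative at
    \<open>a = b = 1\<close>, so \<open>p4\<close> is stated with an extra
    \<open>240000*b^4\<close>; to pay for it, \<open>p2\<close> and \<open>p6\<close> hold back some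
    \<open>b^2\<close> and \<open>b^6\<close>.\<close>
  have p2: "4089*a^2 + 11844*a*b + 12636*b^2 \<ge> 0"
  proof -
    have eq: "4089*a^2 + 11844*a*b + 12636*b^2 = 4000*(a + 3/2*b)^2 + 78*(a - b)^2 + 11*a^2 + 3558*b^2" by algebra
    show ?thesis unfolding eq by (intro add_nonneg_nonneg mult_nonneg_nonneg) simp_all
  qed
  have p4: "12882*a^4 + 32420*a^3*b + 11340*a^2*b^2 - 187320*a*b^3 + 335060*b^4 \<ge> 0"
  proof -
    have eq: "12882*a^4 + 32420*a^3*b + 11340*a^2*b^2 - 187320*a*b^3 + 335060*b^4 =
      10000*(a^2 + 2*a*b - 4*b^2)^2 + 30000*(a*b - b^2)^2 + 50000*(b^2)^2
      + 1895*(a^2 - 2*a*b)^2 + 8170*(a*b + 2*b^2)^2 + 987*(a^2)^2 + 5590*(a*b)^2 + 62380*(b^2)^2"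
      by algebra
    show ?thesis unfolding eq by (intro add_nonneg_nonneg mult_nonneg_nonneg) simp_all
  qed
  have p6: "14625*a^6 + 22480*a^5*b + 17045*a^4*b^2 + 524650*a^3*b^3 + 3200050*a^2*b^4 + 3479000*a*b^5
      + 1401000*b^6 \<ge> 0"
  proof -
    have eq: "14625*a^6 + 22480*a^5*b + 17045*a^4*b^2 + 524650*a^3*b^3 + 3200050*a^2*b^4 + 3479000*a*b^5
      + 1401000*b^6 = 14000*(a^3 + 4/5*a^2*b - 2*a*b^2 - 7/5*b^3)^2
      + 60000*(a^2*b + 5*a*b^2 + 29/10*b^3)^2 + 1300000*(a*b^2 + 16/25*b^3)^2 + 210000*(b^3)^2
      + 20*(a^3 + 2*a^2*b)^2 + 4325/2*(a^2*b + 2*a*b^2)^2 + 850*(a*b^2 - 2*b^3)^2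
      + 605*(a^3)^2 + 3685/2*(a^2*b)^2 + 17910*(a*b^2)^2 + 123080*(b^3)^2"
      by algebra
    show ?thesis unfolding eq by (intro add_nonneg_nonneg mult_nonneg_nonneg) simp_all
  qed
  have p8: "5496*a^8 + 2120*a^7*b + 37565*a^6*b^2 + 635280*a^5*b^3 + 2482060*a^4*b^4 + 3119200*a^3*b^5
      + 9298800*a^2*b^6 + 16150400*a*b^7 + 12622400*b^8 \<ge> 0"
  proof -
    have eq: "5496*a^8 + 2120*a^7*b + 37565*a^6*b^2 + 635280*a^5*b^3 + 2482060*a^4*b^4 + 3119200*a^3*b^5
      + 9298800*a^2*b^6 + 16150400*a*b^7 + 12622400*b^8 =
      4600*(a^4 + 23/100*a^3*b - 11*a^2*b^2 + 13/5*a*b^3 + 15*b^4)^2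
      + 130000*(a^3*b + 12/5*a^2*b^2 - 17/100*a*b^3 - 19/10*b^4)^2
      + 1000000*(a^2*b^2 + 19/10*a*b^3 + b^4)^2 + 5900000*(a*b^3 + 99/100*b^4)^2 + 2900000*(b^4)^2
      + (a^4 + 2*a^3*b)^2 + 2659*(a^3*b + 2*a^2*b^2)^2 + 37665*(a^2*b^2 + 2*a*b^3)^2
      + 56405*(a*b^3 + 2*b^4)^2
      + 895*(a^4)^2 + 292933/50*(a^3*b)^2 + 145287/5*(a^2*b^2)^2 + 250482*(a*b^3)^2 + 1209890*(b^4)^2"
      by algebra
    show ?thesis unfolding eq by (intro add_nonneg_nonneg mult_nonneg_nonneg) simp_all
  qed
  \<comment> \<open>This settles the balance: \<open>15000*b^2\<close> and
    \<open>1000000*b^6\<close> were held back from the coefficients 27636 and 2401000. The constant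
    336 makes the inequality strict.\<close>
  have eq: "15000*b^2 - 240000*b^4 + 1000000*b^6 = 15000*(b - 8*b^3)^2 + 40000*(b^3)^2" by algebra
  have "15000*b^2 - 240000*b^4 + 1000000*b^6 \<ge> 0"
    unfolding eq by (intro add_nonneg_nonneg mult_nonneg_nonneg) simp_all
  with p2 p4 p6 p8 show ?thesis by linarith
qed

text \<open>In the coordinate \<open>q\<close> with \<open>q^2 / 2\<close> equal to the integral of
  \<open>(v - b * v^2 - c * v^3 - d * v^4) / (1 + a * v)\<close>, the density \<open>v'(q) / (1 + a * v)\<close> has the even
  coefficients below. At \<open>a = -1\<close>, \<open>b = c = d = 0\<close> they become \<open>1/12\<close>, \<open>1/864\<close> and
  \<open>-139/777600\<close>, which belong to the variable \<open>1 - 1 / x^4\<close>.\<close>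

definition be_coeff2 :: "real \<Rightarrow> real \<Rightarrow> real \<Rightarrow> real" where
  "be_coeff2 a b c = (a^2 - a * b + 10 * b^2 + 9 * c) / 12"

definition be_coeff4 :: "real \<Rightarrow> real \<Rightarrow> real \<Rightarrow> real \<Rightarrow> real" where
  "be_coeff4 a b c d = (a^4 - 2*a^3*b + 21*a^2*b^2 + 18*a^2*c + 700*a*b^3 + 1134*a*b*c + 432*a*d + 1540*b^4
      + 3780*b^2*c + 2016*b*d + 945*c^2) / 864"

definition be_coeff6 :: "real \<Rightarrow> real \<Rightarrow> real \<Rightarrow> real \<Rightarrow> real" where
  "be_coeff6 a b c d = (-139*a^6 + 417*a^5*b - 699*a^4*b^2 - 297*a^4*c + 11935*a^3*b^3 + 18738*a^3*b*c
      + 6912*a^3*d + 690690*a^2*b^4 + 1590435*a^2*b^2*c + 799632*a^2*b*d + 358911*a^2*c^2 + 3303300*a*b^5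
      + 10270260*a*b^3*c + 5987520*a*b^2*d + 5519745*a*b*c^2 + 2531088*a*c*d + 3403400*b^6 + 13513500*b^4*c
      + 8648640*b^3*d + 12162150*b^2*c^2 + 8981280*b*c*d + 1403325*c^3 + 979776*d^2) / 777600"

text \<open>The three hypotheses express that the coefficients of \<open>R^2\<close>,
  \<open>R^4\<close>, \<open>R^6\<close> in the period vanish. Solved one after the other they force
  the values -1/12, 1/864, 139/777600: through degree 6 the even part of \<open>be\<close> would be
  the even part of \<open>al\<close> at imaginary argument.\<close>

lemma no_real_solution:
  fixes a b c d :: real
  assumes e2: "1/12 + be_coeff2 a b c = 0"
    and e4: "3/4 * (1/864 + be_coeff4 a b c d) + 1/4 * (1/12 * be_coeff2 a b c) = 0"
    and e6: "5/8 * (- 139/777600 + be_coeff6 a b c d) + 1/8 * (1/864 * be_coeff2 a b c + 1/12 * be_coeff4 a b c d) = 0"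
  shows False
proof -
  have c: "c = - (a^2 - a*b + 10*b^2 + 1) / 9" using e2 by (simp add: be_coeff2_def field_simps)
  have lin4: "3/4 * (1/864 + x) + 1/4 * (1/12 * (- 1/12)) = 0 \<Longrightarrow> x = 1/864" for x :: real by simp
  have lin6: "5/8 * (- 139/777600 + x) + 1/8 * (1/864 * (- 1/12) + 1/12 * (1/864)) = 0 \<Longrightarrow> x = 139/777600"
    for x :: real by simp
  have b2: "be_coeff2 a b c = - 1/12" using e2 by linarith
  have b4: "be_coeff4 a b c d = 1/864" using e4 unfolding b2 by (rule lin4)
  have b6: "be_coeff6 a b c d = 139/777600" using e6 unfolding b2 b4 by (rule lin6)
  \<comment> \<open>Eliminating \<open>c\<close> leaves an equation linear in \<open>d\<close> and one quadratic in \<open>d\<close>;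
    their resultant is a multiple of the positive polynomial above.\<close>
  define L where "L = 81*a + 378*b"
  define N where "N = 2*a^4 - 28*a^3*b - 9*a^2*b^2 + 4*a^2 - 70*a*b^3 - 28*a*b - 280*b^4 - 35*b^2 + 2"
  define p where "p = (50*a^6 + 1320*a^5*b - 2742*a^4*b^2 + 65*a^4 + 3880*a^3*b^3 + 2852*a^3*b + 3360*a^2*b^4
      - 945*a^2*b^2 - 28*a^2 - 46200*a*b^5 + 770*a*b^3 + 1540*a*b + 30800*b^6 + 19250*b^4 + 1925*b^2
      - 43) / 1080"
  define q where "q = (-635 * a^3 + 192 * a^2 * b + 9660 * a * b^2 - 651 * a - 3080 * b^3 - 2310 * b) / 120"
  have "L * d + N = 162 * (be_coeff4 a b c d - 1/864)"
    unfolding c L_def N_def be_coeff4_def by (simp add: field_simps power_numeral_reduce)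
  then have d: "L * d = - N" unfolding b4 by simp
  have "189/10*d^2 + q*d + p = 15 * (be_coeff6 a b c d - 139/777600)"
    unfolding c p_def q_def be_coeff6_def by (simp add: field_simps power_numeral_reduce)
  then have "189/10*d^2 + q*d + p = 0" unfolding b6 by simp
  \<comment> \<open>Scaling by \<open>L^2\<close> before substituting \<open>L * d = - N\<close>
    avoids a division by \<open>L\<close>, which may vanish.\<close>
  then have "189/10*(L*d)^2 + q*(L*d)*L + p*L^2 = 0" by algebra
  then have "189/10*N^2 - q*N*L + p*L^2 = 0" unfolding d by simp
  also have "189/10*N^2 - q*N*L + p*L^2 = 9/40*(5496*a^8 + 2120*a^7*b + 37565*a^6*b^2 + 14625*a^6 + 635280*a^5*b^3 + 22480*a^5*b
    + 2482060*a^4*b^4 + 17045*a^4*b^2 + 12882*a^4 + 3119200*a^3*b^5 + 524650*a^3*b^3 + 32420*a^3*b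
    + 9298800*a^2*b^6 + 3200050*a^2*b^4 + 11340*a^2*b^2 + 4089*a^2 + 16150400*a*b^7
    + 3479000*a*b^5 - 187320*a*b^3 + 11844*a*b + 12622400*b^8 + 2401000*b^6 + 95060*b^4
    + 27636*b^2 + 336)"
    unfolding N_def q_def L_def p_def by algebra
  finally show False using resultant_positive[of a b] by simp
qed

subsection \<open>Power series coefficients of the Morse coordinates\<close>

text \<open>Degree \<open>n - 1\<close> of the first identity and degree \<open>n\<close> of the
  second express \<open>n * V$n - B$(n-1)\<close> and \<open>V$n + B$(n-1)\<close> by earlier
  coefficients. This is a linear system of determinant \<open>n + 1\<close>, which
  \<open>lin\<close> solves; it is run from \<open>n = 2\<close> to \<open>n = 7\<close>.\<close>

lemma morse_coeffs:
  fixes V B :: "real fps"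
  assumes V0: "V $ 0 = 0" and V1: "V $ 1 = 1"
    and B: "B * (1 + fps_const a * V) = fps_deriv V"
    and f: "B * (V - fps_const b * V^2 - fps_const c * V^3 - fps_const d * V^4) = fps_X"
  shows "B $ 0 = 1" "B $ 2 = be_coeff2 a b c"
    "B $ 4 = be_coeff4 a b c d"
    "B $ 6 = be_coeff6 a b c d"
proof -
  have lin: "v = (e1 + e2) * (1/m)" "w = (k * e2 - e1) * (1/m)" if "k * v = w + e1" "v + w = e2" "m = k + 1" "m \<noteq> 0"
    for k m v w e1 e2 :: real
    using that by (auto simp: field_simps)
  define W2 where "W2 = V*V"
  define W3 where "W3 = V*W2"
  define W4 where "W4 = V*W3"
  define G where "G = V - fps_const b * W2 - fps_const c * W3 - fps_const d * W4"
  have BG: "B * G = fps_X" using f by (simp add: G_def W2_def W3_def W4_def power_numeral_reduce)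
  have mult: "(f*g) $ 1 = f$0*g$1+f$1*g$0" "(f*g) $ 2 = f$0*g$2+f$1*g$1+f$2*g$0"
    "(f*g) $ 3 = f$0*g$3+f$1*g$2+f$2*g$1+f$3*g$0"
    "(f*g) $ 4 = f$0*g$4+f$1*g$3+f$2*g$2+f$3*g$1+f$4*g$0"
    "(f*g) $ 5 = f$0*g$5+f$1*g$4+f$2*g$3+f$3*g$2+f$4*g$1+f$5*g$0"
    "(f*g) $ 6 = f$0*g$6+f$1*g$5+f$2*g$4+f$3*g$3+f$4*g$2+f$5*g$1+f$6*g$0"
    "(f*g) $ 7 = f$0*g$7+f$1*g$6+f$2*g$5+f$3*g$4+f$4*g$3+f$5*g$2+f$6*g$1+f$7*g$0"
    for f g :: "real fps"
    by (simp_all add: fps_mult_nth eval_nat_numeral)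
  note s = V0 V1[unfolded One_nat_def] mult[unfolded One_nat_def]
  have W20: "W2$0=0" "W2$1=0" "W2$2=1" "W2$3=2*V$2" "W2$4=2*V$3+(V$2)^2" "W2$5=2*V$4+2*V$2*V$3"
    "W2$6=2*V$5+2*V$2*V$4+(V$3)^2" "W2$7=2*V$6+2*V$2*V$5+2*V$3*V$4"
    by (simp_all add: W2_def s power2_eq_square)
  note s = s W20[unfolded One_nat_def]
  have W30: "W3$0=0" "W3$1=0" "W3$2=0" "W3$3=1" "W3$4=3*V$2" "W3$5=3*V$3+3*(V$2)^2"
    "W3$6=3*V$4+6*V$2*V$3+(V$2)^3" "W3$7=3*V$5+6*V$2*V$4+3*(V$3)^2+3*(V$2)^2*V$3"
    by (simp_all add: W3_def s power2_eq_square power3_eq_cube algebra_simps)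
  note s = s W30[unfolded One_nat_def]
  have W40: "W4$0=0" "W4$1=0" "W4$2=0" "W4$3=0" "W4$4=1" "W4$5=4*V$2" "W4$6=4*V$3+6*(V$2)^2"
     "W4$7=4*V$4+12*V$2*V$3+4*(V$2)^3"
    by (simp_all add: W4_def s power2_eq_square power3_eq_cube algebra_simps)
  note s = s W40[unfolded One_nat_def]
  have G0: "G$0=0" "G$1=1" "G$2=V$2-b" "G$3=V$3-b*W2$3-c" "G$4=V$4-b*W2$4-c*W3$4-d"
    "G$5=V$5-b*W2$5-c*W3$5-d*W4$5" "G$6=V$6-b*W2$6-c*W3$6-d*W4$6" "G$7=V$7-b*W2$7-c*W3$7-d*W4$7"
    unfolding G_def by (simp_all add: s)
  note bg = BG[THEN arg_cong[where f = "\<lambda>F. F $ n" for n]]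
  note bv = B[THEN arg_cong[where f = "\<lambda>F. F $ n" for n]]
  show b0: "B $ 0 = 1" using bg[of 1] by (simp add: s G0[unfolded One_nat_def])
  have Suc_num: "Suc (Suc 0) = 2" "Suc 2 = 3" "Suc 3 = 4" "Suc 4 = 5" "Suc 5 = 6" "Suc 6 = 7" by simp_all
  note s = s b0 Suc_num
  note g = G0[unfolded One_nat_def]
  have p: "2 * V$2 = B$1 + a * (1)"
    using bv[of 1] by (simp add: s algebra_simps)
  have q: "V$2 + B$1 = b*W2$2"
    using bg[of 2] by (simp add: s g algebra_simps)
  have y2: "V $2 = (a + b) * (1/3)"
    by (rule trans[OF lin(1)[where m = 3, OF p q]], simp, simp, unfold g W20 W30 W40) algebra
  have x1: "B $1 = (-a + 2 * b) * (1/3)"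
    by (rule trans[OF lin(2)[where m = 3, OF p q]], simp, simp, unfold g W20 W30 W40) algebra
  have p: "3 * V$3 = B$2 + a * (V$2 + B$1 * 1)"
    using bv[of 2] by (simp add: s algebra_simps)
  have q: "V$3 + B$2 = b*W2$3 + c*W3$3 - B$1 * G$2"
    using bg[of 3] by (simp add: s g algebra_simps)
  have y3: "V $3 = (a^2 + 11 * a * b + 10 * b^2 + 9 * c) * (1/36)"
    by (rule trans[OF lin(1)[where m = 4, OF p q]], simp, simp, unfold g W20 W30 W40 x1 y2) algebra
  have x2: "B $2 = (a^2 - a * b + 10 * b^2 + 9 * c) * (1/12)"
    by (rule trans[OF lin(2)[where m = 4, OF p q]], simp, simp, unfold g W20 W30 W40 x1 y2) algebra
  have p: "4 * V$4 = B$3 + a * (V$3 + B$1 * V$2 + B$2 * 1)"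
    using bv[of 3] by (simp add: s algebra_simps)
  have q: "V$4 + B$3 = b*W2$4 + c*W3$4 + d*W4$4 - B$1 * G$3 - B$2 * G$2"
    using bg[of 4] by (simp add: s g algebra_simps)
  have y4: "V $4 = (- (a^3) + 24 * a^2 * b + 105 * a * b^2 + 81 * a * c + 80 * b^3 + 135 * b * c + 54 * d) * (1/270)"
    by (rule trans[OF lin(1)[where m = 5, OF p q]], simp, simp, unfold g W20 W30 W40 x1 x2 y2 y3) algebra
  have x3: "B $3 = (-2 * a^3 + 3 * a^2 * b + 30 * a * b^2 + 27 * a * c + 160 * b^3 + 270 * b * c + 108 * d) * (1/135)"
    by (rule trans[OF lin(2)[where m = 5, OF p q]], simp, simp, unfold g W20 W30 W40 x1 x2 y2 y3) algebra
  have p: "5 * V$5 = B$4 + a * (V$4 + B$1 * V$3 + B$2 * V$2 + B$3 * 1)"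
    using bv[of 4] by (simp add: s algebra_simps)
  have q: "V$5 + B$4 = b*W2$5 + c*W3$5 + d*W4$5 - B$1 * G$4 - B$2 * G$3 - B$3 * G$2"
    using bg[of 5] by (simp add: s g algebra_simps)
  have y5: "V $5 = (a^4 + 22*a^3*b + 861*a^2*b^2 + 594*a^2*c + 2380*a*b^3 + 3654*a*b*c + 1296*a*d + 1540*b^4
      + 3780*b^2*c + 2016*b*d + 945*c^2)*(1/4320)"
    by (rule trans[OF lin(1)[where m = 6, OF p q]], simp, simp, unfold g W20 W30 W40 x1 x2 x3 y2 y3 y4) algebra
  have x4: "B $4 = (a^4 - 2*a^3*b + 21*a^2*b^2 + 18*a^2*c + 700*a*b^3 + 1134*a*b*c + 432*a*d + 1540*b^4
      + 3780*b^2*c + 2016*b*d + 945*c^2)*(1/864)"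
    by (rule trans[OF lin(2)[where m = 6, OF p q]], simp, simp, unfold g W20 W30 W40 x1 x2 x3 y2 y3 y4) algebra
  have p: "6 * V$6 = B$5 + a * (V$5 + B$1 * V$4 + B$2 * V$3 + B$3 * V$2 + B$4 * 1)"
    using bv[of 5] by (simp add: s algebra_simps)
  have q: "V$6 + B$5 = b*W2$6 + c*W3$6 + d*W4$6 - B$1 * G$5 - B$2 * G$4 - B$3 * G$3 - B$4 * G$2"
    using bg[of 6] by (simp add: s g algebra_simps)
  have y6: "V $6 = (a^5 - 13*a^4*b + 721*a^3*b^2 + 468*a^3*c + 6895*a^2*b^3 + 9828*a^2*b*c + 3186*a^2*d
      + 14000*a*b^4 + 32130*a*b^2*c + 15876*a*b*d + 7371*a*c^2 + 7840*b^5 + 25200*b^3*c + 15120*b^2*d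
      + 14175*b*c^2 + 6804*c*d)*(1/17010)"
    by (rule trans[OF lin(1)[where m = 7, OF p q]], simp, simp, unfold g W20 W30 W40 x1 x2 x3 x4 y2 y3 y4 y5) algebra
  have x5: "B $5 = (2*a^5 - 5*a^4*b - 7*a^3*b^2 - 9*a^3*c + 1190*a^2*b^3 + 1890*a^2*b*c + 702*a^2*d
      + 11200*a*b^4 + 26460*a*b^2*c + 13608*a*b*d + 6237*a*c^2 + 15680*b^5 + 50400*b^3*c + 30240*b^2*d
      + 28350*b*c^2 + 13608*c*d)*(1/5670)"
    by (rule trans[OF lin(2)[where m = 7, OF p q]], simp, simp, unfold g W20 W30 W40 x1 x2 x3 x4 y2 y3 y4 y5) algebra
  have p: "7 * V$7 = B$6 + a * (V$6 + B$1 * V$5 + B$2 * V$4 + B$3 * V$3 + B$4 * V$2 + B$5 * 1)"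
    using bv[of 6] by (simp add: s algebra_simps)
  have q: "V$7 + B$6 = b*W2$7 + c*W3$7 + d*W4$7 - B$1 * G$6 - B$2 * G$5 - B$3 * G$4 - B$4 * G$3 - B$5 * G$2"
    using bg[of 7] by (simp add: s g algebra_simps)
  have x6: "B $6 = (-139*a^6 + 417*a^5*b - 699*a^4*b^2 - 297*a^4*c + 11935*a^3*b^3 + 18738*a^3*b*c
      + 6912*a^3*d + 690690*a^2*b^4 + 1590435*a^2*b^2*c + 799632*a^2*b*d + 358911*a^2*c^2 + 3303300*a*b^5
      + 10270260*a*b^3*c + 5987520*a*b^2*d + 5519745*a*b*c^2 + 2531088*a*c*d + 3403400*b^6 + 13513500*b^4*c
      + 8648640*b^3*d + 12162150*b^2*c^2 + 8981280*b*c*d + 1403325*c^3 + 979776*d^2)*(1/777600)"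
    by (rule trans[OF lin(2)[where m = 8, OF p q]], simp, simp, unfold g W20 W30 W40 x1 x2 x3 x4 x5 y2 y3 y4 y5 y6) algebra
  show "B $ 2 = be_coeff2 a b c" "B $ 4 = be_coeff4 a b c d" "B $ 6 = be_coeff6 a b c d"
    unfolding be_coeff2_def be_coeff4_def be_coeff6_def using x2 x4 x6 by simp_all
qed

subsection \<open>Real analytic Morse coordinates\<close>

lemma fps_nth_fps_expansion_real:
  fixes f :: "real \<Rightarrow> real"
  assumes "f has_fps_expansion F"
  shows "(deriv ^^ n) f 0 = fact n * F $ n"
  using assms
proof (induction n arbitrary: f F)
  case 0
  then show ?case by (simp add: has_fps_expansion_imp_0_eq_fps_nth_0)
next
  case (Suc n)
  have "(deriv ^^ Suc n) f 0 = (deriv ^^ n) (deriv f) 0"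
    by (simp add: funpow_swap1)
  also have "\<dots> = fact n * fps_deriv F $ n"
    by (rule Suc.IH) (intro fps_expansion_intros Suc.prems)
  finally show ?case by (simp add: mult_ac)
qed

section \<open>Real analytic functions through their holomorphic extensions\<close>

lemma has_fps_expansion_complexify:
  fixes f :: "real \<Rightarrow> real"
  assumes "f has_fps_expansion F"
  defines "Fc \<equiv> Abs_fps (\<lambda>n. complex_of_real (F $ n))"
  shows "eval_fps Fc has_fps_expansion Fc"
    and "eventually (\<lambda>x. eval_fps Fc (of_real x) = of_real (f x)) (nhds 0)"
proof -
  have r: "fps_conv_radius Fc = fps_conv_radius F"
    unfolding fps_conv_radius_def Fc_def by (rule conv_radius_cong) simp
  then show "eval_fps Fc has_fps_expansion Fc"
    using assms by (intro eval_fps_has_fps_expansion) (simp add: has_fps_expansion_def)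
  have "eventually (\<lambda>x. x \<in> eball 0 (fps_conv_radius F)) (nhds 0)"
    using assms by (intro eventually_nhds_in_open) (auto simp: has_fps_expansion_def zero_ereal_def)
  moreover have "eventually (\<lambda>x. eval_fps F x = f x) (nhds 0)"
    using assms by (simp add: has_fps_expansion_def)
  ultimately show "eventually (\<lambda>x. eval_fps Fc (of_real x) = of_real (f x)) (nhds 0)"
  proof eventually_elim
    case (elim x)
    have "(\<lambda>n. F $ n * x ^ n) sums f x"
      using sums_eval_fps[of x F] elim by simp
    then have "(\<lambda>n. complex_of_real (F $ n * x ^ n)) sums of_real (f x)"
      by (rule sums_of_real)
    then show ?case
      by (simp add: eval_fps_def Fc_def sums_iff)
  qed
qed

text \<open>The way back from \<open>has_fps_expansion_complexify\<close>. Compositions, square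
  roots and local inverses are formed in the complex plane and return to the real line as soon as
  the result is known to be real on the real axis.\<close>

lemma has_fps_expansion_realify:
  fixes f :: "real \<Rightarrow> real"
  assumes g: "g has_fps_expansion G"
    and fg: "eventually (\<lambda>x. g (of_real x) = of_real (f x)) (nhds 0)"
  shows "f has_fps_expansion Abs_fps (\<lambda>n. Re (G $ n))"
proof (rule has_fps_expansionI)
  have "filterlim complex_of_real (nhds 0) (nhds 0)"
    using tendsto_of_real[OF filterlim_ident[of "nhds (0::real)"]] by simp
  moreover have "eventually (\<lambda>z. z \<in> eball 0 (fps_conv_radius G)) (nhds 0)"
    using g by (intro eventually_nhds_in_open) (auto simp: has_fps_expansion_def zero_ereal_def)
  moreover have "eventually (\<lambda>z. eval_fps G z = g z) (nhds 0)"
    using g by (simp add: has_fps_expansion_def)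
  ultimately have "eventually (\<lambda>x. complex_of_real x \<in> eball 0 (fps_conv_radius G)) (nhds 0)"
      "eventually (\<lambda>x. eval_fps G (complex_of_real x) = g (of_real x)) (nhds 0)"
    by (auto simp: filterlim_iff)
  with fg show "eventually (\<lambda>x. (\<lambda>n. Abs_fps (\<lambda>n. Re (G $ n)) $ n * x ^ n) sums f x) (nhds 0)"
  proof eventually_elim
    case (elim x)
    have "(\<lambda>n. G $ n * of_real x ^ n) sums complex_of_real (f x)"
      using sums_eval_fps[of "complex_of_real x" G] elim by simp
    from sums_Re[OF this] show ?case
      by (simp flip: of_real_power)
  qed
qed

lemma has_fps_expansion_compose_real:
  fixes f g :: "real \<Rightarrow> real"
  assumes f: "f has_fps_expansion F" and g: "g has_fps_expansion G" "G $ 0 = 0"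
  shows "\<exists>H. (\<lambda>x. f (g x)) has_fps_expansion H"
proof -
  define Fc where "Fc = Abs_fps (\<lambda>n. complex_of_real (F $ n))"
  define Gc where "Gc = Abs_fps (\<lambda>n. complex_of_real (G $ n))"
  note F = has_fps_expansion_complexify[OF f, folded Fc_def]
  note G = has_fps_expansion_complexify[OF g(1), folded Gc_def]
  have exp: "(eval_fps Fc \<circ> eval_fps Gc) has_fps_expansion fps_compose Fc Gc"
    by (intro has_fps_expansion_compose F G) (simp add: Gc_def g)
  have "g 0 = 0" using g by (simp add: has_fps_expansion_imp_0_eq_fps_nth_0)
  then have "filterlim g (nhds 0) (nhds 0)"
    using has_fps_expansion_imp_continuous[OF g(1), of UNIV] by (simp add: continuous_within filterlim_at_within_not_equal tendsto_nhds_iff)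
  with F(2) have "eventually (\<lambda>x. eval_fps Fc (of_real (g x)) = of_real (f (g x))) (nhds 0)"
    by (auto simp: filterlim_iff)
  with G(2) have "eventually (\<lambda>x. (eval_fps Fc \<circ> eval_fps Gc) (of_real x) = of_real (f (g x))) (nhds 0)"
    by eventually_elim simp
  from has_fps_expansion_realify[OF exp this] show ?thesis by blast
qed

lemma fps_expansion_pos:
  fixes f :: "real \<Rightarrow> real"
  assumes "f has_fps_expansion F" "F $ 0 > 0"
  shows "eventually (\<lambda>x. f x > 0) (nhds 0)"
proof -
  have "isCont f 0" using has_fps_expansion_imp_continuous[OF assms(1), of UNIV] by simp
  moreover have "f 0 > 0" using assms by (simp add: has_fps_expansion_imp_0_eq_fps_nth_0)
  ultimately show ?thesis
    using order_tendstoD(1)[of f "f 0" "nhds 0" 0] by (simp add: isCont_def tendsto_nhds_iff)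
qed

lemma has_fps_expansion_sqrt:
  fixes f :: "real \<Rightarrow> real"
  assumes f: "f has_fps_expansion F" and "F $ 0 > 0"
  shows "\<exists>H. (\<lambda>x. sqrt (f x)) has_fps_expansion H"
proof -
  define Fc where "Fc = Abs_fps (\<lambda>n. complex_of_real (F $ n))"
  note F = has_fps_expansion_complexify[OF f, folded Fc_def]
  have "(\<lambda>z. csqrt (eval_fps Fc z)) analytic_on {0}"
  proof (rule analytic_on_csqrt')
    show "eval_fps Fc analytic_on {0}" by (rule has_fps_expansion_imp_analytic_0[OF F(1)])
    show "eval_fps Fc z \<notin> \<real>\<^sub>\<le>\<^sub>0" if "z \<in> {0}" for z
      using that assms(2) by (simp add: eval_fps_at_0 Fc_def)
  qed
  then have exp: "(\<lambda>z. csqrt (eval_fps Fc z)) has_fps_expansion fps_expansion (\<lambda>z. csqrt (eval_fps Fc z)) 0"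
    by (rule analytic_at_imp_has_fps_expansion_0)
  have "eventually (\<lambda>x. f x > 0) (nhds 0)" by (rule fps_expansion_pos[OF assms])
  with F(2) have "eventually (\<lambda>x. csqrt (eval_fps Fc (of_real x)) = of_real (sqrt (f x))) (nhds 0)"
    by eventually_elim simp
  from has_fps_expansion_realify[OF exp this] show ?thesis by blast
qed

lemma has_real_derivative_of_fps_expansion:
  fixes f :: "real \<Rightarrow> real"
  assumes "f has_fps_expansion F"
  shows "eventually (\<lambda>x. (f has_real_derivative eval_fps (fps_deriv F) x) (at x)) (nhds 0)"
proof -
  have "eventually (\<lambda>x. x \<in> eball 0 (fps_conv_radius F)) (nhds 0)"
    using assms by (intro eventually_nhds_in_open) (auto simp: has_fps_expansion_def zero_ereal_def)
  moreover have "eventually (\<lambda>x. eventually (\<lambda>x. eval_fps F x = f x) (nhds x)) (nhds 0)"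
    using assms unfolding eventually_eventually by (simp add: has_fps_expansion_def)
  ultimately show ?thesis
  proof eventually_elim
    case (elim x)
    have "(eval_fps F has_real_derivative eval_fps (fps_deriv F) x) (at x)"
      using elim by (intro has_field_derivative_eval_fps) simp
    then show ?case
      by (rule DERIV_cong_ev[OF refl elim(2) refl, THEN iffD1])
  qed
qed

text \<open>The holomorphic extension has a local inverse because its derivative at 0 does not
  vanish. The remaining point is that this inverse is real on the real axis, which follows from the
  intermediate value theorem for \<open>f\<close> itself.\<close>

lemma real_analytic_inverse:
  fixes f :: "real \<Rightarrow> real"
  assumes f: "f has_fps_expansion F" and F0: "F $ 0 = 0" and F1: "F $ 1 > 0"
  obtains g G where "g has_fps_expansion G" "G $ 0 = 0"
    "eventually (\<lambda>x. g (f x) = x) (nhds 0)" "eventually (\<lambda>x. f (g x) = x) (nhds 0)"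
proof -
  define Fc where "Fc = Abs_fps (\<lambda>n. complex_of_real (F $ n))"
  define fc where "fc = eval_fps Fc"
  note Fc = has_fps_expansion_complexify[OF f, folded Fc_def, folded fc_def]
  obtain S where S: "open S" "0 \<in> S" "fc holomorphic_on S"
    using has_fps_expansion_imp_holomorphic[OF Fc(1)] by blast
  have "deriv fc 0 = of_real (F $ 1)"
    using fps_nth_fps_expansion[OF Fc(1), of 1] by (simp add: Fc_def)
  then have "deriv fc 0 \<noteq> 0" using F1 by simp
  then obtain r where r: "r > 0" "ball 0 r \<subseteq> S" "inj_on fc (ball 0 r)"
    using has_complex_derivative_locally_injective[OF S(3,2,1)] by blast
  obtain gc where gc: "gc holomorphic_on (fc ` ball 0 r)" "\<And>z. z \<in> ball 0 r \<Longrightarrow> gc (fc z) = z"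
    using holomorphic_has_inverse[of fc "ball 0 r"] S(3) r by (metis holomorphic_on_subset open_ball)
  have op: "open (fc ` ball 0 r)"
    using S(3) r by (intro open_mapping_thm3) (auto intro: holomorphic_on_subset)
  have fc0: "fc 0 = 0" by (simp add: fc_def eval_fps_at_0 Fc_def F0)
  have "0 \<in> fc ` ball 0 r" using fc0 r(1) by (metis centre_in_ball imageI)
  then have gexp: "gc has_fps_expansion fps_expansion gc 0"
    using op gc(1) by (intro has_fps_expansion_fps_expansion)
  have gc0: "gc 0 = 0" using gc(2)[of 0] fc0 r(1) by simp
  from Fc(2) has_real_derivative_of_fps_expansion[OF f]
  have "eventually (\<lambda>x. fc (of_real x) = of_real (f x) \<and>
      (f has_real_derivative eval_fps (fps_deriv F) x) (at x)) (nhds 0)"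
    by eventually_elim simp
  then obtain e where e: "e > 0" "\<And>x. \<bar>x\<bar> < e \<Longrightarrow> fc (of_real x) = of_real (f x)"
      "\<And>x. \<bar>x\<bar> < e \<Longrightarrow> (f has_real_derivative eval_fps (fps_deriv F) x) (at x)"
    by (auto simp: eventually_nhds_metric dist_real_def)
  have f0: "f 0 = 0" using f F0 by (simp add: has_fps_expansion_imp_0_eq_fps_nth_0)
  have d0: "(f has_real_derivative F $ 1) (at 0)"
    using e(3)[of 0] e(1) by (simp add: eval_fps_at_0)
  define d where "d = min (e/2) (r/2)"
  have d: "d > 0" "d < e" "d < r" using e(1) r(1) by (auto simp: d_def)
  obtain d1 where d1: "d1 > 0" "\<And>h. h > 0 \<Longrightarrow> h < d1 \<Longrightarrow> f 0 < f (0 + h)"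
    using DERIV_pos_inc_right[OF d0 F1] by blast
  obtain d2 where d2: "d2 > 0" "\<And>h. h > 0 \<Longrightarrow> h < d2 \<Longrightarrow> f (0 - h) < f 0"
    using DERIV_pos_inc_left[OF d0 F1] by blast
  define h where "h = min d (min (d1/2) (d2/2))"
  have h: "h > 0" "h \<le> d" "h < d1" "h < d2" using d d1 d2 by (auto simp: h_def)
  have fh: "f (-h) < 0" "f h > 0" using d1(2)[of h] d2(2)[of h] h f0 by auto
  \<comment> \<open>Every small real \<open>x\<close> is a value \<open>f s\<close> at a real
    \<open>s\<close>, and then the complex inverse sends \<open>x\<close> to that real
    \<open>s\<close>.\<close>
  have surj: "\<exists>s. \<bar>s\<bar> \<le> h \<and> f s = x" if "f (-h) \<le> x" "x \<le> f h" for x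
  proof -
    have "\<exists>s\<ge>-h. s \<le> h \<and> f s = x"
    proof (intro IVT that allI impI)
      fix s assume "- h \<le> s \<and> s \<le> h"
      then show "isCont f s" using h d by (intro DERIV_isCont[OF e(3)]) auto
    qed (use h in simp)
    then show ?thesis by (auto simp: abs_le_iff)
  qed
  have gf: "gc (of_real (f s)) = of_real s" if "\<bar>s\<bar> \<le> h" for s
    using gc(2)[of "of_real s"] e(2)[of s] that h d by simp
  define g where "g = (\<lambda>x. Re (gc (of_real x)))"
  have g: "gc (of_real x) = of_real (g x) \<and> f (g x) = x" if x: "f (-h) < x" "x < f h" for x
  proof -
    obtain s where "\<bar>s\<bar> \<le> h" "f s = x"
      using surj[OF less_imp_le[OF x(1)] less_imp_le[OF x(2)]] by blast
    with gf[of s] show ?thesis by (auto simp: g_def)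
  qed
  have "eventually (\<lambda>x. x \<in> {f (-h) <..< f h}) (nhds 0)"
    using fh by (intro eventually_nhds_in_open) auto
  then have ev: "eventually (\<lambda>x. gc (of_real x) = of_real (g x)) (nhds 0)"
      "eventually (\<lambda>x. f (g x) = x) (nhds 0)"
    using g by (auto elim!: eventually_mono)
  have "eventually (\<lambda>x::real. x \<in> {-h <..< h}) (nhds 0)"
    using h by (intro eventually_nhds_in_open) auto
  then have "eventually (\<lambda>x. g (f x) = x) (nhds 0)"
    by (rule eventually_mono) (auto simp: g_def gf abs_le_iff)
  moreover have "fps_expansion gc 0 $ 0 = 0"
    using gexp gc0 by (simp add: has_fps_expansion_imp_0_eq_fps_nth_0)
  ultimately show ?thesis
    using has_fps_expansion_realify[OF gexp ev(1)] ev(2) by (intro that) auto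
qed

text \<open>The Morse lemma in one variable. With the primitive \<open>\<Phi>\<close> of
  \<open>\<phi>\<close>, the new coordinate is the root \<open>Y\<close> of
  \<open>2 * \<Phi>\<close> that has the sign of \<open>x\<close>, and \<open>y\<close> is its
  inverse; differentiating \<open>2 * \<Phi> (y s) = s^2\<close> gives the last conclusion.\<close>

lemma morse_coordinate:
  fixes \<phi> :: "real \<Rightarrow> real"
  assumes \<phi>: "\<phi> has_fps_expansion F" and F0: "F $ 0 = 0" and F1: "F $ 1 = 1"
  obtains y Y G H where "y has_fps_expansion G" "G $ 0 = 0" "G $ 1 = 1"
    "Y has_fps_expansion H" "H $ 0 = 0" "H $ 1 = 1"
    "eventually (\<lambda>x. y (Y x) = x) (nhds 0)"
    "eventually (\<lambda>x. eval_fps (fps_deriv G) x * \<phi> (y x) = x) (nhds 0)"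
proof -
  define I where "I = fps_integral0 F"
  have I': "fps_deriv I = F" by (simp add: I_def fps_deriv_fps_integral)
  have Ic: "fps_conv_radius I = fps_conv_radius F"
  proof -
    have "conv_radius (fps_nth I) \<ge> conv_radius (fps_nth F)"
    proof (rule conv_radius_geI_ex)
      fix s :: real assume s: "s > 0" "ereal s < conv_radius (fps_nth F)"
      have "summable (\<lambda>n. norm (F $ n * s ^ n))"
        by (rule abs_summable_in_conv_radius) (use s in auto)
      then have "summable (\<lambda>n. s * norm (F $ n * s ^ n))" by (rule summable_mult)
      then have "summable (\<lambda>n. I $ Suc n * s ^ Suc n)"
      proof (rule summable_comparison_test'[where N = 0])
        fix n :: nat
        show "norm (I $ Suc n * s ^ Suc n) \<le> s * norm (F $ n * s ^ n)"
          using s(1) by (simp add: I_def abs_mult field_simps)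
      qed
      then have "summable (\<lambda>n. I $ n * s ^ n)"
        by (subst (asm) summable_Suc_iff)
      then show "\<exists>z. norm z = s \<and> summable (\<lambda>n. I $ n * z ^ n)"
        using s(1) by (intro exI[of _ s]) auto
    qed
    moreover have "fps_conv_radius F \<ge> fps_conv_radius I"
      using fps_conv_radius_deriv[of I] by (simp add: I')
    ultimately show ?thesis by (simp add: fps_conv_radius_def)
  qed
  define \<Phi> where "\<Phi> = eval_fps I"
  have \<Phi>: "\<Phi> has_fps_expansion I"
    using \<phi> unfolding \<Phi>_def by (intro eval_fps_has_fps_expansion) (simp add: Ic has_fps_expansion_def)
  have I0: "I $ 0 = 0" "I $ Suc 0 = 0" "I $ Suc (Suc 0) = 1/2"
    using F0 F1 by (simp_all add: I_def)
  have d\<Phi>: "eventually (\<lambda>x. (\<Phi> has_real_derivative \<phi> x) (at x)) (nhds 0)"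
    using has_real_derivative_of_fps_expansion[OF \<Phi>] \<phi> unfolding I' has_fps_expansion_def
    by (auto elim: eventually_elim2)
  \<comment> \<open>\<open>2 * \<Phi>\<close> has a double zero at 0. Dividing by \<open>x^2\<close>
    leaves an analytic function with value 1 at 0, whose square root is analytic, whereas the root
    of \<open>2 * \<Phi>\<close> itself would be like \<open>\<bar>x\<bar>\<close>.\<close>
  define J where "J = fps_shift 2 (2 * I)"
  define g where "g = (\<lambda>x. if x = 0 then 1 else 2 * \<Phi> x / x ^ 2)"
  have sub: "2 \<le> subdegree (2 * I)"
  proof (rule subdegree_geI)
    have "(2 * I) $ Suc (Suc 0) \<noteq> 0" by (simp add: I0)
    then show "2 * I \<noteq> 0" by force
    show "(2 * I) $ i = 0" if "i < 2" for i
      using that I0 by (cases i) auto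
  qed
  have g: "g has_fps_expansion J"
    unfolding g_def J_def
    by (intro has_fps_expansion_shift has_fps_expansion_mult has_fps_expansion_numeral \<Phi> sub)
       (simp add: I0 numeral_2_eq_2)
  have J0: "J $ 0 = 1" by (simp add: J_def I0 numeral_2_eq_2)
  obtain K where K: "(\<lambda>x. sqrt (g x)) has_fps_expansion K"
    using has_fps_expansion_sqrt[OF g] J0 by auto
  have K0: "K $ 0 = 1" using has_fps_expansion_imp_0_eq_fps_nth_0[OF K] by (simp add: g_def)
  define Y where "Y = (\<lambda>x. x * sqrt (g x))"
  have Y: "Y has_fps_expansion fps_X * K"
    unfolding Y_def by (intro has_fps_expansion_mult K fps_expansion_intros)
  have "eventually (\<lambda>x. g x > 0) (nhds 0)" by (rule fps_expansion_pos[OF g]) (simp add: J0)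
  then have Y2: "eventually (\<lambda>x. Y x ^ 2 = 2 * \<Phi> x) (nhds 0)"
    by eventually_elim (auto simp: Y_def g_def power_mult_distrib \<Phi>_def eval_fps_at_0 I0)
  obtain y G where y: "y has_fps_expansion G" "G $ 0 = 0"
    "eventually (\<lambda>x. y (Y x) = x) (nhds 0)" "eventually (\<lambda>x. Y (y x) = x) (nhds 0)"
    using real_analytic_inverse[OF Y] K0 by auto
  have "y 0 = 0" using y by (simp add: has_fps_expansion_imp_0_eq_fps_nth_0)
  then have ylim: "filterlim y (nhds 0) (nhds 0)"
    using has_fps_expansion_imp_continuous[OF y(1), of UNIV] by (simp add: continuous_within tendsto_nhds_iff)
  have "eventually (\<lambda>x. Y (y x) ^ 2 = 2 * \<Phi> (y x)) (nhds 0)"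
    using eventually_compose_filterlim[OF Y2 ylim] .
  with y(4) have "eventually (\<lambda>x. 2 * \<Phi> (y x) = x ^ 2) (nhds 0)"
    by eventually_elim simp
  then have "eventually (\<lambda>x. eventually (\<lambda>x. 2 * \<Phi> (y x) = x ^ 2) (nhds x)) (nhds 0)"
    by (simp add: eventually_eventually)
  moreover have "eventually (\<lambda>x. (\<Phi> has_real_derivative \<phi> (y x)) (at (y x))) (nhds 0)"
    using eventually_compose_filterlim[OF d\<Phi> ylim] .
  moreover note has_real_derivative_of_fps_expansion[OF y(1)]
  ultimately have ode: "eventually (\<lambda>x. eval_fps (fps_deriv G) x * \<phi> (y x) = x) (nhds 0)"
  proof eventually_elim
    case (elim x)
    have "((\<lambda>x. 2 * \<Phi> (y x)) has_real_derivative 2 * (\<phi> (y x) * eval_fps (fps_deriv G) x)) (at x)"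
      using DERIV_chain2[OF elim(2,3)] by (intro DERIV_cmult)
    then have "((\<lambda>x. x ^ 2) has_real_derivative 2 * (\<phi> (y x) * eval_fps (fps_deriv G) x)) (at x)"
      by (rule DERIV_cong_ev[OF refl elim(1) refl, THEN iffD1])
    moreover have "((\<lambda>x. x ^ 2) has_real_derivative 2 * x) (at x)"
      by (auto intro!: derivative_eq_intros)
    ultimately have "2 * (\<phi> (y x) * eval_fps (fps_deriv G) x) = 2 * x"
      by (rule DERIV_unique)
    then show ?case by (simp add: mult.commute)
  qed
  have "((\<lambda>x. y (Y x)) has_real_derivative G $ 1 * 1) (at 0)"
  proof (rule DERIV_chain2[of y "G $ 1" Y])
    show "(Y has_real_derivative 1) (at 0)"
      using eventually_nhds_x_imp_x[OF has_real_derivative_of_fps_expansion[OF Y]] K0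
      by (simp add: eval_fps_at_0)
    show "(y has_real_derivative G $ 1) (at (Y 0))"
      using eventually_nhds_x_imp_x[OF has_real_derivative_of_fps_expansion[OF y(1)]]
      by (simp add: eval_fps_at_0 Y_def)
  qed
  then have "((\<lambda>x. x) has_real_derivative G $ 1) (at 0)"
    by (simp add: DERIV_cong_ev[OF refl y(3) refl])
  then have "G $ 1 = 1" using DERIV_unique[OF _ DERIV_ident] by blast
  with y ode Y K0 show ?thesis
    by (intro that[of y G Y "fps_X * K"]) simp_all
qed

subsection \<open>Integrals over the circle\<close>

definition trig_moment :: "nat \<Rightarrow> nat \<Rightarrow> real" where
  "trig_moment i j = integral {0..2*pi} (\<lambda>\<theta>. cos \<theta> ^ i * sin \<theta> ^ j)"

lemma trig_moment_has_integral:
  "((\<lambda>\<theta>. cos \<theta> ^ i * sin \<theta> ^ j) has_integral trig_moment i j) {0..2*pi}"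
  unfolding trig_moment_def
  by (intro integrable_integral integrable_continuous_real continuous_intros)

text \<open>The derivative of \<open>cos^(i+1) * sin^(j+1)\<close> integrates to 0 over a full turn,
  which gives one relation between the two moments of degree \<open>i + j + 2\<close>. The identity
  \<open>cos^2 + sin^2 = 1\<close> gives a second, and the two are solved.\<close>

lemma trig_moment_rec:
  "real (i + j + 2) * trig_moment (i + 2) j = real (i + 1) * trig_moment i j"
  "real (i + j + 2) * trig_moment i (j + 2) = real (j + 1) * trig_moment i j"
proof -
  have "((\<lambda>\<theta>. real (j + 1) * (cos \<theta> ^ (i + 2) * sin \<theta> ^ j) - real (i + 1) * (cos \<theta> ^ i * sin \<theta> ^ (j + 2)))
      has_integral (cos (2*pi) ^ (i + 1) * sin (2*pi) ^ (j + 1) - cos 0 ^ (i + 1) * sin 0 ^ (j + 1))) {0..2*pi}"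
  proof (rule fundamental_theorem_of_calculus)
    fix x :: real
    have "((\<lambda>\<theta>. cos \<theta> ^ (i + 1) * sin \<theta> ^ (j + 1)) has_real_derivative
        real (i + 1) * (- sin x * cos x ^ (i + 1 - Suc 0)) * sin x ^ (j + 1) +
        real (j + 1) * (cos x * sin x ^ (j + 1 - Suc 0)) * cos x ^ (i + 1)) (at x)"
      by (intro DERIV_mult DERIV_power DERIV_sin DERIV_cos)
    also have "real (i + 1) * (- sin x * cos x ^ (i + 1 - Suc 0)) * sin x ^ (j + 1) +
        real (j + 1) * (cos x * sin x ^ (j + 1 - Suc 0)) * cos x ^ (i + 1) =
        real (j + 1) * (cos x ^ (i + 2) * sin x ^ j) - real (i + 1) * (cos x ^ i * sin x ^ (j + 2))"
      by (simp add: power_add power2_eq_square mult_ac)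
    finally show "((\<lambda>\<theta>. cos \<theta> ^ (i + 1) * sin \<theta> ^ (j + 1)) has_vector_derivative
        real (j + 1) * (cos x ^ (i + 2) * sin x ^ j) - real (i + 1) * (cos x ^ i * sin x ^ (j + 2)))
        (at x within {0..2*pi})"
      unfolding has_real_derivative_iff_has_vector_derivative by (rule has_vector_derivative_at_within)
  qed simp
  moreover have "((\<lambda>\<theta>. real (j + 1) * (cos \<theta> ^ (i + 2) * sin \<theta> ^ j) - real (i + 1) * (cos \<theta> ^ i * sin \<theta> ^ (j + 2)))
      has_integral (real (j + 1) * trig_moment (i + 2) j - real (i + 1) * trig_moment i (j + 2))) {0..2*pi}"
    by (intro has_integral_diff has_integral_mult_right trig_moment_has_integral)
  ultimately have "cos (2*pi) ^ (i + 1) * sin (2*pi) ^ (j + 1) - cos 0 ^ (i + 1) * sin 0 ^ (j + 1)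
      = real (j + 1) * trig_moment (i + 2) j - real (i + 1) * trig_moment i (j + 2)"
    by (rule has_integral_unique)
  then have 1: "real (j + 1) * trig_moment (i + 2) j = real (i + 1) * trig_moment i (j + 2)"
    by simp
  have sum: "((\<lambda>\<theta>. cos \<theta> ^ (i + 2) * sin \<theta> ^ j + cos \<theta> ^ i * sin \<theta> ^ (j + 2))
      has_integral (trig_moment (i + 2) j + trig_moment i (j + 2))) {0..2*pi}"
    by (intro has_integral_add trig_moment_has_integral)
  have *: "cos \<theta> ^ (i + 2) * sin \<theta> ^ j + cos \<theta> ^ i * sin \<theta> ^ (j + 2) = cos \<theta> ^ i * sin \<theta> ^ j" for \<theta> :: real
  proof -
    have "cos \<theta> ^ (i + 2) * sin \<theta> ^ j + cos \<theta> ^ i * sin \<theta> ^ (j + 2) =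
      cos \<theta> ^ i * sin \<theta> ^ j * ((cos \<theta>)\<^sup>2 + (sin \<theta>)\<^sup>2)"
      unfolding power_add by (simp only: algebra_simps)
    then show ?thesis by simp
  qed
  have 2: "trig_moment (i + 2) j + trig_moment i (j + 2) = trig_moment i j"
    by (rule has_integral_unique[OF sum[unfolded *] trig_moment_has_integral])
  have "real (i + j + 2) * trig_moment (i + 2) j
      = real (j + 1) * trig_moment (i + 2) j + real (i + 1) * trig_moment (i + 2) j"
    by (simp only: distrib_right[symmetric] of_nat_add[symmetric]) (simp add: add_ac)
  also have "\<dots> = real (i + 1) * trig_moment i j"
    unfolding 1 2[symmetric] by (simp only: distrib_left add.commute)
  finally show "real (i + j + 2) * trig_moment (i + 2) j = real (i + 1) * trig_moment i j" .
  have "real (i + j + 2) * trig_moment i (j + 2)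
      = real (i + 1) * trig_moment i (j + 2) + real (j + 1) * trig_moment i (j + 2)"
    by (simp only: distrib_right[symmetric] of_nat_add[symmetric]) (simp add: add_ac)
  also have "\<dots> = real (j + 1) * trig_moment i j"
    unfolding 1[symmetric] 2[symmetric] by (simp only: distrib_left)
  finally show "real (i + j + 2) * trig_moment i (j + 2) = real (j + 1) * trig_moment i j" .
qed

lemma trig_moment_base:
  "trig_moment 0 0 = 2 * pi" "trig_moment 1 0 = 0" "trig_moment 0 1 = 0" "trig_moment 1 1 = 0"
proof -
  show "trig_moment 0 0 = 2 * pi" by (simp add: trig_moment_def)
  have "((\<lambda>\<theta>::real. cos \<theta> ^ 1 * sin \<theta> ^ 0) has_integral (sin (2*pi) - sin 0)) {0..2*pi}"
    by (intro fundamental_theorem_of_calculus)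
       (auto simp: has_real_derivative_iff_has_vector_derivative[symmetric] intro!: derivative_eq_intros)
  from has_integral_unique[OF trig_moment_has_integral this] show "trig_moment 1 0 = 0" by simp
  have "((\<lambda>\<theta>::real. cos \<theta> ^ 0 * sin \<theta> ^ 1) has_integral ((- cos (2*pi)) - (- cos 0))) {0..2*pi}"
    by (intro fundamental_theorem_of_calculus)
       (auto simp: has_real_derivative_iff_has_vector_derivative[symmetric] intro!: derivative_eq_intros)
  from has_integral_unique[OF trig_moment_has_integral this] show "trig_moment 0 1 = 0" by simp
  have "((\<lambda>\<theta>::real. cos \<theta> ^ 1 * sin \<theta> ^ 1) has_integral (sin (2*pi) ^ 2 / 2 - sin 0 ^ 2 / 2)) {0..2*pi}"
    by (intro fundamental_theorem_of_calculus)
       (auto simp: has_real_derivative_iff_has_vector_derivative[symmetric] intro!: derivative_eq_intros)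
  from has_integral_unique[OF trig_moment_has_integral this] show "trig_moment 1 1 = 0" by simp
qed

lemma trig_moment_odd:
  assumes "odd (i + j)"
  shows "trig_moment i j = 0"
  using assms
proof (induction "i + j" arbitrary: i j rule: less_induct)
  case less
  consider "i \<ge> 2" | "j \<ge> 2" | "i = 1" "j = 0" | "i = 0" "j = 1"
    using less.prems by (metis One_nat_def Suc_1 add.right_neutral add_0 even_zero less_2_cases not_le odd_even_add odd_one)
  then show ?case
  proof cases
    case 1
    then obtain k where k: "i = k + 2" by (metis add.commute le_Suc_ex)
    then have "trig_moment k j = 0" using less.prems by (intro less.hyps) auto
    with trig_moment_rec(1)[of k j] k show ?thesis by simp
  next
    case 2
    then obtain k where k: "j = k + 2" by (metis add.commute le_Suc_ex)
    then have "trig_moment i k = 0" using less.prems by (intro less.hyps) auto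
    with trig_moment_rec(2)[of i k] k show ?thesis by simp
  qed (use trig_moment_base in auto)
qed

lemma trig_moment_values:
  "trig_moment 2 0 = pi" "trig_moment 1 1 = 0" "trig_moment 0 2 = pi"
  "trig_moment 4 0 = 3/4 * pi" "trig_moment 3 1 = 0" "trig_moment 2 2 = 1/4 * pi"
  "trig_moment 1 3 = 0" "trig_moment 0 4 = 3/4 * pi"
  "trig_moment 6 0 = 5/8 * pi" "trig_moment 5 1 = 0" "trig_moment 4 2 = 1/8 * pi"
  "trig_moment 3 3 = 0" "trig_moment 2 4 = 1/8 * pi" "trig_moment 1 5 = 0" "trig_moment 0 6 = 5/8 * pi"
proof -
  show a: "trig_moment 2 0 = pi" using trig_moment_rec(1)[of 0 0] trig_moment_base by (simp add: numeral_2_eq_2)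
  show b: "trig_moment 0 2 = pi" using trig_moment_rec(2)[of 0 0] trig_moment_base by (simp add: numeral_2_eq_2)
  show c: "trig_moment 1 1 = 0" by (fact trig_moment_base)
  show d: "trig_moment 4 0 = 3/4 * pi" using trig_moment_rec(1)[of 2 0] a by simp
  show e: "trig_moment 0 4 = 3/4 * pi" using trig_moment_rec(2)[of 0 2] b by simp
  show f: "trig_moment 2 2 = 1/4 * pi" using trig_moment_rec(2)[of 2 0] a by (simp add: numeral_2_eq_2)
  show g: "trig_moment 3 1 = 0" using trig_moment_rec(1)[of 1 1] c by (simp add: numeral_3_eq_3)
  show h: "trig_moment 1 3 = 0" using trig_moment_rec(2)[of 1 1] c by (simp add: numeral_3_eq_3)
  show "trig_moment 6 0 = 5/8 * pi" using trig_moment_rec(1)[of 4 0] d by simp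
  show "trig_moment 0 6 = 5/8 * pi" using trig_moment_rec(2)[of 0 4] e by simp
  show "trig_moment 4 2 = 1/8 * pi" using trig_moment_rec(1)[of 2 2] f by simp
  show "trig_moment 2 4 = 1/8 * pi" using trig_moment_rec(2)[of 2 2] f by simp
  show "trig_moment 5 1 = 0" using trig_moment_rec(1)[of 3 1] g by simp
  show "trig_moment 1 5 = 0" using trig_moment_rec(2)[of 1 3] h by simp
  show "trig_moment 3 3 = 0" using trig_moment_rec(2)[of 3 1] g by (simp add: numeral_3_eq_3)
qed

text \<open>The Cauchy product of the two series converges uniformly in the angle, so it may be
  integrated term by term.\<close>

lemma circle_integral_expansion:
  fixes a b :: "real \<Rightarrow> real"
  assumes a: "a has_fps_expansion A" and b: "b has_fps_expansion B"
  shows "(\<lambda>R. integral {0..2*pi} (\<lambda>\<theta>. a (R * cos \<theta>) * b (R * sin \<theta>))) has_fps_expansion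
    Abs_fps (\<lambda>n. \<Sum>i\<le>n. A $ i * B $ (n - i) * trig_moment i (n - i))" (is "?T has_fps_expansion ?F")
proof (rule has_fps_expansionI)
  obtain r where r: "r > 0" "ereal r < fps_conv_radius A" "ereal r < fps_conv_radius B"
  proof -
    have "(0::ereal) < min (fps_conv_radius A) (fps_conv_radius B)"
      using a b by (simp add: has_fps_expansion_def)
    from ereal_dense2[OF this] show ?thesis using that by (auto simp: zero_ereal_def)
  qed
  have "eventually (\<lambda>x. eval_fps A x = a x \<and> eval_fps B x = b x) (nhds 0)"
    using a b by (simp add: has_fps_expansion_def eventually_conj)
  then obtain e where e: "e > 0" "\<And>x. \<bar>x\<bar> < e \<Longrightarrow> eval_fps A x = a x" "\<And>x. \<bar>x\<bar> < e \<Longrightarrow> eval_fps B x = b x"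
    by (auto simp: eventually_nhds_metric dist_real_def)
  define d where "d = min e r"
  have d: "d > 0" "d \<le> e" "d \<le> r" using e r by (auto simp: d_def)
  have sumA: "summable (\<lambda>i. norm (A $ i * x ^ i))" if "\<bar>x\<bar> \<le> r" for x
    by (rule norm_summable_fps) (use that r in \<open>auto intro: le_less_trans[of _ "ereal r"]\<close>)
  have sumB: "summable (\<lambda>i. norm (B $ i * x ^ i))" if "\<bar>x\<bar> \<le> r" for x
    by (rule norm_summable_fps) (use that r in \<open>auto intro: le_less_trans[of _ "ereal r"]\<close>)
  have "(\<lambda>n. ?F $ n * R ^ n) sums ?T R" if R: "\<bar>R\<bar> < d" for R
  proof -
    define f where "f = (\<lambda>n \<theta>. \<Sum>i\<le>n. (A $ i * (R * cos \<theta>) ^ i) * (B $ (n - i) * (R * sin \<theta>) ^ (n - i)))"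
    \<comment> \<open>A bound independent of the angle: both arguments have modulus at most
      \<open>\<bar>R\<bar>\<close>, so the Cauchy product of the absolute values at \<open>R\<close>
      dominates.\<close>
    define M where "M = (\<lambda>n. \<Sum>i\<le>n. norm (A $ i * R ^ i) * norm (B $ (n - i) * R ^ (n - i)))"
    have small: "\<bar>R * cos \<theta>\<bar> \<le> \<bar>R\<bar>" "\<bar>R * sin \<theta>\<bar> \<le> \<bar>R\<bar>" for \<theta>
      by (simp_all add: abs_mult mult_left_le)
    have fs: "f n \<theta> = R ^ n * (\<Sum>i\<le>n. A $ i * B $ (n - i) * (cos \<theta> ^ i * sin \<theta> ^ (n - i)))" for n \<theta>
      unfolding f_def sum_distrib_left
      by (rule sum.cong) (auto simp: power_mult_distrib power_add[symmetric] mult_ac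
        simp flip: power_add[of R])
    have prod: "(\<lambda>n. f n \<theta>) sums (a (R * cos \<theta>) * b (R * sin \<theta>))" for \<theta>
    proof -
      have *: "\<bar>R * cos \<theta>\<bar> < d" "\<bar>R * sin \<theta>\<bar> < d" using small[of \<theta>] R by auto
      have "f n \<theta> = (\<Sum>i\<le>n. (A $ i * (R * cos \<theta>) ^ i) * (B $ (n - i) * (R * sin \<theta>) ^ (n - i)))" for n
        by (simp add: f_def)
      moreover have "(\<lambda>n. \<Sum>i\<le>n. (A $ i * (R * cos \<theta>) ^ i) * (B $ (n - i) * (R * sin \<theta>) ^ (n - i))) sums
          ((\<Sum>i. A $ i * (R * cos \<theta>) ^ i) * (\<Sum>i. B $ i * (R * sin \<theta>) ^ i))"
        using * d by (intro Cauchy_product_sums sumA sumB) auto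
      ultimately show ?thesis
        using e(2)[of "R * cos \<theta>"] e(3)[of "R * sin \<theta>"] * d by (simp add: eval_fps_def)
    qed
    have "summable M"
      unfolding M_def
      by (rule summable_Cauchy_product) (use sumA[of R] sumB[of R] R d in auto)
    moreover have "norm (f n \<theta>) \<le> M n" for n \<theta>
      unfolding f_def M_def
    proof (rule sum_norm_le)
      fix i assume "i \<in> {..n}"
      have "norm ((R * cos \<theta>) ^ i) \<le> norm (R ^ i)" "norm ((R * sin \<theta>) ^ (n - i)) \<le> norm (R ^ (n - i))"
        using small[of \<theta>] by (auto simp: power_abs intro: power_mono)
      then have "norm (A $ i * (R * cos \<theta>) ^ i) \<le> norm (A $ i * R ^ i)"
          "norm (B $ (n - i) * (R * sin \<theta>) ^ (n - i)) \<le> norm (B $ (n - i) * R ^ (n - i))"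
        by (simp_all add: abs_mult mult_left_mono)
      then show "norm ((A $ i * (R * cos \<theta>) ^ i) * (B $ (n - i) * (R * sin \<theta>) ^ (n - i)))
          \<le> norm (A $ i * R ^ i) * norm (B $ (n - i) * R ^ (n - i))"
        unfolding norm_mult[of "A $ i * (R * cos \<theta>) ^ i"] by (intro mult_mono) auto
    qed
    ultimately have "uniform_limit {0..2*pi} (\<lambda>n \<theta>. \<Sum>k<n. f k \<theta>) (\<lambda>\<theta>. \<Sum>k. f k \<theta>) sequentially"
      by (intro Weierstrass_m_test) auto
    then have ul: "uniform_limit {0..2*pi} (\<lambda>n \<theta>. \<Sum>k<n. f k \<theta>) (\<lambda>\<theta>. a (R * cos \<theta>) * b (R * sin \<theta>)) sequentially"
      using prod by (simp add: sums_iff)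
    have cont: "continuous_on {0..2*pi} (\<lambda>\<theta>. \<Sum>k<n. f k \<theta>)" for n
      unfolding f_def by (intro continuous_intros)
    obtain I J where IJ: "\<And>n. ((\<lambda>\<theta>. \<Sum>k<n. f k \<theta>) has_integral I n) {0..2*pi}"
        "((\<lambda>\<theta>. a (R * cos \<theta>) * b (R * sin \<theta>)) has_integral J) {0..2*pi}" "I \<longlonglongrightarrow> J"
      using uniform_limit_integral[OF ul cont] by auto
    have "((\<lambda>\<theta>. \<Sum>k<n. f k \<theta>) has_integral (\<Sum>k<n. ?F $ k * R ^ k)) {0..2*pi}" for n
    proof (rule has_integral_sum)
      fix k
      have "(f k has_integral R ^ k * (\<Sum>i\<le>k. A $ i * B $ (k - i) * trig_moment i (k - i))) {0..2*pi}"
        unfolding fs by (intro has_integral_mult_right has_integral_sum trig_moment_has_integral) auto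
      then show "(f k has_integral ?F $ k * R ^ k) {0..2*pi}" by (simp add: mult.commute)
    qed simp
    then have "I = (\<lambda>n. \<Sum>k<n. ?F $ k * R ^ k)"
      using IJ(1) has_integral_unique by blast
    then show ?thesis
      using IJ(3) unfolding sums_def integral_unique[OF IJ(2)] by simp
  qed
  moreover have "eventually (\<lambda>R. R \<in> {-d<..<d}) (nhds 0)"
    using d by (intro eventually_nhds_in_open) auto
  ultimately show "eventually (\<lambda>R. (\<lambda>n. ?F $ n * R ^ n) sums ?T R) (nhds 0)"
    by (auto elim!: eventually_mono)
qed

subsection \<open>Reparametrisation and uniqueness of solutions\<close>

text \<open>Here \<open>w\<close> is the time spent per unit angle and its primitive
  \<open>S\<close> is time as a function of the angle; \<open>\<theta>\<close> is the inverse of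
  \<open>S\<close>. Positivity makes \<open>S\<close> increasing, and
  \<open>S (x + 2 * pi) = S x + T\<close> makes it unbounded in both directions, hence onto.\<close>

lemma periodic_reparametrisation:
  fixes w :: "real \<Rightarrow> real"
  assumes cont: "\<And>x. isCont w x" and pos: "\<And>x. w x > 0" and per: "\<And>x. w (x + 2 * pi) = w x"
  defines "T \<equiv> integral {0..2*pi} w"
  obtains \<theta> :: "real \<Rightarrow> real" where "\<And>t. (\<theta> has_real_derivative 1 / w (\<theta> t)) (at t)"
    "strict_mono \<theta>" "\<And>t. \<theta> (t + T) = \<theta> t + 2 * pi" "\<theta> 0 = x0" "T > 0"
proof -
  define S where "S = (\<lambda>x. LBINT y=ereal x0..ereal x. w y)"
  have contw: "continuous_on A w" for A
    using cont by (simp add: continuous_at_imp_continuous_on)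
  have S': "(S has_real_derivative w x) (at x)" for x
  proof -
    define A B where "A = min x x0 - 1" and "B = max x x0 + 1"
    have "((\<lambda>u. LBINT y=ereal x0..ereal u. w y) has_vector_derivative w x) (at x within {A..B})"
      by (rule interval_integral_FTC2) (auto simp: A_def B_def contw)
    moreover have "at x within {A..B} = at x"
      by (rule at_within_Icc_at) (auto simp: A_def B_def)
    ultimately show ?thesis
      by (simp add: S_def has_real_derivative_iff_has_vector_derivative)
  qed
  have contS: "isCont S x" for x using DERIV_isCont[OF S'] .
  have S0: "S x0 = 0" by (simp add: S_def)
  have mono: "S x < S y" if "x < y" for x y
    using DERIV_pos_imp_increasing[OF that, of S] S' pos by blast
  have "((\<lambda>x. S (x + 2 * pi) - S x) has_real_derivative 0) (at x)" for x
  proof -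
    have "((\<lambda>x. S (x + 2 * pi)) has_real_derivative w (x + 2 * pi) * 1) (at x)"
      by (rule DERIV_chain2[OF S']) (auto intro!: derivative_eq_intros)
    from DERIV_diff[OF this S'[of x]] show ?thesis by (simp add: per)
  qed
  then have const: "S (x + 2 * pi) - S x = S (0 + 2 * pi) - S 0" for x
    by (rule DERIV_isconst_all[OF allI])
  have "(w has_integral S (2 * pi) - S 0) {0..2*pi}"
    using S' by (intro fundamental_theorem_of_calculus)
      (auto simp: has_real_derivative_iff_has_vector_derivative[symmetric] has_field_derivative_at_within)
  then have T: "T = S (2 * pi) - S 0" by (simp add: T_def integral_unique)
  have ST: "S (x + 2 * pi) = S x + T" for x using const[of x] T by simp
  have Tpos: "T > 0" using mono[of 0 "2 * pi"] T by simp
  have STn: "S (x + real n * (2 * pi)) = S x + real n * T" for x n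
  proof (induction n)
    case (Suc n)
    have "S (x + real (Suc n) * (2 * pi)) = S (x + real n * (2 * pi) + 2 * pi)"
      by (simp add: algebra_simps)
    then show ?case using Suc unfolding ST by (simp add: algebra_simps)
  qed auto
  have surj: "\<exists>x. S x = t" for t
  proof -
    obtain n where n: "real n * T > \<bar>t\<bar>" using reals_Archimedean3[OF Tpos] by blast
    have "S (x0 - real n * (2 * pi)) = - (real n * T)"
      using STn[of "x0 - real n * (2 * pi)" n] S0 by simp
    moreover have "S (x0 + real n * (2 * pi)) = real n * T" using STn[of x0 n] S0 by simp
    ultimately have "\<exists>x\<ge>x0 - real n * (2 * pi). x \<le> x0 + real n * (2 * pi) \<and> S x = t"
      using n contS by (intro IVT) auto
    then show ?thesis by blast
  qed
  define \<theta> where "\<theta> = (\<lambda>t. THE x. S x = t)"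
  have inj: "x = y" if "S x = S y" for x y
    using mono[of x y] mono[of y x] that by (cases x y rule: linorder_cases) auto
  have \<theta>S: "\<theta> (S x) = x" for x
    unfolding \<theta>_def using inj by blast
  have S\<theta>: "S (\<theta> t) = t" for t using surj[of t] \<theta>S by metis
  have cont\<theta>: "isCont \<theta> t" for t
    using isCont_inverse_function[where d = 1 and x = "\<theta> t" and g = \<theta> and f = S] \<theta>S contS S\<theta> by simp
  have "(\<theta> has_real_derivative 1 / w (\<theta> t)) (at t)" for t
    using DERIV_inverse_function[where f = S and g = \<theta> and x = t and D = "w (\<theta> t)" and a = "t - 1" and b = "t + 1"]
      S' pos[of "\<theta> t"] S\<theta> cont\<theta> by (simp add: inverse_eq_divide)
  moreover have "strict_mono \<theta>"
  proof (rule strict_monoI)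
    fix s t :: real assume "s < t"
    then have "S (\<theta> s) < S (\<theta> t)" by (simp add: S\<theta>)
    then show "\<theta> s < \<theta> t" using mono[of "\<theta> t" "\<theta> s"] by (cases "\<theta> s" "\<theta> t" rule: linorder_cases) auto
  qed
  moreover have "\<theta> (t + T) = \<theta> t + 2 * pi" for t
    using \<theta>S[of "\<theta> t + 2 * pi"] by (simp add: ST S\<theta>)
  moreover have "\<theta> 0 = x0" using \<theta>S[of x0] S0 by simp
  ultimately show ?thesis using that Tpos by blast
qed

text \<open>Boundedness belongs to the notion so that it is closed under products, hence holds for
  all polynomials on a bounded set.\<close>

definition lip_on :: "'a::metric_space set \<Rightarrow> ('a \<Rightarrow> real) \<Rightarrow> bool" where
  "lip_on S f \<longleftrightarrow> (\<exists>B. \<forall>x\<in>S. \<bar>f x\<bar> \<le> B) \<and> (\<exists>K. \<forall>x\<in>S. \<forall>y\<in>S. \<bar>f x - f y\<bar> \<le> K * dist x y)"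

lemma lip_on_const: "lip_on S (\<lambda>_. c)"
  unfolding lip_on_def by (intro conjI exI[of _ "\<bar>c\<bar>"] exI[of _ 0]) auto

lemma lip_on_add:
  assumes "lip_on S f" "lip_on S g"
  shows "lip_on S (\<lambda>x. f x + g x)"
proof -
  from assms obtain B1 B2 K1 K2 where *:
    "\<And>x. x \<in> S \<Longrightarrow> \<bar>f x\<bar> \<le> B1" "\<And>x y. x \<in> S \<Longrightarrow> y \<in> S \<Longrightarrow> \<bar>f x - f y\<bar> \<le> K1 * dist x y"
    "\<And>x. x \<in> S \<Longrightarrow> \<bar>g x\<bar> \<le> B2" "\<And>x y. x \<in> S \<Longrightarrow> y \<in> S \<Longrightarrow> \<bar>g x - g y\<bar> \<le> K2 * dist x y"
    unfolding lip_on_def by metis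
  have "\<bar>f x + g x\<bar> \<le> B1 + B2" if "x \<in> S" for x
    using *(1,3)[OF that] by linarith
  moreover have "\<bar>(f x + g x) - (f y + g y)\<bar> \<le> (K1 + K2) * dist x y" if "x \<in> S" "y \<in> S" for x y
    using *(2,4)[OF that] by (simp add: distrib_right)
  ultimately show ?thesis unfolding lip_on_def by blast
qed

lemma lip_on_mult:
  assumes "lip_on S f" "lip_on S g"
  shows "lip_on S (\<lambda>x. f x * g x)"
proof -
  from assms obtain B1 B2 K1 K2 where *:
    "\<And>x. x \<in> S \<Longrightarrow> \<bar>f x\<bar> \<le> B1" "\<And>x y. x \<in> S \<Longrightarrow> y \<in> S \<Longrightarrow> \<bar>f x - f y\<bar> \<le> K1 * dist x y"
    "\<And>x. x \<in> S \<Longrightarrow> \<bar>g x\<bar> \<le> B2" "\<And>x y. x \<in> S \<Longrightarrow> y \<in> S \<Longrightarrow> \<bar>g x - g y\<bar> \<le> K2 * dist x y"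
    unfolding lip_on_def by metis
  have "\<bar>f x * g x\<bar> \<le> \<bar>B1\<bar> * \<bar>B2\<bar>" if "x \<in> S" for x
    unfolding abs_mult using *(1,3)[OF that] by (intro mult_mono) auto
  moreover have "\<bar>f x * g x - f y * g y\<bar> \<le> (K1 * \<bar>B2\<bar> + \<bar>B1\<bar> * K2) * dist x y" if "x \<in> S" "y \<in> S" for x y
  proof -
    have "\<bar>f x * g x - f y * g y\<bar> = \<bar>(f x - f y) * g x + f y * (g x - g y)\<bar>" by (simp add: algebra_simps)
    also have "\<dots> \<le> \<bar>f x - f y\<bar> * \<bar>g x\<bar> + \<bar>f y\<bar> * \<bar>g x - g y\<bar>"
      by (rule order.trans[OF abs_triangle_ineq]) (simp add: abs_mult)
    also have "\<dots> \<le> (K1 * dist x y) * \<bar>B2\<bar> + \<bar>B1\<bar> * (K2 * dist x y)"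
    proof (intro add_mono mult_mono)
      show "0 \<le> K1 * dist x y" using *(2)[OF that] by linarith
    qed (use *(1)[of y] *(3)[of x] *(2,4)[OF that] that in auto)
    finally show ?thesis by (simp add: algebra_simps)
  qed
  ultimately show ?thesis unfolding lip_on_def by blast
qed

lemma lip_on_uminus: "lip_on S f \<Longrightarrow> lip_on S (\<lambda>x. - f x)"
  using lip_on_mult[OF lip_on_const[of S "-1"]] by simp

lemma lip_on_diff: "lip_on S f \<Longrightarrow> lip_on S g \<Longrightarrow> lip_on S (\<lambda>x. f x - g x)"
  using lip_on_add[OF _ lip_on_uminus, of S f g] by simp

lemma lip_on_power: "lip_on S f \<Longrightarrow> lip_on S (\<lambda>x. f x ^ n)"
  by (induction n) (auto intro: lip_on_mult lip_on_const)

lemma lip_on_fst: "bounded S \<Longrightarrow> lip_on S (fst :: real \<times> real \<Rightarrow> real)"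
  and lip_on_snd: "bounded S \<Longrightarrow> lip_on S (snd :: real \<times> real \<Rightarrow> real)"
proof -
  assume "bounded S"
  then obtain B where "\<And>x. x \<in> S \<Longrightarrow> norm x \<le> B" by (auto simp: bounded_iff)
  then have "\<And>x. x \<in> S \<Longrightarrow> \<bar>fst x\<bar> \<le> B" "\<And>x. x \<in> S \<Longrightarrow> \<bar>snd x\<bar> \<le> B"
    by (metis norm_fst_le norm_snd_le order.trans prod.collapse real_norm_def)+
  then show "lip_on S (fst :: real \<times> real \<Rightarrow> real)" "lip_on S (snd :: real \<times> real \<Rightarrow> real)"
    using dist_fst_le dist_snd_le unfolding lip_on_def dist_real_def[symmetric]
    by (metis mult_1)+
qed

text \<open>One constant for each bounded set, so that two solutions over a compact time interval
  can be compared with a single constant.\<close>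

definition locally_lipschitz :: "(real \<times> real \<Rightarrow> real \<times> real) \<Rightarrow> bool" where
  "locally_lipschitz V \<longleftrightarrow> (\<forall>S. bounded S \<longrightarrow> (\<exists>K. \<forall>x\<in>S. \<forall>y\<in>S. dist (V x) (V y) \<le> K * dist x y))"

lemma locally_lipschitz_system_S: "locally_lipschitz (system_S lam)"
  unfolding locally_lipschitz_def
proof (intro allI impI)
  fix S :: "(real \<times> real) set" assume S: "bounded S"
  obtain a2 a3 a4 a6 a7 a8 a9 a10 where lam: "lam = (a2, a3, a4, a6, a7, a8, a9, a10)"
    by (cases lam) auto
  have "lip_on S (\<lambda>z. rhs_x (\<lambda>c. c) lam (fst z) (snd z))" "lip_on S (\<lambda>z. rhs_y (\<lambda>c. c) lam (fst z) (snd z))"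
    unfolding lam rhs_x.simps rhs_y.simps
    by (intro lip_on_add lip_on_diff lip_on_mult lip_on_uminus lip_on_power lip_on_const
        lip_on_fst[OF S] lip_on_snd[OF S])+
  then obtain K L where KL: "\<And>x y. x \<in> S \<Longrightarrow> y \<in> S \<Longrightarrow>
      \<bar>rhs_x (\<lambda>c. c) lam (fst x) (snd x) - rhs_x (\<lambda>c. c) lam (fst y) (snd y)\<bar> \<le> K * dist x y"
      "\<And>x y. x \<in> S \<Longrightarrow> y \<in> S \<Longrightarrow>
      \<bar>rhs_y (\<lambda>c. c) lam (fst x) (snd x) - rhs_y (\<lambda>c. c) lam (fst y) (snd y)\<bar> \<le> L * dist x y"
    unfolding lip_on_def by metis
  have "dist (system_S lam x) (system_S lam y) \<le> (K + L) * dist x y" if "x \<in> S" "y \<in> S" for x y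
  proof -
    have "dist (system_S lam x) (system_S lam y) \<le>
        \<bar>rhs_x (\<lambda>c. c) lam (fst x) (snd x) - rhs_x (\<lambda>c. c) lam (fst y) (snd y)\<bar>
        + \<bar>rhs_y (\<lambda>c. c) lam (fst x) (snd x) - rhs_y (\<lambda>c. c) lam (fst y) (snd y)\<bar>"
      using sqrt_sum_squares_le_sum_abs
      by (simp add: system_S_def dist_prod_def dist_real_def case_prod_unfold)
    with KL[OF that] show ?thesis by (simp add: distrib_right)
  qed
  then show "\<exists>K. \<forall>x\<in>S. \<forall>y\<in>S. dist (system_S lam x) (system_S lam y) \<le> K * dist x y" by blast
qed

text \<open>Gronwall's argument: the squared distance of the two solutions times
  \<open>exp (- 2 * K * s)\<close> is nonincreasing and starts at 0.\<close>

lemma solution_unique_forward: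
  fixes f g :: "real \<Rightarrow> real \<times> real"
  assumes V: "locally_lipschitz V"
    and f: "is_solution V f" and g: "is_solution V g" and eq: "f 0 = g 0" and t: "t \<ge> 0"
  shows "f t = g t"
proof -
  have cont: "continuous_on A f" "continuous_on A g" for A
    using f g unfolding is_solution_def
    by (meson continuous_at_imp_continuous_on has_vector_derivative_continuous)+
  have "bounded (f ` {0..t} \<union> g ` {0..t})"
    by (simp add: compact_imp_bounded compact_continuous_image cont)
  then obtain K where K: "\<And>x y. x \<in> f ` {0..t} \<union> g ` {0..t} \<Longrightarrow> y \<in> f ` {0..t} \<union> g ` {0..t} \<Longrightarrow>
      dist (V x) (V y) \<le> K * dist x y"
    using V unfolding locally_lipschitz_def by metis
  define e where "e s = (f s - g s) \<bullet> (f s - g s)" for s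
  define E where "E s = e s * exp (- 2 * K * s)" for s
  have "\<exists>y. (E has_real_derivative y) (at s) \<and> y \<le> 0" if s: "0 \<le> s" "s \<le> t" for s
  proof -
    have d: "((\<lambda>s. f s - g s) has_vector_derivative (V (f s) - V (g s))) (at s)"
      using f g unfolding is_solution_def by (intro has_vector_derivative_diff) auto
    have "(e has_vector_derivative (f s - g s) \<bullet> (V (f s) - V (g s)) + (V (f s) - V (g s)) \<bullet> (f s - g s)) (at s)"
      unfolding e_def by (rule bounded_bilinear.has_vector_derivative[OF bounded_bilinear_inner d d])
    then have "(e has_real_derivative 2 * ((f s - g s) \<bullet> (V (f s) - V (g s)))) (at s)"
      by (simp add: has_real_derivative_iff_has_vector_derivative inner_commute)
    then have "(E has_real_derivative 2 * ((f s - g s) \<bullet> (V (f s) - V (g s))) * exp (- 2 * K * s)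
        + e s * (exp (- 2 * K * s) * (- 2 * K))) (at s)"
      unfolding E_def by (auto intro!: derivative_eq_intros)
    moreover have "2 * ((f s - g s) \<bullet> (V (f s) - V (g s))) * exp (- 2 * K * s)
        + e s * (exp (- 2 * K * s) * (- 2 * K)) \<le> 0"
    proof -
      have "(f s - g s) \<bullet> (V (f s) - V (g s)) \<le> norm (f s - g s) * norm (V (f s) - V (g s))"
        by (rule norm_cauchy_schwarz)
      also have "\<dots> \<le> norm (f s - g s) * (K * norm (f s - g s))"
        using K[of "f s" "g s"] s by (intro mult_left_mono) (auto simp: dist_norm)
      also have "\<dots> = K * e s" by (simp add: e_def power2_norm_eq_inner[symmetric] power2_eq_square)
      finally have "((f s - g s) \<bullet> (V (f s) - V (g s)) - K * e s) * (2 * exp (- 2 * K * s)) \<le> 0"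
        by (intro mult_nonpos_nonneg) auto
      then show ?thesis by (simp add: algebra_simps)
    qed
    ultimately show ?thesis by blast
  qed
  then have "E t \<le> E 0"
    by (rule DERIV_nonpos_imp_nonincreasing[OF t])
  then have "e t \<le> 0" using eq by (simp add: E_def e_def mult_le_0_iff)
  then show ?thesis unfolding e_def using inner_ge_zero[of "f t - g t"] inner_eq_zero_iff[of "f t - g t"] by simp
qed

lemma solution_unique:
  assumes V: "locally_lipschitz V"
    and f: "is_solution V f" and g: "is_solution V g" and eq: "f 0 = g 0"
  shows "f = g"
proof
  fix t :: real
  show "f t = g t"
  proof (cases "t \<ge> 0")
    case True
    then show ?thesis by (rule solution_unique_forward[OF assms])
  next
    case False
    have rev: "is_solution (\<lambda>x. - V x) (\<lambda>s. h (- s))" if "is_solution V h" for h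
      unfolding is_solution_def
    proof
      fix s
      have "((h \<circ> (\<lambda>s. - s)) has_vector_derivative (- 1) *\<^sub>R V (h (- s))) (at s)"
        using that unfolding is_solution_def
        by (intro vector_diff_chain_at) (auto intro!: derivative_eq_intros)
      then show "((\<lambda>s. h (- s)) has_vector_derivative - V (h (- s))) (at s)" by (simp add: o_def)
    qed
    have "locally_lipschitz (\<lambda>x. - V x)"
      using V unfolding locally_lipschitz_def by (simp add: dist_minus)
    from solution_unique_forward[OF this rev[OF f] rev[OF g], of "- t"] eq False show ?thesis by simp
  qed
qed

subsection \<open>Existence of the formal normal form\<close>

text \<open>The subdegree of a \<open>series2\<close> only sees powers of \<open>z\<close>; the
  normalisation proceeds by total degree.\<close>

definition ord_ge :: "nat \<Rightarrow> series2 \<Rightarrow> bool" where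
  "ord_ge m F \<longleftrightarrow> (\<forall>k l. k + l < m \<longrightarrow> F $ k $ l = 0)"

lemma ord_geD: "ord_ge m F \<Longrightarrow> k + l < m \<Longrightarrow> F $ k $ l = 0"
  by (simp add: ord_ge_def)

lemma ord_ge_mono: "ord_ge m F \<Longrightarrow> n \<le> m \<Longrightarrow> ord_ge n F"
  by (auto simp: ord_ge_def)

lemma ord_ge_0 [simp]: "ord_ge 0 F" "ord_ge m 0"
  by (auto simp: ord_ge_def)

lemma ord_ge_add: "ord_ge m F \<Longrightarrow> ord_ge m G \<Longrightarrow> ord_ge m (F + G)"
  by (auto simp: ord_ge_def)

lemma ord_ge_diff: "ord_ge m F \<Longrightarrow> ord_ge m G \<Longrightarrow> ord_ge m (F - G)"
  by (auto simp: ord_ge_def)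

lemma ord_ge_uminus: "ord_ge m F \<Longrightarrow> ord_ge m (- F)"
  by (auto simp: ord_ge_def)

lemma series2_mult_nth:
  "((F :: series2) * G) $ k $ l = (\<Sum>i\<le>k. \<Sum>j\<le>l. F $ i $ j * G $ (k - i) $ (l - j))"
  by (simp add: fps_mult_nth fps_sum_nth atLeast0AtMost)

lemma ord_ge_mult: "ord_ge m F \<Longrightarrow> ord_ge n G \<Longrightarrow> ord_ge (m + n) (F * G)"
  unfolding ord_ge_def
proof (intro allI impI)
  fix k l
  assume F: "\<forall>k l. k + l < m \<longrightarrow> F $ k $ l = 0" and G: "\<forall>k l. k + l < n \<longrightarrow> G $ k $ l = 0"
    and kl: "k + l < m + n"
  have *: "F $ i $ j * G $ (k - i) $ (l - j) = 0" if "i \<le> k" "j \<le> l" for i j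
  proof (cases "i + j < m")
    case False
    then have "(k - i) + (l - j) < n" using kl that by simp
    then show ?thesis using G by simp
  qed (use F in simp)
  show "(F * G) $ k $ l = 0"
    unfolding series2_mult_nth by (intro sum.neutral ballI *) auto
qed

lemma ord_ge_mult_left: "ord_ge n G \<Longrightarrow> ord_ge n (F * G)"
  using ord_ge_mult[of 0 F n G] by simp

lemma ord_ge_mult_right: "ord_ge n F \<Longrightarrow> ord_ge n (F * G)"
  using ord_ge_mult[of n F 0 G] by simp

lemma ord_ge_power: "ord_ge m F \<Longrightarrow> ord_ge (n * m) (F ^ n)"
  by (induction n) (auto intro: ord_ge_mult)

lemma var_z_nth: "var_z $ k $ l = (if k = 1 \<and> l = 0 then 1 else 0)"
  by (simp add: var_z_def)

lemma var_w_nth: "var_w $ k $ l = (if k = 0 \<and> l = 1 then 1 else 0)"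
  by (simp add: var_w_def)

lemma var_z_mult_nth: "(F * var_z) $ k $ l = (if k = 0 then 0 else F $ (k - 1) $ l)"
  by (simp add: var_z_def)

lemma var_w_mult_nth: "(F * var_w) $ k $ l = (if l = 0 then 0 else F $ k $ (l - 1))"
  by (simp add: var_w_def)

lemma ord_ge_var: "ord_ge 1 var_z" "ord_ge 1 var_w"
  by (auto simp: ord_ge_def var_z_nth var_w_nth)

lemma var_power_nth: "(var_z ^ a * var_w ^ b) $ k $ l = (if k = a \<and> l = b then 1 else 0)"
proof (induction b arbitrary: k l)
  case 0
  have "(var_z ^ a) $ k $ l = (if k = a \<and> l = 0 then 1 else 0)"
  proof (induction a arbitrary: k)
    case (Suc a)
    show ?case unfolding power_Suc2 var_z_mult_nth Suc.IH by auto
  qed auto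
  then show ?case by simp
next
  case (Suc b)
  show ?case unfolding power_Suc2 mult.assoc[symmetric] var_w_mult_nth Suc.IH by auto
qed

lemma deriv_z_nth: "deriv_z F $ k $ l = of_nat (k + 1) * F $ (k + 1) $ l"
  by (simp add: deriv_z_def fps_of_nat[symmetric] del: fps_of_nat of_nat_Suc)

lemma deriv_w_nth: "deriv_w F $ k $ l = of_nat (l + 1) * F $ k $ (l + 1)"
  by (simp add: deriv_w_def)

lemma ord_ge_deriv: "ord_ge (Suc m) F \<Longrightarrow> ord_ge m (deriv_z F)" "ord_ge (Suc m) F \<Longrightarrow> ord_ge m (deriv_w F)"
  by (auto simp: ord_ge_def deriv_z_nth deriv_w_nth)

lemma deriv_z_diff: "deriv_z (F - G) = deriv_z F - deriv_z G"
  by (simp add: deriv_z_def)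

lemma deriv_w_diff: "deriv_w (F - G) = deriv_w F - deriv_w G"
  by (rule fps_ext, rule fps_ext) (simp add: deriv_w_nth algebra_simps)

text \<open>The linear part of the field is diagonal on monomials, with eigenvalue
  \<open>k - l\<close> at \<open>z^k w^l\<close>. This is the source of the resonance
  condition.\<close>

lemma euler_nth: "(deriv_z F * var_z - deriv_w F * var_w) $ k $ l = of_int (int k - int l) * F $ k $ l"
  unfolding fps_sub_nth var_z_mult_nth var_w_mult_nth deriv_z_nth deriv_w_nth
  by (cases k; cases l) (simp_all add: algebra_simps)

lemma resonant_sum_nth:
  "resonant_sum p F G $ k $ l = (\<Sum>j=1..k+l. p j * (F ^ (j + 1) * G ^ j) $ k $ l)"
  by (simp add: resonant_sum_def)

text \<open>Agreement with relative precision \<open>n\<close> above the leading order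
  \<open>a\<close>. Under multiplication the leading orders add while \<open>n\<close> is
  kept.\<close>

definition rel_ord :: "nat \<Rightarrow> nat \<Rightarrow> series2 \<Rightarrow> series2 \<Rightarrow> bool" where
  "rel_ord n a F G \<longleftrightarrow> ord_ge a F \<and> ord_ge a G \<and> ord_ge (n + a) (F - G)"

lemma rel_ord_mult:
  assumes "rel_ord n a F F'" "rel_ord n b G G'"
  shows "rel_ord n (a + b) (F * G) (F' * G')"
proof -
  have "F * G - F' * G' = (F - F') * G + F' * (G - G')" by (simp add: algebra_simps)
  moreover have "ord_ge ((n + a) + b) ((F - F') * G)" "ord_ge (a + (n + b)) (F' * (G - G'))"
    using assms by (auto simp: rel_ord_def intro!: ord_ge_mult)
  ultimately have "ord_ge (n + (a + b)) (F * G - F' * G')"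
    by (simp add: ord_ge_add add_ac)
  then show ?thesis
    using assms by (auto simp: rel_ord_def intro: ord_ge_mult)
qed

lemma rel_ord_power: "rel_ord n a F F' \<Longrightarrow> rel_ord n (k * a) (F ^ k) (F' ^ k)"
proof (induction k)
  case (Suc k)
  then show ?case using rel_ord_mult[of n a F F' "k * a" "F ^ k" "F' ^ k"] by simp
qed (simp add: rel_ord_def)

text \<open>A change of order \<open>n\<close> in \<open>F\<close> or \<open>G\<close> moves
  \<open>F^(j+1) * G^j\<close> with \<open>j \<ge> 1\<close> only in degrees above \<open>n\<close>.
  Through degree \<open>n\<close> one therefore sees nothing but the change of the constant
  \<open>p j\<close> with \<open>2 * j + 1 = n\<close>.\<close>

lemma resonant_sum_diff_nth:
  assumes F: "ord_ge 1 F" "ord_ge 1 F'" "ord_ge n (F' - F)" and G: "ord_ge 1 G" "ord_ge 1 G'" "ord_ge n (G' - G)"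
    and n: "n \<ge> 1" and p: "\<And>j. 2 * j + 1 < n \<Longrightarrow> p' j = p j" and kl: "k + l \<le> n"
  shows "(resonant_sum p' F' G' - resonant_sum p F G) $ k $ l =
    (\<Sum>j\<in>{j. 1 \<le> j \<and> 2 * j + 1 = n \<and> k + l = n}. (p' j - p j) * (F ^ (j + 1) * G ^ j) $ k $ l)"
proof -
  obtain m where m: "n = Suc m" using n by (cases n) auto
  have *: "(F' ^ (j + 1) * G' ^ j) $ k $ l = (F ^ (j + 1) * G ^ j) $ k $ l" if "j \<ge> 1" for j
  proof -
    have "rel_ord m 1 F' F" "rel_ord m 1 G' G" using F G m by (auto simp: rel_ord_def)
    then have "rel_ord m ((j + 1) * 1 + j * 1) (F' ^ (j + 1) * G' ^ j) (F ^ (j + 1) * G ^ j)"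
      by (intro rel_ord_mult rel_ord_power)
    then have "ord_ge (Suc n) (F' ^ (j + 1) * G' ^ j - F ^ (j + 1) * G ^ j)"
      unfolding rel_ord_def using that m by (auto elim: ord_ge_mono)
    from ord_geD[OF this, of k l] kl show ?thesis by simp
  qed
  have "(resonant_sum p' F' G' - resonant_sum p F G) $ k $ l =
      (\<Sum>j=1..k+l. (p' j - p j) * (F ^ (j + 1) * G ^ j) $ k $ l)"
    unfolding fps_sub_nth resonant_sum_nth sum_subtractf[symmetric]
  proof (intro sum.cong refl)
    fix j assume "j \<in> {1..k+l}"
    then have "j \<ge> 1" by simp
    then show "p' j * (F' ^ (j + 1) * G' ^ j) $ k $ l - p j * (F ^ (j + 1) * G ^ j) $ k $ l =
        (p' j - p j) * (F ^ (j + 1) * G ^ j) $ k $ l"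
      by (simp only: * left_diff_distrib)
  qed
  also have "\<dots> = (\<Sum>j\<in>{j. 1 \<le> j \<and> 2 * j + 1 = n \<and> k + l = n}. (p' j - p j) * (F ^ (j + 1) * G ^ j) $ k $ l)"
  proof (rule sum.mono_neutral_right)
    show "\<forall>j\<in>{1..k+l} - {j. 1 \<le> j \<and> 2 * j + 1 = n \<and> k + l = n}. (p' j - p j) * (F ^ (j + 1) * G ^ j) $ k $ l = 0"
    proof
      fix j assume j: "j \<in> {1..k+l} - {j. 1 \<le> j \<and> 2 * j + 1 = n \<and> k + l = n}"
      have "ord_ge ((j + 1) * 1 + j * 1) (F ^ (j + 1) * G ^ j)"
        by (intro ord_ge_mult ord_ge_power F G)
      then have "k + l < 2 * j + 1 \<Longrightarrow> (F ^ (j + 1) * G ^ j) $ k $ l = 0"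
        by (auto intro: ord_geD)
      moreover have "2 * j + 1 < n \<or> k + l < 2 * j + 1" using j kl by auto
      ultimately show "(p' j - p j) * (F ^ (j + 1) * G ^ j) $ k $ l = 0" using p by auto
    qed
  qed auto
  finally show ?thesis .
qed

lemma pow_lead_nth:
  assumes "ord_ge 2 (F - X)" "ord_ge 2 (G - Y)" "ord_ge 1 X" "ord_ge 1 Y" "k + l = a + b"
  shows "(F ^ a * G ^ b) $ k $ l = (X ^ a * Y ^ b) $ k $ l"
proof -
  have "ord_ge 1 F" "ord_ge 1 G"
    using assms ord_ge_add[of 1 X "F - X"] ord_ge_add[of 1 Y "G - Y"]
      ord_ge_mono[of 2 "F - X" 1] ord_ge_mono[of 2 "G - Y" 1] by simp_all
  then have "rel_ord 1 1 F X" "rel_ord 1 1 G Y"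
    using assms by (auto simp: rel_ord_def numeral_2_eq_2)
  then have "rel_ord 1 (a * 1 + b * 1) (F ^ a * G ^ b) (X ^ a * Y ^ b)"
    by (intro rel_ord_mult rel_ord_power)
  then have "ord_ge (Suc (a + b)) (F ^ a * G ^ b - X ^ a * Y ^ b)"
    by (simp add: rel_ord_def)
  from ord_geD[OF this, of k l] assms(5) show ?thesis by simp
qed

text \<open>One step of the normalisation. The sign \<open>s\<close> is \<open>1\<close> for \<open>xi\<close> and \<open>-1\<close> for \<open>eta\<close>; the
  monomial \<open>z^k w^l\<close> is resonant if \<open>k - l = s\<close>.\<close>

definition residual :: "series2 \<Rightarrow> series2 \<Rightarrow> int \<Rightarrow> (nat \<Rightarrow> complex) \<Rightarrow> series2 \<Rightarrow> series2 \<Rightarrow> series2" where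
  "residual fz fw s p F G = deriv_z F * fz + deriv_w F * fw - of_int s * (F + resonant_sum p F G)"

text \<open>The linearised problem. Through degree \<open>n\<close> a correction of order
  \<open>n\<close> acts only via the linear part of the field, which multiplies its coefficient at
  \<open>(k, l)\<close> by \<open>k - l - s\<close>; the nonlinear terms raise the degree.\<close>

lemma residual_diff_nth:
  assumes fz: "ord_ge 2 (fz - var_z)" and fw: "ord_ge 2 (fw + var_w)"
    and F: "ord_ge 1 F" "ord_ge 1 F'" "ord_ge n (F' - F)" and G: "ord_ge 1 G" "ord_ge 1 G'" "ord_ge n (G' - G)"
    and n: "n \<ge> 1" and p: "\<And>j. 2 * j + 1 < n \<Longrightarrow> p' j = p j" and kl: "k + l \<le> n"
  shows "(residual fz fw s p' F' G' - residual fz fw s p F G) $ k $ l =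
    of_int (int k - int l - s) * (F' - F) $ k $ l -
    of_int s * (\<Sum>j\<in>{j. 1 \<le> j \<and> 2 * j + 1 = n \<and> k + l = n}. (p' j - p j) * (F ^ (j + 1) * G ^ j) $ k $ l)"
proof -
  define d where "d = F' - F"
  obtain m where m: "n = Suc m" using n by (cases n) auto
  have d: "ord_ge (Suc m) d" using F m by (simp add: d_def)
  have 1: "residual fz fw s p' F' G' - residual fz fw s p F G =
      (deriv_z d * var_z - deriv_w d * var_w) - of_int s * d
      - of_int s * (resonant_sum p' F' G' - resonant_sum p F G)
      + (deriv_z d * (fz - var_z) + deriv_w d * (fw + var_w))"
    by (simp add: residual_def d_def deriv_z_diff deriv_w_diff algebra_simps)
  have "ord_ge (m + 2) (deriv_z d * (fz - var_z) + deriv_w d * (fw + var_w))"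
    by (intro ord_ge_add ord_ge_mult ord_ge_deriv d fz fw)
  then have 2: "(deriv_z d * (fz - var_z) + deriv_w d * (fw + var_w)) $ k $ l = 0"
    using kl m by (intro ord_geD) auto
  have 3: "(of_int s * H) $ k $ l = of_int s * H $ k $ l" for H :: series2
    by (simp flip: fps_of_int)
  have "(residual fz fw s p' F' G' - residual fz fw s p F G) $ k $ l =
      (deriv_z d * var_z - deriv_w d * var_w) $ k $ l - of_int s * d $ k $ l
      - of_int s * (resonant_sum p' F' G' - resonant_sum p F G) $ k $ l
      + (deriv_z d * (fz - var_z) + deriv_w d * (fw + var_w)) $ k $ l"
    unfolding 1 3[symmetric] by (simp only: fps_add_nth fps_sub_nth)
  moreover have 4: "(resonant_sum p' F' G' - resonant_sum p F G) $ k $ l =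
      (\<Sum>j\<in>{j. 1 \<le> j \<and> 2 * j + 1 = n \<and> k + l = n}. (p' j - p j) * (F ^ (j + 1) * G ^ j) $ k $ l)"
    by (rule resonant_sum_diff_nth[OF F G n _ kl]) (rule p)
  ultimately show ?thesis
    unfolding 2 euler_nth 4 unfolding d_def[symmetric]
    by (simp add: left_diff_distrib)
qed

text \<open>A nonresonant error of degree \<open>n\<close> is removed by dividing by
  \<open>k - l - s\<close>. Where this divisor vanishes, which happens only for odd
  \<open>n = 2 * j + 1\<close>, the error is absorbed by \<open>p j\<close> instead. The other
  series may change at the same time, to \<open>G'\<close>, as long as it agrees below degree
  \<open>n\<close>.\<close>

lemma residual_step:
  assumes fz: "ord_ge 2 (fz - var_z)" and fw: "ord_ge 2 (fw + var_w)"
    and s: "s = 1 \<or> s = -1"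
    and F: "ord_ge 1 F" and G: "ord_ge 1 G" "ord_ge 1 G'" "ord_ge n (G' - G)" and n: "n \<ge> 2"
    and lead: "\<And>j k l. 1 \<le> j \<Longrightarrow> k + l = 2 * j + 1 \<Longrightarrow> (F ^ (j + 1) * G ^ j) $ k $ l = (if int k - int l = s then 1 else 0)"
    and norm: "\<And>k l. k + l \<ge> 2 \<Longrightarrow> int k - int l = s \<Longrightarrow> F $ k $ l = 0"
    and res: "ord_ge n (residual fz fw s p F G)"
  obtains d p' where "ord_ge n d" "\<And>k l. int k - int l = s \<Longrightarrow> d $ k $ l = 0"
    "\<And>j. 2 * j + 1 < n \<Longrightarrow> p' j = p j"
    "ord_ge (Suc n) (residual fz fw s p' (F + d) G')"
proof -
  define E where "E = residual fz fw s p F G"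
  define d :: series2 where "d = Abs_fps (\<lambda>k. Abs_fps (\<lambda>l. if k + l = n \<and> int k - int l \<noteq> s
    then - E $ k $ l / of_int (int k - int l - s) else 0))"
  \<comment> \<open>Raising \<open>p j\<close> by \<open>t\<close> changes the residual at the
    resonant monomial by \<open>- s * t\<close>, so \<open>t = s * E\<close> cancels the error
    because \<open>s^2 = 1\<close>. That monomial is \<open>z^(j+1) w^j\<close> for
    \<open>s = 1\<close> and \<open>z^j w^(j+1)\<close> for \<open>s = -1\<close>.\<close>
  define p' where "p' = (\<lambda>j. if 2 * j + 1 = n
    then p j + of_int s * (if s = 1 then E $ (j + 1) $ j else E $ j $ (j + 1)) else p j)"
  have d: "ord_ge n d" by (auto simp: d_def ord_ge_def)
  have p': "p' j = p j" if "2 * j + 1 < n" for j using that by (simp add: p'_def)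
  have Fd: "ord_ge 1 (F + d)" "ord_ge n (F + d - F)"
    using d F n by (auto intro!: ord_ge_add intro: ord_ge_mono)
  have "residual fz fw s p' (F + d) G' $ k $ l = 0" if kl: "k + l \<le> n" for k l
  proof -
    have eq: "(residual fz fw s p' (F + d) G' - E) $ k $ l = of_int (int k - int l - s) * d $ k $ l -
      of_int s * (\<Sum>j\<in>{j. 1 \<le> j \<and> 2 * j + 1 = n \<and> k + l = n}. (p' j - p j) * (F ^ (j + 1) * G ^ j) $ k $ l)"
      using residual_diff_nth[OF fz fw F(1) Fd G(1,2,3) _ p' kl] n by (simp add: E_def)
    show ?thesis
    proof (cases "k + l = n")
      case False
      then have "E $ k $ l = 0" "d $ k $ l = 0" using kl res d by (auto simp: E_def ord_ge_def)
      with eq False show ?thesis by simp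
    next
      case True
      show ?thesis
      proof (cases "int k - int l = s")
        case False
        have "(\<Sum>j\<in>{j. 1 \<le> j \<and> 2 * j + 1 = n \<and> k + l = n}. (p' j - p j) * (F ^ (j + 1) * G ^ j) $ k $ l) = 0"
          using lead[of _ k l] False by (intro sum.neutral) auto
        moreover have "of_int (int k - int l - s) * d $ k $ l = - E $ k $ l"
        proof -
          have "of_int (int k - int l - s) \<noteq> (0 :: complex)"
            using False by (simp only: of_int_eq_0_iff)
          moreover have "d $ k $ l = - E $ k $ l / of_int (int k - int l - s)"
            using False True by (simp add: d_def del: of_int_diff)
          ultimately show ?thesis by (simp del: of_int_diff)
        qed
        ultimately show ?thesis using eq by simp
      next
        case res: True
        define j where "j = (if s = 1 then l else k)"
        have j: "2 * j + 1 = n" "1 \<le> j" using res s \<open>k + l = n\<close> n by (auto simp: j_def)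
        have kl': "if s = 1 then k = j + 1 \<and> l = j else k = j \<and> l = j + 1"
          using res s by (auto simp: j_def)
        have set: "{i. 1 \<le> i \<and> 2 * i + 1 = n \<and> k + l = n} = {j}" using j True by auto
        have "p' j - p j = of_int s * E $ k $ l"
          using j kl' s by (auto simp: p'_def split: if_splits)
        moreover have "(F ^ (j + 1) * G ^ j) $ k $ l = 1" using lead[OF j(2)] j(1) True res by simp
        moreover have "of_int s * of_int s = (1 :: complex)" using s by auto
        ultimately have "residual fz fw s p' (F + d) G' $ k $ l - E $ k $ l = - E $ k $ l"
          using eq res unfolding set by (simp add: mult.assoc[symmetric])
        then show ?thesis by simp
      qed
    qed
  qed
  then have "ord_ge (Suc n) (residual fz fw s p' (F + d) G')" by (auto simp: ord_ge_def)
  moreover have "\<And>k l. int k - int l = s \<Longrightarrow> d $ k $ l = 0" by (simp add: d_def)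
  ultimately show ?thesis using d p' that by blast
qed

lemma residual_cong:
  assumes fz: "ord_ge 2 (fz - var_z)" and fw: "ord_ge 2 (fw + var_w)"
    and F: "ord_ge 1 F" "ord_ge 1 F'" "ord_ge n (F' - F)" and G: "ord_ge 1 G" "ord_ge 1 G'" "ord_ge n (G' - G)"
    and n: "n \<ge> 1" and p: "\<And>j. 2 * j + 1 < n \<Longrightarrow> p' j = p j"
  shows "ord_ge n (residual fz fw s p F G) \<longleftrightarrow> ord_ge n (residual fz fw s p' F' G')"
proof -
  have "(residual fz fw s p' F' G' - residual fz fw s p F G) $ k $ l = 0" if "k + l < n" for k l
    by (rule trans[OF residual_diff_nth[OF fz fw F G n _ less_imp_le[OF that]]])
       (use p that ord_geD[OF F(3) that] in auto)
  then show ?thesis by (auto simp: ord_ge_def)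
qed

text \<open>The second series enters only through the resonant sum, where a change of order
  \<open>n\<close> stays invisible through degree \<open>n\<close>. Hence one whole degree more is
  preserved than in \<open>residual_cong\<close>.\<close>

lemma residual_cong_snd:
  assumes fz: "ord_ge 2 (fz - var_z)" and fw: "ord_ge 2 (fw + var_w)"
    and F: "ord_ge 1 F" and G: "ord_ge 1 G" "ord_ge 1 G'" "ord_ge n (G' - G)"
    and n: "n \<ge> 1" and res: "ord_ge (Suc n) (residual fz fw s p F G)"
  shows "ord_ge (Suc n) (residual fz fw s p F G')"
proof -
  have "(residual fz fw s p F G' - residual fz fw s p F G) $ k $ l = 0" if "k + l \<le> n" for k l
    by (rule trans[OF residual_diff_nth[OF fz fw F F _ G n _ that]]) auto
  then show ?thesis using res by (auto simp: ord_ge_def)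
qed

lemma lead_xi:
  assumes "ord_ge 2 (xi - var_z)" "ord_ge 2 (eta - var_w)" "k + l = 2 * j + 1"
  shows "(xi ^ (j + 1) * eta ^ j) $ k $ l = (if int k - int l = 1 then 1 else 0)"
  using pow_lead_nth[OF assms(1,2) ord_ge_var, of k l "j + 1" j] assms(3)
  by (simp only: var_power_nth) auto

lemma lead_eta:
  assumes "ord_ge 2 (xi - var_z)" "ord_ge 2 (eta - var_w)" "k + l = 2 * j + 1"
  shows "(eta ^ (j + 1) * xi ^ j) $ k $ l = (if int k - int l = -1 then 1 else 0)"
  using pow_lead_nth[OF assms(2,1) ord_ge_var(2,1), of k l "j + 1" j] assms(3)
  by (simp only: mult.commute[of "var_w ^ _"] var_power_nth) auto

lemma ord_ge_of_lead: "ord_ge 2 (F - X) \<Longrightarrow> ord_ge 1 X \<Longrightarrow> ord_ge 1 F"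
  using ord_ge_add[of 1 X "F - X"] ord_ge_mono[of 2 "F - X" 1] by simp

text \<open>Corrections are made degree by degree. Stage \<open>m\<close> leaves all coefficients of
  total degree below \<open>m + 2\<close> and all constants with \<open>2 * j + 1 < m + 2\<close>
  untouched, so the stages converge coefficientwise.\<close>

lemma formal_normal_form_exists:
  assumes fz: "ord_ge 2 (fz - var_z)" and fw: "ord_ge 2 (fw + var_w)"
  shows "\<exists>xi eta p q. ord_ge 2 (xi - var_z) \<and> ord_ge 2 (eta - var_w) \<and>
    (\<forall>k l. k + l \<ge> 2 \<longrightarrow> int k - int l = 1 \<longrightarrow> xi $ k $ l = 0) \<and>
    (\<forall>k l. k + l \<ge> 2 \<longrightarrow> int k - int l = -1 \<longrightarrow> eta $ k $ l = 0) \<and>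
    residual fz fw 1 p xi eta = 0 \<and> residual fz fw (-1) q eta xi = 0"
proof -
  define P where "P = (\<lambda>m (xi, eta, p, q). ord_ge 2 (xi - var_z) \<and> ord_ge 2 (eta - var_w) \<and>
    (\<forall>k l. k + l \<ge> 2 \<longrightarrow> int k - int l = 1 \<longrightarrow> xi $ k $ l = 0) \<and>
    (\<forall>k l. k + l \<ge> 2 \<longrightarrow> int k - int l = -1 \<longrightarrow> eta $ k $ l = 0) \<and>
    ord_ge (m + 2) (residual fz fw 1 p xi eta) \<and> ord_ge (m + 2) (residual fz fw (-1) q eta xi))"
  define Q where "Q = (\<lambda>m (xi, eta, p :: nat \<Rightarrow> complex, q :: nat \<Rightarrow> complex) (xi', eta', p', q').
    ord_ge (m + 2) (xi' - xi) \<and> ord_ge (m + 2) (eta' - eta) \<and>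
    (\<forall>j. 2 * j + 1 < m + 2 \<longrightarrow> p' j = p j \<and> q' j = q j))"
  have "\<exists>f. \<forall>m. P m (f m) \<and> Q m (f m) (f (Suc m))"
  proof (rule dependent_nat_choice)
    have dz: "deriv_z var_z = 1" "deriv_w var_z = 0" "deriv_z var_w = 0" "deriv_w var_w = 1"
      by (auto simp: fps_eq_iff deriv_z_nth deriv_w_nth var_z_nth var_w_nth fps_one_nth)
    have "resonant_sum (\<lambda>_. 0) F G = 0" for F G
      by (rule fps_ext, rule fps_ext) (simp add: resonant_sum_nth)
    then have "P 0 (var_z, var_w, \<lambda>_. 0, \<lambda>_. 0)"
      using fz fw by (auto simp: P_def residual_def dz var_z_nth var_w_nth add.commute numeral_2_eq_2)
    then show "\<exists>S. P 0 S" by blast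
  next
    fix S m assume "P m S"
    then obtain xi eta p q where S: "S = (xi, eta, p, q)"
      and xi: "ord_ge 2 (xi - var_z)" and eta: "ord_ge 2 (eta - var_w)"
      and nxi: "\<And>k l. k + l \<ge> 2 \<Longrightarrow> int k - int l = 1 \<Longrightarrow> xi $ k $ l = 0"
      and neta: "\<And>k l. k + l \<ge> 2 \<Longrightarrow> int k - int l = -1 \<Longrightarrow> eta $ k $ l = 0"
      and rxi: "ord_ge (m + 2) (residual fz fw 1 p xi eta)"
      and reta: "ord_ge (m + 2) (residual fz fw (-1) q eta xi)"
      by (cases S) (auto simp: P_def)
    note xi1 = ord_ge_of_lead[OF xi ord_ge_var(1)] and eta1 = ord_ge_of_lead[OF eta ord_ge_var(2)]
    obtain e q' where e: "ord_ge (m + 2) e" "\<And>k l. int k - int l = -1 \<Longrightarrow> e $ k $ l = 0"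
      and q': "\<And>j. 2 * j + 1 < m + 2 \<Longrightarrow> q' j = q j"
      and reta': "ord_ge (Suc (m + 2)) (residual fz fw (-1) q' (eta + e) xi)"
      by (rule residual_step[OF fz fw _ eta1 xi1 xi1 _ _ lead_eta[OF xi eta] neta reta]) auto
    have eta': "ord_ge 2 (eta + e - var_w)"
      using ord_ge_add[OF eta ord_ge_mono[OF e(1), of 2]] by (simp add: algebra_simps)
    note eta1' = ord_ge_of_lead[OF eta' ord_ge_var(2)]
    obtain d p' where d: "ord_ge (m + 2) d" "\<And>k l. int k - int l = 1 \<Longrightarrow> d $ k $ l = 0"
      and p': "\<And>j. 2 * j + 1 < m + 2 \<Longrightarrow> p' j = p j"
      and rxi': "ord_ge (Suc (m + 2)) (residual fz fw 1 p' (xi + d) (eta + e))"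
      by (rule residual_step[OF fz fw _ xi1 eta1 eta1' _ _ lead_xi[OF xi eta] nxi rxi]) (use e in auto)
    have xi': "ord_ge 2 (xi + d - var_z)"
      using ord_ge_add[OF xi ord_ge_mono[OF d(1), of 2]] by (simp add: algebra_simps)
    note xi1' = ord_ge_of_lead[OF xi' ord_ge_var(1)]
    \<comment> \<open>The equation for \<open>eta\<close> was solved against the old
      \<open>xi\<close>; passing to the corrected \<open>xi\<close> does no harm in the degrees
      considered.\<close>
    have "ord_ge (Suc (m + 2)) (residual fz fw (-1) q' (eta + e) (xi + d))"
      by (rule residual_cong_snd[OF fz fw eta1' xi1 xi1' _ _ reta']) (use d in auto)
    then have "P (Suc m) (xi + d, eta + e, p', q')" "Q m S (xi + d, eta + e, p', q')"
      using xi' eta' rxi' nxi neta d e p' q' by (auto simp: P_def Q_def S)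
    then show "\<exists>S'. P (Suc m) S' \<and> Q m S S'" by blast
  qed
  then obtain f where f: "\<And>m. P m (f m)" "\<And>m. Q m (f m) (f (Suc m))" by blast
  define X where "X m = fst (f m)" for m
  define Y where "Y m = fst (snd (f m))" for m
  define p where "p m = fst (snd (snd (f m)))" for m
  define q where "q m = snd (snd (snd (f m)))" for m
  have fm: "f m = (X m, Y m, p m, q m)" for m by (simp add: X_def Y_def p_def q_def)
  note PX = f(1)[unfolded fm P_def, simplified] and QX = f(2)[unfolded fm Q_def, simplified]
  have step: "ord_ge (m + 2) (X (m + d) - X m) \<and> ord_ge (m + 2) (Y (m + d) - Y m) \<and>
      (\<forall>j. 2 * j + 1 < m + 2 \<longrightarrow> p (m + d) j = p m j \<and> q (m + d) j = q m j)" for m d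
  proof (induction d)
    case (Suc d)
    have "ord_ge (m + 2) (X (Suc (m + d)) - X (m + d))" "ord_ge (m + 2) (Y (Suc (m + d)) - Y (m + d))"
      using QX[of "m + d"] by (auto elim: ord_ge_mono)
    from ord_ge_add[OF this(1)] ord_ge_add[OF this(2)] Suc QX[of "m + d"] show ?case by force
  qed auto
  have agree: "X m' $ k $ l = X m $ k $ l" "Y m' $ k $ l = Y m $ k $ l" if "m \<le> m'" "k + l < m + 2" for m m' k l
    using step[of m "m' - m"] that by (auto simp: ord_ge_def)
  have agree_pq: "p m' j = p m j" "q m' j = q m j" if "m \<le> m'" "2 * j + 1 < m + 2" for m m' j
    using step[of m "m' - m"] that by auto
  \<comment> \<open>A diagonal choice: by stage \<open>k + l\<close> the coefficient at
    \<open>(k, l)\<close> has become final, and by stage \<open>2 * j\<close> the constants of index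
    \<open>j\<close> have.\<close>
  define XX :: series2 where "XX = Abs_fps (\<lambda>k. Abs_fps (\<lambda>l. X (k + l) $ k $ l))"
  define YY :: series2 where "YY = Abs_fps (\<lambda>k. Abs_fps (\<lambda>l. Y (k + l) $ k $ l))"
  define pp where "pp j = p (2 * j) j" for j
  define qq where "qq j = q (2 * j) j" for j
  have lim: "XX $ k $ l = X m $ k $ l" "YY $ k $ l = Y m $ k $ l" if "k + l < m + 2" for k l m
  proof -
    have "X (k + l) $ k $ l = X m $ k $ l \<and> Y (k + l) $ k $ l = Y m $ k $ l"
    proof (cases "k + l \<le> m")
      case True
      then show ?thesis using agree[of "k + l" m k l] by simp
    next
      case False
      then show ?thesis using agree[of m "k + l" k l] that by simp
    qed
    then show "XX $ k $ l = X m $ k $ l" "YY $ k $ l = Y m $ k $ l" by (simp_all add: XX_def YY_def)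
  qed
  have lim_pq: "pp j = p m j" "qq j = q m j" if "2 * j + 1 < m + 2" for j m
    using agree_pq[of "2 * j" m j] that by (simp_all add: pp_def qq_def)
  have XX: "ord_ge (m + 2) (XX - X m)" "ord_ge (m + 2) (YY - Y m)" for m
    using lim by (simp_all add: ord_ge_def)
  have lead: "ord_ge 2 (XX - var_z)" "ord_ge 2 (YY - var_w)"
    using ord_ge_add[of 2 "XX - X 0" "X 0 - var_z"] ord_ge_add[of 2 "YY - Y 0" "Y 0 - var_w"]
      XX[of 0] PX[of 0] by (simp_all add: numeral_2_eq_2)
  note XX1 = ord_ge_of_lead[OF lead(1) ord_ge_var(1)] and YY1 = ord_ge_of_lead[OF lead(2) ord_ge_var(2)]
  have X1: "ord_ge 1 (X m)" "ord_ge 1 (Y m)" for m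
    using PX[of m] ord_ge_of_lead ord_ge_var by blast+
  have "ord_ge (m + 2) (residual fz fw 1 pp XX YY)" for m
    by (rule iffD1[OF residual_cong[where p = "p m", OF fz fw X1(1) XX1 XX(1) X1(2) YY1 XX(2)]])
       (use PX[of m] lim_pq in auto)
  then have 1: "residual fz fw 1 pp XX YY = 0"
    unfolding ord_ge_def by (intro fps_ext) (metis fps_zero_nth less_add_same_cancel1 pos2)
  have "ord_ge (m + 2) (residual fz fw (-1) qq YY XX)" for m
    by (rule iffD1[OF residual_cong[where p = "q m", OF fz fw X1(2) YY1 XX(2) X1(1) XX1 XX(1)]])
       (use PX[of m] lim_pq in auto)
  then have 2: "residual fz fw (-1) qq YY XX = 0"
    unfolding ord_ge_def by (intro fps_ext) (metis fps_zero_nth less_add_same_cancel1 pos2)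
  have 3: "\<forall>k l. k + l \<ge> 2 \<longrightarrow> int k - int l = 1 \<longrightarrow> XX $ k $ l = 0"
      "\<forall>k l. k + l \<ge> 2 \<longrightarrow> int k - int l = -1 \<longrightarrow> YY $ k $ l = 0"
    using PX by (simp_all add: XX_def YY_def)
  show ?thesis using lead 1 2 3 by blast
qed

lemma cst_mult_nth: "(cst c * F) $ k $ l = c * F $ k $ l"
  by (simp add: cst_def)

text \<open>The linear part of the translated real system is the rotation \<open>(- y, x)\<close>.
  In the coordinates \<open>z\<close>, \<open>w\<close> and the time \<open>T\<close> it becomes
  \<open>z\<close> and \<open>- w\<close>.\<close>

lemma ord_ge_field:
  "ord_ge 2 (field_z lam - var_z)" "ord_ge 2 (field_w lam + var_w)"
proof -
  obtain a2 a3 a4 a6 a7 a8 a9 a10 where lam: "lam = (a2, a3, a4, a6, a7, a8, a9, a10)"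
    by (cases lam) auto
  define s where "s = cst (1/2) * (var_z + var_w)"
  define Y where "Y = cst (1 / (2 * \<i>)) * (var_z - var_w)"
  define e where "e = (\<lambda>c::real. cst (complex_of_real c))"
  have sY: "ord_ge 1 s" "ord_ge 1 Y"
    unfolding s_def Y_def by (intro ord_ge_mult_left ord_ge_add ord_ge_diff ord_ge_var)+
  have ord2: "ord_ge 2 (F * G)" if "ord_ge 1 F" "ord_ge 1 G" for F G
    using ord_ge_mult[OF that] by (simp add: numeral_2_eq_2)
  \<comment> \<open>With \<open>x = s + 1\<close>, splitting
    \<open>x^4 = 1 + s * (s^3 + 4 * s^2 + 6 * s + 4)\<close> isolates the linear term; every other
    summand contains \<open>s * Y\<close> or \<open>Y * Y\<close>.\<close>
  have cx: "cplx_x lam + Y = - (s * Y * (s^3 + 4 * s^2 + 6 * s + 4))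
      + Y * Y * (e a2 * (s + 1)^3 + e a3 * (s + 1)^2 * Y + e a4 * (s + 1) * Y^2)"
    unfolding cplx_x_def lam rhs_x.simps s_def[symmetric] Y_def[symmetric] e_def by algebra
  have "ord_ge 2 (cplx_x lam + Y)"
    unfolding cx by (intro ord_ge_add ord_ge_uminus ord_ge_mult_right ord2 sY)
  note cx = this
  \<comment> \<open>The coefficient 1/4 normalises the frequency:
    \<open>((s + 1)^5 - (s + 1)) / 4\<close> starts with \<open>s\<close>.\<close>
  have e4: "e (1/4) * 4 = 1"
    by (rule fps_ext, rule fps_ext) (simp add: e_def cst_def fps_numeral_fps_const)
  have "cplx_y lam - s = (e (1/4) * 4 - 1) * s + e (1/4) * (s * s * (10 + 10 * s + 5 * s^2 + s^3))
      + e a6 * (s * Y * (s^3 + 4 * s^2 + 6 * s + 4))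
      + Y * Y * (e a7 * (s + 1)^3 + e a8 * (s + 1)^2 * Y + e a9 * (s + 1) * Y^2 + e a10 * Y^3)"
    unfolding cplx_y_def lam rhs_y.simps s_def[symmetric] Y_def[symmetric] e_def by algebra
  also have "ord_ge 2 \<dots>"
    unfolding e4 by (intro ord_ge_add ord_ge_mult_left[of 2 _ "e _"] ord_ge_mult_right ord2 sY) auto
  finally have cy: "ord_ge 2 (cplx_y lam - s)" .
  have "field_z lam - var_z = cst (-\<i>) * ((cplx_x lam + Y) + cst \<i> * (cplx_y lam - s))
      + (cst (-\<i>) * (cst \<i> * s - Y) - var_z)"
    by (simp add: field_z_def algebra_simps)
  moreover have "cst (-\<i>) * (cst \<i> * s - Y) - var_z = 0"
    by (rule fps_ext, rule fps_ext) (simp add: s_def Y_def cst_mult_nth, (simp add: field_simps)?)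
  moreover have "ord_ge 2 (cst (-\<i>) * ((cplx_x lam + Y) + cst \<i> * (cplx_y lam - s)))"
    by (intro ord_ge_mult_left ord_ge_add cx cy)
  ultimately show "ord_ge 2 (field_z lam - var_z)" by (simp only: add_0_right)
  have "field_w lam + var_w = cst (-\<i>) * ((cplx_x lam + Y) - cst \<i> * (cplx_y lam - s))
      + (cst (-\<i>) * (- cst \<i> * s - Y) + var_w)"
    by (simp add: field_w_def algebra_simps)
  moreover have "cst (-\<i>) * (- cst \<i> * s - Y) + var_w = 0"
    by (rule fps_ext, rule fps_ext) (simp add: s_def Y_def cst_mult_nth, (simp add: field_simps)?)
  moreover have "ord_ge 2 (cst (-\<i>) * ((cplx_x lam + Y) - cst \<i> * (cplx_y lam - s)))"
    by (intro ord_ge_mult_left ord_ge_diff ord_ge_add cx cy)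
  ultimately show "ord_ge 2 (field_w lam + var_w)" by (simp only: add_0_right)
qed

lemma normal_form_exists: "\<exists>xi eta p q. normal_form lam xi eta p q"
proof -
  obtain xi eta p q where xi: "ord_ge 2 (xi - var_z)" and eta: "ord_ge 2 (eta - var_w)"
    and nxi: "\<And>k l. k + l \<ge> 2 \<Longrightarrow> int k - int l = 1 \<Longrightarrow> xi $ k $ l = 0"
    and neta: "\<And>k l. k + l \<ge> 2 \<Longrightarrow> int k - int l = -1 \<Longrightarrow> eta $ k $ l = 0"
    and res: "residual (field_z lam) (field_w lam) 1 p xi eta = 0"
      "residual (field_z lam) (field_w lam) (-1) q eta xi = 0"
    using formal_normal_form_exists[OF ord_ge_field, of lam] by blast
  have "normal_form lam xi eta p q"
    unfolding normal_form_def
    using ord_geD[OF xi, of 0 0] ord_geD[OF xi, of 1 0] ord_geD[OF xi, of 0 1]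
      ord_geD[OF eta, of 0 0] ord_geD[OF eta, of 1 0] ord_geD[OF eta, of 0 1] nxi neta res
    by (auto simp: residual_def deriv_T_def var_z_nth var_w_nth algebra_simps eq_neg_iff_add_eq_0)
  then show ?thesis by blast
qed

subsection \<open>Taylor polynomials of formal series\<close>

definition tri :: "nat \<Rightarrow> (nat \<times> nat) set" where
  "tri N = {(k, l). k + l \<le> N}"

lemma finite_tri [simp]: "finite (tri N)"
  by (rule finite_subset[of _ "{..N} \<times> {..N}"]) (auto simp: tri_def)

text \<open>The Taylor polynomial of degree \<open>N\<close> of a series, on the real plane \<open>w = cnj z\<close>.\<close>

definition taylor :: "nat \<Rightarrow> series2 \<Rightarrow> complex \<Rightarrow> complex" where
  "taylor N F z = (\<Sum>(k, l)\<in>tri N. F $ k $ l * z ^ k * cnj z ^ l)"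

text \<open>A substitute for convergence: the formal series only has to be asymptotic to the
  function, and \<open>z ^ (N + 1)\<close> merely measures the size of the remainder on the real
  plane. The relation respects all ring operations.\<close>

definition approx :: "nat \<Rightarrow> (complex \<Rightarrow> complex) \<Rightarrow> series2 \<Rightarrow> bool" where
  "approx N f F \<longleftrightarrow> (\<lambda>z. f z - taylor N F z) \<in> O[at 0](\<lambda>z. z ^ (N + 1))"

lemma monomial_bigo:
  assumes "m \<le> k + l"
  shows "(\<lambda>z. c * z ^ k * cnj z ^ l) \<in> O[at 0](\<lambda>z :: complex. z ^ m)"
proof (rule bigoI)
  have "eventually (\<lambda>z :: complex. z \<in> ball 0 1) (at 0)"
    by (rule eventually_at_in_open') auto
  then show "eventually (\<lambda>z. norm (c * z ^ k * cnj z ^ l) \<le> norm c * norm (z ^ m)) (at 0)"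
  proof eventually_elim
    case (elim z)
    have "norm z ^ (k + l) \<le> norm z ^ m" using elim assms by (intro power_decreasing) auto
    then show ?case by (simp add: norm_mult norm_power power_add mult.assoc mult_left_mono)
  qed
qed

lemma taylor_add: "taylor N (F + G) z = taylor N F z + taylor N G z"
  unfolding taylor_def sum.distrib[symmetric] by (intro sum.cong) (auto simp: algebra_simps)

lemma taylor_diff: "taylor N (F - G) z = taylor N F z - taylor N G z"
  unfolding taylor_def sum_subtractf[symmetric] by (intro sum.cong) (auto simp: algebra_simps)

lemma taylor_bigo:
  assumes "ord_ge m F"
  shows "taylor N F \<in> O[at 0](\<lambda>z. z ^ m)"
proof -
  have "(\<lambda>z. \<Sum>x\<in>tri N. case x of (k, l) \<Rightarrow> F $ k $ l * z ^ k * cnj z ^ l) \<in> O[at 0](\<lambda>z. z ^ m)"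
  proof (rule big_sum_in_bigo)
    fix x assume "x \<in> tri N"
    obtain k l where x: "x = (k, l)" by (cases x)
    show "(\<lambda>z. case x of (k, l) \<Rightarrow> F $ k $ l * z ^ k * cnj z ^ l) \<in> O[at 0](\<lambda>z. z ^ m)"
      using monomial_bigo[of m k l "F $ k $ l"] ord_geD[OF assms, of k l] by (cases "m \<le> k + l") (auto simp: x)
  qed
  then show ?thesis by (simp add: taylor_def[abs_def])
qed

lemma taylor_Suc_bigo: "(\<lambda>z. taylor (Suc N) F z - taylor N F z) \<in> O[at 0](\<lambda>z. z ^ (N + 1))"
proof -
  have sub: "tri N \<subseteq> tri (Suc N)" by (auto simp: tri_def)
  have "taylor (Suc N) F z - taylor N F z =
      (\<Sum>(k, l)\<in>tri (Suc N) - tri N. F $ k $ l * z ^ k * cnj z ^ l)" for z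
    unfolding taylor_def by (subst sum_diff) (simp_all add: sub)
  moreover have "(\<lambda>z. \<Sum>x\<in>tri (Suc N) - tri N. case x of (k, l) \<Rightarrow> F $ k $ l * z ^ k * cnj z ^ l)
      \<in> O[at 0](\<lambda>z. z ^ (N + 1))"
  proof (rule big_sum_in_bigo)
    fix x assume "x \<in> tri (Suc N) - tri N"
    then obtain k l where x: "x = (k, l)" "N + 1 \<le> k + l" by (cases x) (auto simp: tri_def)
    show "(\<lambda>z. case x of (k, l) \<Rightarrow> F $ k $ l * z ^ k * cnj z ^ l) \<in> O[at 0](\<lambda>z. z ^ (N + 1))"
      using monomial_bigo[OF x(2)] by (simp add: x)
  qed
  ultimately show ?thesis by simp
qed

text \<open>The product of the two polynomials differs from the truncated product by index pairs of
  total degree above \<open>N\<close>, the complement of \<open>S\<close>.\<close>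

lemma taylor_mult_bigo:
  "(\<lambda>z. taylor N F z * taylor N G z - taylor N (F * G) z) \<in> O[at 0](\<lambda>z. z ^ (N + 1))"
proof -
  define t where "t z = (\<lambda>((i, j), (i', j')). F $ i $ j * G $ i' $ j' * z ^ (i + i') * cnj z ^ (j + j'))" for z
  define S where "S = {((i, j), (i', j')). (i + j) + (i' + j') \<le> N}"
  have S: "S \<subseteq> tri N \<times> tri N" by (auto simp: S_def tri_def)
  have 1: "taylor N F z * taylor N G z = sum (t z) (tri N \<times> tri N)" for z
    unfolding taylor_def sum_product sum.cartesian_product
    by (intro sum.cong) (auto simp: t_def power_add mult_ac)
  have 2: "taylor N (F * G) z = sum (t z) S" for z
  proof -
    have "taylor N (F * G) z =
        (\<Sum>(k, l)\<in>tri N. \<Sum>(i, j)\<in>{..k} \<times> {..l}. F $ i $ j * G $ (k - i) $ (l - j) * z ^ k * cnj z ^ l)"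
      unfolding taylor_def series2_mult_nth sum.cartesian_product sum_distrib_right
      by (intro sum.cong refl) (auto intro!: sum.cong)
    also have "\<dots> = (\<Sum>((k, l), (i, j))\<in>(SIGMA (k, l):tri N. {..k} \<times> {..l}).
        F $ i $ j * G $ (k - i) $ (l - j) * z ^ k * cnj z ^ l)"
      by (subst sum.Sigma[symmetric]) (auto intro!: sum.cong simp: case_prod_unfold)
    also have "\<dots> = sum (t z) S"
      by (rule sum.reindex_bij_witness[where
            i = "\<lambda>((i, j), (i', j')). ((i + i', j + j'), (i, j))" and
            j = "\<lambda>((k, l), (i, j)). ((i, j), (k - i, l - j))"])
         (auto simp: S_def tri_def t_def)
    finally show ?thesis .
  qed
  have "taylor N F z * taylor N G z - taylor N (F * G) z = sum (t z) (tri N \<times> tri N - S)" for z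
    unfolding 1 2 using S by (subst sum_diff) auto
  moreover have "(\<lambda>z. \<Sum>x\<in>tri N \<times> tri N - S. t z x) \<in> O[at 0](\<lambda>z. z ^ (N + 1))"
  proof (rule big_sum_in_bigo)
    fix x assume "x \<in> tri N \<times> tri N - S"
    then obtain i j i' j' where x: "x = ((i, j), (i', j'))" "N + 1 \<le> (i + i') + (j + j')"
      by (cases x) (auto simp: S_def)
    show "(\<lambda>z. t z x) \<in> O[at 0](\<lambda>z. z ^ (N + 1))"
      using monomial_bigo[OF x(2)] by (simp add: x t_def)
  qed
  ultimately show ?thesis by simp
qed

lemma approx_add: "approx N f F \<Longrightarrow> approx N g G \<Longrightarrow> approx N (\<lambda>z. f z + g z) (F + G)"
  unfolding approx_def taylor_add by (drule (1) sum_in_bigo(1)) (simp add: algebra_simps)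

lemma approx_diff: "approx N f F \<Longrightarrow> approx N g G \<Longrightarrow> approx N (\<lambda>z. f z - g z) (F - G)"
  unfolding approx_def taylor_diff by (drule (1) sum_in_bigo(2)) (simp add: algebra_simps)

lemma taylor_0: "taylor N 0 z = 0"
  by (simp add: taylor_def)

lemma approx_uminus: "approx N f F \<Longrightarrow> approx N (\<lambda>z. - f z) (- F)"
  using approx_diff[of N "\<lambda>_. 0" 0 f F] by (simp add: approx_def taylor_0)

lemma approx_taylor: "approx N (taylor N F) F"
  by (simp add: approx_def)

lemma approx_taylor_Suc: "approx N (taylor (Suc N) F) F"
  using taylor_Suc_bigo by (simp add: approx_def)

lemma taylor_monomial:
  assumes "\<And>k l. (k, l) \<noteq> (i, j) \<Longrightarrow> F $ k $ l = 0" "i + j \<le> N"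
  shows "taylor N F z = F $ i $ j * z ^ i * cnj z ^ j"
proof -
  have "taylor N F z = (\<Sum>(k, l)\<in>{(i, j)}. F $ k $ l * z ^ k * cnj z ^ l)"
    unfolding taylor_def
  proof (rule sum.mono_neutral_right)
    show "{(i, j)} \<subseteq> tri N" using assms(2) by (simp add: tri_def)
    show "\<forall>x\<in>tri N - {(i, j)}. (case x of (k, l) \<Rightarrow> F $ k $ l * z ^ k * cnj z ^ l) = 0"
    proof
      fix x assume "x \<in> tri N - {(i, j)}"
      then show "(case x of (k, l) \<Rightarrow> F $ k $ l * z ^ k * cnj z ^ l) = 0"
        using assms(1)[of "fst x" "snd x"] by (simp add: case_prod_unfold)
    qed
  qed simp
  then show ?thesis by simp
qed

lemma approx_cst: "approx N (\<lambda>_. c) (cst c)"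
proof -
  have "taylor N (cst c) z = c" for z
    by (subst taylor_monomial[of 0 0]) (auto simp: cst_def)
  then show ?thesis by (simp add: approx_def)
qed

lemma approx_var_z: "N \<ge> 1 \<Longrightarrow> approx N (\<lambda>z. z) var_z"
  using taylor_monomial[of 1 0 var_z N] by (simp add: approx_def var_z_nth)

lemma approx_var_w: "N \<ge> 1 \<Longrightarrow> approx N cnj var_w"
  using taylor_monomial[of 0 1 var_w N] by (simp add: approx_def var_w_nth)

lemma approx_bounded:
  assumes "approx N f F"
  shows "f \<in> O[at 0](\<lambda>_. 1)"
proof -
  have "(\<lambda>z::complex. z ^ (N + 1)) \<in> O[at 0](\<lambda>z. z ^ 0)"
    using monomial_bigo[of 0 "N + 1" 0 1] by simp
  then have "(\<lambda>z. f z - taylor N F z) \<in> O[at 0](\<lambda>z. z ^ 0)"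
    using assms unfolding approx_def by (rule landau_o.big.trans[rotated])
  from sum_in_bigo(1)[OF this taylor_bigo[of 0 F N]] show ?thesis by simp
qed

lemma approx_mult:
  assumes f: "approx N f F" and g: "approx N g G"
  shows "approx N (\<lambda>z. f z * g z) (F * G)"
proof -
  have A: "(\<lambda>z. (f z - taylor N F z) * g z) \<in> O[at 0](\<lambda>z. z ^ (N + 1) * 1)"
    using f approx_bounded[OF g] unfolding approx_def by (rule landau_o.big.mult)
  have B: "(\<lambda>z. taylor N F z * (g z - taylor N G z)) \<in> O[at 0](\<lambda>z. 1 * z ^ (N + 1))"
    using approx_bounded[OF approx_taylor] g unfolding approx_def by (rule landau_o.big.mult)
  have "(\<lambda>z. (f z - taylor N F z) * g z + taylor N F z * (g z - taylor N G z)
      + (taylor N F z * taylor N G z - taylor N (F * G) z)) \<in> O[at 0](\<lambda>z. z ^ (N + 1))"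
    by (rule sum_in_bigo(1)[OF sum_in_bigo(1)[OF A[unfolded mult_1_right] B[unfolded mult_1_left]] taylor_mult_bigo])
  moreover have "(f z - taylor N F z) * g z + taylor N F z * (g z - taylor N G z)
      + (taylor N F z * taylor N G z - taylor N (F * G) z) = f z * g z - taylor N (F * G) z" for z
    by (simp add: algebra_simps)
  ultimately show ?thesis unfolding approx_def by (simp only:)
qed

lemma approx_one: "approx N (\<lambda>_. 1) 1"
  using approx_cst[of N 1] by (simp add: cst_def)

lemma approx_power: "approx N f F \<Longrightarrow> approx N (\<lambda>z. f z ^ n) (F ^ n)"
  by (induction n) (auto intro: approx_mult approx_one)

lemma approx_sum: "(\<And>i. i \<in> A \<Longrightarrow> approx N (f i) (F i)) \<Longrightarrow> approx N (\<lambda>z. \<Sum>i\<in>A. f i z) (\<Sum>i\<in>A. F i)"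
proof (induction A rule: infinite_finite_induct)
  case (insert x A)
  then show ?case by (simp add: approx_add)
qed (auto simp: approx_def taylor_0)

lemma approx_diff_bigo:
  assumes f: "approx N f F" and g: "approx N g G" and "ord_ge m (F - G)" "m \<le> N + 1"
  shows "(\<lambda>z. f z - g z) \<in> O[at 0](\<lambda>z. z ^ m)"
proof -
  have "(\<lambda>z::complex. z ^ (N + 1)) \<in> O[at 0](\<lambda>z. z ^ m)"
    using monomial_bigo[of m "N + 1" 0 1] assms(4) by simp
  moreover have "(\<lambda>z. f z - g z - taylor N (F - G) z) \<in> O[at 0](\<lambda>z. z ^ (N + 1))"
    using approx_diff[OF f g] by (simp add: approx_def)
  ultimately have "(\<lambda>z. f z - g z - taylor N (F - G) z) \<in> O[at 0](\<lambda>z. z ^ m)"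
    by (rule landau_o.big.trans[rotated])
  from sum_in_bigo(1)[OF this taylor_bigo[OF assms(3), of N]]
  show ?thesis by (simp only: diff_add_cancel)
qed

text \<open>The chain rule in Wirtinger form, with \<open>w = cnj z\<close>. Differentiation lowers
  the degree, which is why polynomials of degree \<open>N + 1\<close> are followed along orbits when
  degree \<open>N\<close> is wanted for the field.\<close>

lemma taylor_has_vector_derivative:
  assumes z: "(z has_vector_derivative z') (at t)"
  shows "((\<lambda>t. taylor (Suc N) F (z t)) has_vector_derivative
    taylor N (deriv_z F) (z t) * z' + taylor N (deriv_w F) (z t) * cnj z') (at t)"
proof -
  have w: "((\<lambda>t. cnj (z t)) has_vector_derivative cnj z') (at t)"
    using z by (rule has_vector_derivative_cnj)
  have pow: "((\<lambda>t. f t ^ n) has_vector_derivative of_nat n * f t ^ (n - 1) * f') (at t)"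
    if "(f has_vector_derivative f') (at t)" for f :: "real \<Rightarrow> complex" and f' n
  proof -
    have "((\<lambda>x. x ^ n) has_field_derivative of_nat n * f t ^ (n - 1)) (at (f t))"
      by (auto intro!: derivative_eq_intros)
    from field_vector_diff_chain_at[OF that this] show ?thesis by (simp add: o_def mult.commute)
  qed
  define A where "A = (\<Sum>(k, l)\<in>tri (Suc N). F $ k $ l * (of_nat k * z t ^ (k - 1)) * cnj (z t) ^ l)"
  define B where "B = (\<Sum>(k, l)\<in>tri (Suc N). F $ k $ l * z t ^ k * (of_nat l * cnj (z t) ^ (l - 1)))"
  have "((\<lambda>t. \<Sum>x\<in>tri (Suc N). case x of (k, l) \<Rightarrow> F $ k $ l * z t ^ k * cnj (z t) ^ l) has_vector_derivative
    (\<Sum>x\<in>tri (Suc N). case x of (k, l) \<Rightarrow> F $ k $ l * (of_nat k * z t ^ (k - 1) * z') * cnj (z t) ^ l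
      + F $ k $ l * z t ^ k * (of_nat l * cnj (z t) ^ (l - 1) * cnj z'))) (at t)"
  proof (rule has_vector_derivative_sum)
    fix x :: "nat \<times> nat"
    obtain k l where x: "x = (k, l)" by (cases x)
    have "((\<lambda>t. F $ k $ l * z t ^ k) has_vector_derivative F $ k $ l * (of_nat k * z t ^ (k - 1) * z')) (at t)"
      by (rule has_vector_derivative_mult_right[OF pow[OF z]])
    from has_vector_derivative_mult[OF this pow[OF w, of l]]
    show "((\<lambda>t. case x of (k, l) \<Rightarrow> F $ k $ l * z t ^ k * cnj (z t) ^ l) has_vector_derivative
      (case x of (k, l) \<Rightarrow> F $ k $ l * (of_nat k * z t ^ (k - 1) * z') * cnj (z t) ^ l
      + F $ k $ l * z t ^ k * (of_nat l * cnj (z t) ^ (l - 1) * cnj z'))) (at t)"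
      by (simp add: x add.commute)
  qed
  also have "(\<Sum>x\<in>tri (Suc N). case x of (k, l) \<Rightarrow> F $ k $ l * (of_nat k * z t ^ (k - 1) * z') * cnj (z t) ^ l
      + F $ k $ l * z t ^ k * (of_nat l * cnj (z t) ^ (l - 1) * cnj z')) = A * z' + B * cnj z'"
    unfolding A_def B_def sum_distrib_right sum.distrib[symmetric]
    by (intro sum.cong) (auto simp: mult_ac)
  also have "A = taylor N (deriv_z F) (z t)"
    unfolding A_def taylor_def
    by (rule trans[OF sum.mono_neutral_right[where S = "tri (Suc N) - {0} \<times> UNIV"]
          sum.reindex_bij_witness[where i = "\<lambda>(k, l). (Suc k, l)" and j = "\<lambda>(k, l). (k - 1, l)"]])
       (auto simp: tri_def deriv_z_nth mult_ac finite_tri[unfolded tri_def], (case_tac a; simp)+)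
  also have "B = taylor N (deriv_w F) (z t)"
    unfolding B_def taylor_def
    by (rule trans[OF sum.mono_neutral_right[where S = "tri (Suc N) - UNIV \<times> {0}"]
          sum.reindex_bij_witness[where i = "\<lambda>(k, l). (k, Suc l)" and j = "\<lambda>(k, l). (k, l - 1)"]])
       (auto simp: tri_def deriv_w_nth mult_ac finite_tri[unfolded tri_def], (case_tac b; simp)+)
  finally show ?thesis by (simp add: taylor_def[abs_def])
qed

subsection \<open>Orbits and periods\<close>

lemma is_center_uminus:
  assumes odd: "\<And>z. V (- z) = - V z" and c: "is_center V p"
  shows "is_center V (- p)"
proof -
  from c obtain U where U: "V p = 0" "open U" "p \<in> U"
    "\<And>q. q \<in> U - {p} \<Longrightarrow> \<exists>g T. is_solution V g \<and> g 0 = q \<and> minimal_period g T \<and> range g \<subseteq> U - {p}"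
    unfolding is_center_def by blast
  have "\<exists>g T. is_solution V g \<and> g 0 = q \<and> minimal_period g T \<and> range g \<subseteq> uminus ` U - {- p}"
    if "q \<in> uminus ` U - {- p}" for q
  proof -
    have "- q \<in> U - {p}" using that by auto
    then obtain g T where g: "is_solution V g" "g 0 = - q" "minimal_period g T" "range g \<subseteq> U - {p}"
      using U(4) by blast
    have "is_solution V (\<lambda>t. - g t)"
      using g(1) unfolding is_solution_def odd by (auto intro: has_vector_derivative_minus)
    moreover have "minimal_period (\<lambda>t. - g t) T" using g(3) by (simp add: minimal_period_def)
    moreover have "range (\<lambda>t. - g t) \<subseteq> uminus ` U - {- p}" using g(4) by auto
    ultimately show ?thesis using g(2) by (intro exI[of _ "\<lambda>t. - g t"] exI[of _ T]) auto
  qed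
  moreover have "open (uminus ` U)" using U(2) by (rule open_negations)
  ultimately show ?thesis
    unfolding is_center_def using U(1,3) odd[of p] by (auto intro!: exI[of _ "uminus ` U"])
qed

lemma system_S_uminus: "system_S lam (- z) = - system_S lam z"
proof -
  obtain a2 a3 a4 a6 a7 a8 a9 a10 where "lam = (a2, a3, a4, a6, a7, a8, a9, a10)" by (cases lam) auto
  then show ?thesis by (cases z) (simp add: system_S_def)
qed

lemma is_solution_translated:
  "is_solution (translated_S lam) g \<longleftrightarrow> is_solution (system_S lam) (\<lambda>t. g t + (1, 0))"
proof -
  have "translated_S lam z = system_S lam (z + (1, 0))" for z
    by (cases z) (simp add: translated_S_def)
  moreover have "((\<lambda>t. g t + (1, 0)) has_vector_derivative d) (at t) \<longleftrightarrow> (g has_vector_derivative d) (at t)" for d t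
  proof
    assume "((\<lambda>t. g t + (1, 0)) has_vector_derivative d) (at t)"
    from has_vector_derivative_diff[OF this has_vector_derivative_const[of "(1, 0)"]]
    show "(g has_vector_derivative d) (at t)" by simp
  next
    assume "(g has_vector_derivative d) (at t)"
    from has_vector_derivative_add[OF this has_vector_derivative_const[of "(1, 0)"]]
    show "((\<lambda>t. g t + (1, 0)) has_vector_derivative d) (at t)" by simp
  qed
  ultimately show ?thesis by (simp add: is_solution_def)
qed

lemma minimal_period_unique: "minimal_period g S \<Longrightarrow> minimal_period g T \<Longrightarrow> S = T"
  unfolding minimal_period_def by (metis linorder_less_linear)

lemma minimal_period_translate: "minimal_period (\<lambda>t. g t + c) T \<longleftrightarrow> minimal_period g T"
  for c :: "'a :: group_add"
  by (simp add: minimal_period_def)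

text \<open>Uniqueness of solutions identifies every candidate orbit with \<open>g\<close>, and a
  function has at most one minimal period. This gives the description operator in
  \<open>period\<close> its value.\<close>

lemma period_eqI:
  assumes "is_solution (system_S lam) g" "g 0 = (1 + h, 0)" "minimal_period g T"
  shows "period h lam = T"
  unfolding period_def
proof (rule the_equality)
  have eq: "g t = (g t - (1, 0)) + (1, 0)" for t by simp
  have "is_solution (translated_S lam) (\<lambda>t. g t - (1, 0))"
    using assms(1) by (simp add: is_solution_translated)
  moreover have "minimal_period (\<lambda>t. g t - (1, 0)) T"
    using assms(3) minimal_period_translate[of "\<lambda>t. g t - (1, 0)" "(1, 0)"] by simp
  ultimately show "\<exists>g. is_solution (translated_S lam) g \<and> g 0 = (h, 0) \<and> minimal_period g T"
    using assms(2) by (intro exI[of _ "\<lambda>t. g t - (1, 0)"]) simp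
next
  fix S assume "\<exists>f. is_solution (translated_S lam) f \<and> f 0 = (h, 0) \<and> minimal_period f S"
  then obtain f where f: "is_solution (system_S lam) (\<lambda>t. f t + (1, 0))" "f 0 = (h, 0)" "minimal_period f S"
    by (auto simp: is_solution_translated)
  have "(\<lambda>t. f t + (1, 0)) = g"
    using f(1) assms(1) by (rule solution_unique[OF locally_lipschitz_system_S]) (simp add: f assms)
  moreover have "minimal_period (\<lambda>t. f t + (1, 0)) S" using f(3) by (simp add: minimal_period_translate)
  ultimately show "S = T" using minimal_period_unique assms(3) by blast
qed

text \<open>On \<open>Lambda4\<close>, the variables \<open>4 * ln x\<close> and \<open>4 * y / x\<close> separate the system. Here they
  are given as functions \<open>l\<close> and \<open>v\<close> of coordinates \<open>(p, q)\<close> in which the first integral is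
  \<open>p^2 + q^2\<close>, and the angular velocity at \<open>(p, q)\<close> is \<open>1 / (al p * be q)\<close>.\<close>

locale morse_chart =
  fixes a b c d r :: real and l v al be :: "real \<Rightarrow> real"
  assumes r: "r > 0"
    and dl: "\<And>p. \<bar>p\<bar> < r \<Longrightarrow> (l has_real_derivative al p * exp (l p)) (at p)"
    and al_eq: "\<And>p. \<bar>p\<bar> < r \<Longrightarrow> al p * (exp (l p) - 1) = p"
    and al_pos: "\<And>p. \<bar>p\<bar> < r \<Longrightarrow> al p > 0"
    and al_cont: "\<And>p. \<bar>p\<bar> < r \<Longrightarrow> isCont al p"
    and dv: "\<And>q. \<bar>q\<bar> < r \<Longrightarrow> (v has_real_derivative be q * (1 + a * v q)) (at q)"
    and be_eq: "\<And>q. \<bar>q\<bar> < r \<Longrightarrow> be q * (v q - b * v q ^ 2 - c * v q ^ 3 - d * v q ^ 4) = q"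
    and be_pos: "\<And>q. \<bar>q\<bar> < r \<Longrightarrow> be q > 0"
    and be_cont: "\<And>q. \<bar>q\<bar> < r \<Longrightarrow> isCont be q"
    and av_pos: "\<And>q. \<bar>q\<bar> < r \<Longrightarrow> 1 + a * v q > 0"
    and zero: "l 0 = 0" "v 0 = 0" "al 0 = 1" "be 0 = 1"
begin

text \<open>The powers of 4 come from \<open>v = 4 * y / x\<close>: each factor \<open>y\<close>
  contributes \<open>x * v / 4\<close>.\<close>

definition lam :: params where
  "lam = (4 * b, 16 * c, 64 * d, a, -1, 4 * b, 16 * c, 64 * d)"

text \<open>On \<open>Lambda4\<close> the terms of the second component of degree at least 2 in
  \<open>y\<close> are \<open>y / x\<close> times the first component, and the rest factors as
  \<open>(x / 4 + a * y) * (x^4 - 1)\<close>. Hence \<open>w = 4 * y / x\<close> satisfies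
  \<open>w' = (1 + a * w) * (x^4 - 1)\<close>, which is the separation of variables.\<close>

lemma system_S_polar:
  "system_S lam (x, x * w / 4) = (- (x ^ 5 * (w - b * w ^ 2 - c * w ^ 3 - d * w ^ 4)) / 4,
     (- (x ^ 5 * (w - b * w ^ 2 - c * w ^ 3 - d * w ^ 4)) / 4 * w + (1 + a * w) * (x ^ 4 - 1) * x) / 4)"
proof -
  define u where "u = w / 4"
  have w: "w = 4 * u" by (simp add: u_def)
  show ?thesis
    unfolding w system_S_def lam_def prod.case rhs_x.simps rhs_y.simps prod.inject
    by (simp add: field_simps power_numeral_reduce)
qed

definition chart :: "real \<Rightarrow> real \<Rightarrow> real \<times> real" where
  "chart p q = (exp (l p / 4), exp (l p / 4) * v q / 4)"

abbreviation polar :: "real \<Rightarrow> real \<Rightarrow> real \<times> real" where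
  "polar R \<theta> \<equiv> chart (R * cos \<theta>) (R * sin \<theta>)"

text \<open>This is the derivative of time with respect to the angle, the reciprocal of the angular
  velocity.\<close>

definition omega :: "real \<Rightarrow> real \<Rightarrow> real" where
  "omega R \<theta> = al (R * cos \<theta>) * be (R * sin \<theta>)"

definition period_integral :: "real \<Rightarrow> real" where
  "period_integral R = integral {0..2*pi} (omega R)"

lemma small: "\<bar>R * cos \<theta>\<bar> < r" "\<bar>R * sin \<theta>\<bar> < r" if "0 < R" "R < r"
proof -
  have "\<bar>R * cos \<theta>\<bar> \<le> R" "\<bar>R * sin \<theta>\<bar> \<le> R"
    using that by (simp_all add: abs_mult mult_left_le)
  then show "\<bar>R * cos \<theta>\<bar> < r" "\<bar>R * sin \<theta>\<bar> < r" using that by linarith+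
qed

lemma l_less: "\<bar>p\<bar> < r \<Longrightarrow> \<bar>p'\<bar> < r \<Longrightarrow> p < p' \<Longrightarrow> l p < l p'"
  by (rule DERIV_pos_imp_increasing[of p p' l]) (auto intro!: exI dl mult_pos_pos al_pos)

lemma v_less: "\<bar>p\<bar> < r \<Longrightarrow> \<bar>p'\<bar> < r \<Longrightarrow> p < p' \<Longrightarrow> v p < v p'"
  by (rule DERIV_pos_imp_increasing[of p p' v]) (auto intro!: exI dv mult_pos_pos be_pos av_pos)

lemma chart_inj:
  assumes "\<bar>p\<bar> < r" "\<bar>q\<bar> < r" "\<bar>p'\<bar> < r" "\<bar>q'\<bar> < r" "chart p q = chart p' q'"
  shows "p = p'" "q = q'"
proof -
  have "l p = l p'" "v q = v q'" using assms(5) by (auto simp: chart_def)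
  then show "p = p'" "q = q'"
    using l_less[of p p'] l_less[of p' p] v_less[of q q'] v_less[of q' q] assms by force+
qed

text \<open>In the derivatives of \<open>l\<close> and \<open>v\<close> along the circle the factors
  \<open>al\<close> and \<open>be\<close> cancel: \<open>be * f = q\<close> turns the first into
  \<open>- exp l * f\<close>, and \<open>al * (exp l - 1) = p\<close> turns the second into
  \<open>(1 + a * v) * (exp l - 1)\<close>.\<close>

lemma chart_solution:
  assumes R: "0 < R" "R < r" and \<theta>: "\<And>t. (\<theta> has_real_derivative 1 / omega R (\<theta> t)) (at t)"
  shows "is_solution (system_S lam) (\<lambda>t. polar R (\<theta> t))"
  unfolding is_solution_def
proof
  fix t
  define p q where "p = R * cos (\<theta> t)" and "q = R * sin (\<theta> t)"
  define x where "x = exp (l p / 4)"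
  define f where "f = v q - b * v q ^ 2 - c * v q ^ 3 - d * v q ^ 4"
  have pq: "\<bar>p\<bar> < r" "\<bar>q\<bar> < r" using small[OF R] by (auto simp: p_def q_def)
  have \<omega>: "omega R (\<theta> t) = al p * be q" by (simp add: omega_def p_def q_def)
  have pos: "al p > 0" "be q > 0" using pq al_pos be_pos by auto
  have x4: "exp (l p) = x ^ 4" by (simp add: x_def exp_of_nat_mult[symmetric])
  have "((\<lambda>t. R * cos (\<theta> t)) has_real_derivative R * (- sin (\<theta> t) * (1 / omega R (\<theta> t)))) (at t)"
    by (intro DERIV_cmult DERIV_chain2[OF DERIV_cos] \<theta>)
  moreover have "R * (- sin (\<theta> t) * (1 / omega R (\<theta> t))) = - q / (al p * be q)"
    unfolding \<omega> by (simp add: q_def)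
  ultimately have dp: "((\<lambda>t. R * cos (\<theta> t)) has_real_derivative - q / (al p * be q)) (at t)" by simp
  have "((\<lambda>t. R * sin (\<theta> t)) has_real_derivative R * (cos (\<theta> t) * (1 / omega R (\<theta> t)))) (at t)"
    by (intro DERIV_cmult DERIV_chain2[OF DERIV_sin] \<theta>)
  moreover have "R * (cos (\<theta> t) * (1 / omega R (\<theta> t))) = p / (al p * be q)"
    unfolding \<omega> by (simp add: p_def)
  ultimately have dq: "((\<lambda>t. R * sin (\<theta> t)) has_real_derivative p / (al p * be q)) (at t)" by simp
  have "((\<lambda>t. l (R * cos (\<theta> t))) has_real_derivative al p * exp (l p) * (- q / (al p * be q))) (at t)"
    by (rule DERIV_chain2[OF _ dp]) (use dl[OF pq(1)] in \<open>simp add: p_def\<close>)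
  moreover have "al p * exp (l p) * (- q / (al p * be q)) = - (x ^ 4 * f)"
  proof -
    have "q = be q * f" using be_eq[OF pq(2)] by (simp add: f_def)
    then have "al p * exp (l p) * (- q / (al p * be q)) = al p * exp (l p) * (- (be q * f) / (al p * be q))" by simp
    then show ?thesis using pos by (simp add: x4 field_simps)
  qed
  ultimately have dl': "((\<lambda>t. l (R * cos (\<theta> t))) has_real_derivative - (x ^ 4 * f)) (at t)" by simp
  have "((\<lambda>t. v (R * sin (\<theta> t))) has_real_derivative be q * (1 + a * v q) * (p / (al p * be q))) (at t)"
    by (rule DERIV_chain2[OF _ dq]) (use dv[OF pq(2)] in \<open>simp add: q_def\<close>)
  moreover have "be q * (1 + a * v q) * (p / (al p * be q)) = (1 + a * v q) * (x ^ 4 - 1)"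
  proof -
    have "p = al p * (x ^ 4 - 1)" using al_eq[OF pq(1)] by (simp add: x4)
    then have "be q * (1 + a * v q) * (p / (al p * be q)) =
        be q * (1 + a * v q) * ((al p * (x ^ 4 - 1)) / (al p * be q))" by simp
    then show ?thesis using pos by (simp add: field_simps)
  qed
  ultimately have dv': "((\<lambda>t. v (R * sin (\<theta> t))) has_real_derivative (1 + a * v q) * (x ^ 4 - 1)) (at t)" by simp
  have "((\<lambda>t. exp (l (R * cos (\<theta> t)) / 4)) has_real_derivative exp (l (R * cos (\<theta> t)) / 4) * (- (x ^ 4 * f) / 4)) (at t)"
    by (intro DERIV_chain2[OF DERIV_exp] DERIV_cdivide dl')
  moreover have "exp (l (R * cos (\<theta> t)) / 4) * (- (x ^ 4 * f) / 4) = - (x ^ 5 * f) / 4"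
    by (simp add: x_def p_def power_numeral_reduce)
  ultimately have dx: "((\<lambda>t. exp (l (R * cos (\<theta> t)) / 4)) has_real_derivative - (x ^ 5 * f) / 4) (at t)"
    by (simp only:)
  have dy: "((\<lambda>t. exp (l (R * cos (\<theta> t)) / 4) * v (R * sin (\<theta> t)) / 4) has_real_derivative
      (- (x ^ 5 * f) / 4 * v q + (1 + a * v q) * (x ^ 4 - 1) * x) / 4) (at t)"
    using DERIV_cdivide[OF DERIV_mult[OF dx dv'], of 4]
    by (simp add: x_def p_def q_def)
  have eq: "system_S lam (chart p q) = (- (x ^ 5 * f) / 4, (- (x ^ 5 * f) / 4 * v q + (1 + a * v q) * (x ^ 4 - 1) * x) / 4)"
    unfolding chart_def x_def[symmetric] f_def by (rule system_S_polar)
  show "((\<lambda>t. polar R (\<theta> t)) has_vector_derivative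
      system_S lam (polar R (\<theta> t))) (at t)"
    using has_vector_derivative_Pair[OF dx[unfolded has_real_derivative_iff_has_vector_derivative]
        dy[unfolded has_real_derivative_iff_has_vector_derivative]]
    unfolding p_def[symmetric] q_def[symmetric] eq unfolding chart_def .
qed

lemma orbit:
  assumes R: "0 < R" "R < r"
  obtains \<theta> where "\<And>t. (\<theta> has_real_derivative 1 / omega R (\<theta> t)) (at t)" "\<theta> 0 = x0"
    "\<And>t. \<theta> (t + period_integral R) = \<theta> t + 2 * pi" "period_integral R > 0"
    "is_solution (system_S lam) (\<lambda>t. polar R (\<theta> t))"
    "minimal_period (\<lambda>t. polar R (\<theta> t)) (period_integral R)"
proof -
  have "isCont (omega R) x" for x
  proof -
    have "isCont (\<lambda>x. al (R * cos x)) x" "isCont (\<lambda>x. be (R * sin x)) x"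
      by (rule isCont_o2[where g = al] isCont_o2[where g = be], intro continuous_intros,
          use small[OF R] al_cont be_cont in blast)+
    then show ?thesis unfolding omega_def by (intro continuous_intros)
  qed
  moreover have "omega R x > 0" for x
    using small[OF R] al_pos be_pos by (simp add: omega_def)
  moreover have "omega R (x + 2 * pi) = omega R x" for x by (simp add: omega_def)
  ultimately obtain \<theta> where \<theta>: "\<And>t. (\<theta> has_real_derivative 1 / omega R (\<theta> t)) (at t)"
    "strict_mono \<theta>" "\<And>t. \<theta> (t + period_integral R) = \<theta> t + 2 * pi" "\<theta> 0 = x0" "period_integral R > 0"
    using periodic_reparametrisation[of "omega R"] unfolding period_integral_def by metis
  \<comment> \<open>By injectivity of the chart an earlier return would move the angle by a multiple
    of \<open>2 * pi\<close>, but the increase lies strictly between 0 and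
    \<open>2 * pi\<close>.\<close>
  have "\<not> (\<forall>t. polar R (\<theta> (t + s)) = polar R (\<theta> t))"
    if s: "0 < s" "s < period_integral R" for s
  proof
    assume "\<forall>t. polar R (\<theta> (t + s)) = polar R (\<theta> t)"
    then have "polar R (\<theta> (0 + s)) = polar R (\<theta> 0)" by blast
    from chart_inj[OF small[OF R] small[OF R] this] have "sin (\<theta> s) = sin (\<theta> 0) \<and> cos (\<theta> s) = cos (\<theta> 0)"
      using R by simp
    then obtain n :: int where n: "\<theta> s = \<theta> 0 + 2 * pi * n" unfolding sin_cos_eq_iff by blast
    have "\<theta> 0 < \<theta> s" using \<theta>(2) s(1) by (simp add: strict_mono_less)
    moreover have "\<theta> s < \<theta> (0 + period_integral R)" using \<theta>(2) s(2) by (simp add: strict_mono_less)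
    ultimately have "0 < 2 * pi * n" "2 * pi * n < 2 * pi * 1" using n \<theta>(3)[of 0] by auto
    then have "0 < n" "n < 1" by (simp_all add: zero_less_mult_iff mult_less_cancel_left)
    then show False by linarith
  qed
  then have "minimal_period (\<lambda>t. polar R (\<theta> t)) (period_integral R)"
    using \<theta>(3,5) by (simp add: minimal_period_def)
  with \<theta> chart_solution[OF R \<theta>(1)] show ?thesis using that by blast
qed

lemma chart_0: "chart 0 0 = (1, 0)"
  by (simp add: chart_def zero)

text \<open>The neighbourhood is the image of a disc under the chart. It is open by invariance of
  domain, and the images of the concentric circles are the periodic orbits that fill it.\<close>

lemma is_center: "is_center (system_S lam) (1, 0)"
proof -
  define U where "U = (\<lambda>z. chart (fst z) (snd z)) ` ball 0 r"
  have ball: "\<bar>fst z\<bar> < r" "\<bar>snd z\<bar> < r" if "z \<in> ball 0 r" for z :: "real \<times> real"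
  proof -
    have "norm z < r" using that by simp
    then show "\<bar>fst z\<bar> < r" "\<bar>snd z\<bar> < r"
      using norm_fst_le[of "fst z" "snd z"] norm_snd_le[of "snd z" "fst z"] by simp_all
  qed
  have cont: "continuous_on (ball 0 r) (\<lambda>z. chart (fst z) (snd z))"
  proof -
    have cont: "continuous_on {-r<..<r} l" "continuous_on {-r<..<r} v"
      by (auto intro!: continuous_at_imp_continuous_on DERIV_isCont[OF dl] DERIV_isCont[OF dv])
    have sub1: "fst ` ball (0 :: real \<times> real) r \<subseteq> {-r<..<r}"
      by (rule image_subsetI, drule ball(1)) (simp add: abs_less_iff)
    have sub2: "snd ` ball (0 :: real \<times> real) r \<subseteq> {-r<..<r}"
      by (rule image_subsetI, drule ball(2)) (simp add: abs_less_iff)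
    have "continuous_on (ball 0 r) (\<lambda>z :: real \<times> real. l (fst z))"
      by (rule continuous_on_compose2[OF cont(1) _ sub1]) (intro continuous_on_fst continuous_on_id)
    moreover have "continuous_on (ball 0 r) (\<lambda>z :: real \<times> real. v (snd z))"
      by (rule continuous_on_compose2[OF cont(2) _ sub2]) (intro continuous_on_snd continuous_on_id)
    ultimately show ?thesis
      unfolding chart_def
      by (intro continuous_on_Pair continuous_on_mult continuous_on_divide continuous_on_exp continuous_on_const)
         simp_all
  qed
  have inj: "inj_on (\<lambda>z. chart (fst z) (snd z)) (ball 0 r)"
  proof (rule inj_onI)
    fix z z' assume z: "z \<in> ball 0 r" "z' \<in> ball 0 r" "chart (fst z) (snd z) = chart (fst z') (snd z')"
    show "z = z'"
      using chart_inj[OF ball[OF z(1)] ball[OF z(2)] z(3)] by (rule prod_eqI)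
  qed
  have U: "open U"
    unfolding U_def by (rule invariance_of_domain[OF cont open_ball inj])
  have memU: "chart p q \<in> U" if "norm (p, q) < r" for p q
    unfolding U_def by (rule image_eqI[of _ _ "(p, q)"]) (use that in simp_all)
  have "(1, 0) \<in> U" using memU[of 0 0] r by (simp add: chart_0 norm_Pair)
  moreover have "\<exists>g T. is_solution (system_S lam) g \<and> g 0 = z \<and> minimal_period g T \<and> range g \<subseteq> U - {(1, 0)}"
    if z: "z \<in> U - {(1, 0)}" for z
  proof -
    obtain x where x: "x \<in> ball 0 r" "z = chart (fst x) (snd x)" using z unfolding U_def by blast
    define p q where "p = fst x" and "q = snd x"
    define R where "R = norm x"
    have pq: "z = chart p q" using x by (simp add: p_def q_def)
    have "x \<noteq> 0"
    proof
      assume "x = 0"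
      then have "z = (1, 0)" using x(2) chart_0 by simp
      with z show False by blast
    qed
    then have R: "0 < R" "R < r" using x(1) by (simp_all add: R_def)
    have "p\<^sup>2 + q\<^sup>2 = R\<^sup>2" by (simp add: R_def p_def q_def norm_prod_def)
    then have "(p / R)\<^sup>2 + (q / R)\<^sup>2 = 1" using R by (simp add: power_divide add_divide_distrib[symmetric])
    then obtain x0 where x0: "p / R = cos x0" "q / R = sin x0" by (rule sincos_total_2pi) auto
    obtain \<theta> where \<theta>: "\<theta> 0 = x0" "is_solution (system_S lam) (\<lambda>t. polar R (\<theta> t))"
      "minimal_period (\<lambda>t. polar R (\<theta> t)) (period_integral R)"
      using orbit[OF R, of x0] by blast
    have mem: "polar R (\<theta> t) \<in> U - {(1, 0)}" for t
    proof -
      have "norm (R * cos (\<theta> t), R * sin (\<theta> t)) = R"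
        using R by (simp add: norm_Pair power_mult_distrib distrib_left[symmetric])
      then have "polar R (\<theta> t) \<in> U" using R memU by simp
      moreover have "polar R (\<theta> t) \<noteq> chart 0 0"
      proof
        assume "polar R (\<theta> t) = chart 0 0"
        from chart_inj[OF small[OF R] _ _ this] r R have "cos (\<theta> t) = 0" "sin (\<theta> t) = 0" by auto
        then show False using sin_cos_squared_add[of "\<theta> t"] by simp
      qed
      ultimately show ?thesis by (simp add: chart_0)
    qed
    have init: "polar R (\<theta> 0) = z"
      unfolding pq \<theta>(1) x0[symmetric] using R by simp
    have rng: "range (\<lambda>t. polar R (\<theta> t)) \<subseteq> U - {(1, 0)}"
      by (rule image_subsetI) (rule mem)
    show ?thesis
      by (rule exI[of _ "\<lambda>t. polar R (\<theta> t)"], rule exI[of _ "period_integral R"])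
         (rule conjI[OF \<theta>(2) conjI[OF init conjI[OF \<theta>(3) rng]]])
  qed
  moreover have "system_S lam (1, 0) = 0" using system_S_polar[of 1 0] by (simp add: prod_eq_iff)
  ultimately show ?thesis unfolding is_center_def using U by blast
qed

lemma is_bicenter: "is_bicenter lam"
proof -
  have "is_center (system_S lam) (- (1, 0))"
    by (rule is_center_uminus[where V = "system_S lam", OF system_S_uminus is_center])
  then show ?thesis unfolding is_bicenter_def using is_center by simp
qed

text \<open>At angle 0 the orbit of radius \<open>R\<close> crosses the horizontal axis at abscissa
  \<open>exp (l R / 4)\<close>. This links the radius to the parameter \<open>h\<close>.\<close>

lemma period_eq:
  assumes "0 < R" "R < r" "exp (l R / 4) = 1 + h"
  shows "period h lam = period_integral R"
proof -
  obtain \<theta> where \<theta>: "\<theta> 0 = 0" "is_solution (system_S lam) (\<lambda>t. polar R (\<theta> t))"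
      "minimal_period (\<lambda>t. polar R (\<theta> t)) (period_integral R)"
    by (rule orbit[OF assms(1,2), of 0]) blast
  have "polar R (\<theta> 0) = (1 + h, 0)"
    unfolding \<theta>(1) by (simp add: chart_def zero assms(3))
  from period_eqI[OF \<theta>(2) this \<theta>(3)] show ?thesis .
qed

end

subsection \<open>The truncated normal form\<close>

definition field_complex :: "params \<Rightarrow> complex \<Rightarrow> complex" where
  "field_complex lam z = (case translated_S lam (Re z, Im z) of (x, y) \<Rightarrow> Complex x y)"

text \<open>The real field and its formal version evaluate the same polynomial, once in functions
  and once in series, so \<open>approx\<close> carries over operation by operation.\<close>

lemma approx_rhs:
  assumes N: "N \<ge> 1"
  shows "approx N (\<lambda>z. of_real (fst (translated_S lam (Re z, Im z)))) (cplx_x lam)"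
    and "approx N (\<lambda>z. of_real (snd (translated_S lam (Re z, Im z)))) (cplx_y lam)"
proof -
  obtain a2 a3 a4 a6 a7 a8 a9 a10 where lam: "lam = (a2, a3, a4, a6, a7, a8, a9, a10)"
    by (cases lam) auto
  have re: "1/2 * (z + cnj z) + 1 = of_real (Re z + 1)" for z
    by (simp add: complex_eq_iff)
  have im: "1 / (2 * \<i>) * (z - cnj z) = of_real (Im z)" for z
    by (simp add: complex_eq_iff)
  note intros = approx_add approx_diff approx_uminus approx_mult approx_power approx_cst
    approx_var_z[OF N] approx_var_w[OF N] approx_one
  have "approx N (\<lambda>z. rhs_x of_real lam (1/2 * (z + cnj z) + 1) (1 / (2 * \<i>) * (z - cnj z))) (cplx_x lam)"
    unfolding cplx_x_def lam rhs_x.simps by (intro intros)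
  then show "approx N (\<lambda>z. of_real (fst (translated_S lam (Re z, Im z)))) (cplx_x lam)"
    unfolding re im by (simp add: translated_S_def system_S_def lam)
  have "approx N (\<lambda>z. rhs_y of_real lam (1/2 * (z + cnj z) + 1) (1 / (2 * \<i>) * (z - cnj z))) (cplx_y lam)"
    unfolding cplx_y_def lam rhs_y.simps by (intro intros)
  then show "approx N (\<lambda>z. of_real (snd (translated_S lam (Re z, Im z)))) (cplx_y lam)"
    unfolding re im by (simp add: translated_S_def system_S_def lam)
qed

lemma approx_field:
  assumes N: "N \<ge> 1"
  shows "approx N (\<lambda>z. - \<i> * field_complex lam z) (field_z lam)"
    and "approx N (\<lambda>z. - \<i> * cnj (field_complex lam z)) (field_w lam)"
proof -
  have "approx N (\<lambda>z. - \<i> * (of_real (fst (translated_S lam (Re z, Im z))) + \<i> * of_real (snd (translated_S lam (Re z, Im z)))))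
      (field_z lam)"
    unfolding field_z_def by (intro approx_mult approx_cst approx_add approx_rhs N)
  moreover have "of_real x + \<i> * of_real y = Complex x y" for x y
    by (simp add: complex_eq_iff)
  ultimately show "approx N (\<lambda>z. - \<i> * field_complex lam z) (field_z lam)"
    by (simp add: field_complex_def case_prod_unfold)
  have "approx N (\<lambda>z. - \<i> * (of_real (fst (translated_S lam (Re z, Im z))) - \<i> * of_real (snd (translated_S lam (Re z, Im z)))))
      (field_w lam)"
    unfolding field_w_def by (intro approx_mult approx_cst approx_diff approx_rhs N)
  moreover have "of_real x - \<i> * of_real y = cnj (Complex x y)" for x y
    by (simp add: complex_eq_iff)
  ultimately show "approx N (\<lambda>z. - \<i> * cnj (field_complex lam z)) (field_w lam)"
    by (simp add: field_complex_def case_prod_unfold)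
qed

text \<open>\<open>taylor_T N lam F\<close> is \<open>-\<i>\<close> times the time derivative of the Taylor polynomial of degree
  \<open>N + 1\<close> of \<open>F\<close> along the solutions.\<close>

definition taylor_T :: "nat \<Rightarrow> params \<Rightarrow> series2 \<Rightarrow> complex \<Rightarrow> complex" where
  "taylor_T N lam F z = taylor N (deriv_z F) z * (- \<i> * field_complex lam z)
    + taylor N (deriv_w F) z * (- \<i> * cnj (field_complex lam z))"

lemma approx_taylor_T: "N \<ge> 1 \<Longrightarrow> approx N (taylor_T N lam F) (deriv_T lam F)"
  unfolding taylor_T_def[abs_def] deriv_T_def
  by (intro approx_add approx_mult approx_taylor approx_field)

lemma taylor_T_derivative:
  assumes "(z has_vector_derivative field_complex lam (z t)) (at t)"
  shows "((\<lambda>t. taylor (Suc N) F (z t)) has_vector_derivative \<i> * taylor_T N lam F (z t)) (at t)"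
proof -
  have "\<i> * taylor_T N lam F (z t) = taylor N (deriv_z F) (z t) * field_complex lam (z t)
      + taylor N (deriv_w F) (z t) * cnj (field_complex lam (z t))"
    by (simp add: taylor_T_def algebra_simps)
  then show ?thesis using taylor_has_vector_derivative[OF assms] by simp
qed

text \<open>The summands with \<open>i > m\<close> start in degree \<open>2 * m + 3\<close> or
  later.\<close>

lemma resonant_sum_truncate:
  assumes "ord_ge 1 F" "ord_ge 1 G"
  shows "ord_ge (2 * m + 2) (resonant_sum p F G - (\<Sum>i=1..m. cst (p i) * (F ^ (i + 1) * G ^ i)))"
  unfolding ord_ge_def
proof (intro allI impI)
  fix k l assume kl: "k + l < 2 * m + 2"
  have zero: "(F ^ (i + 1) * G ^ i) $ k $ l = 0" if "k + l < 2 * i + 1" for i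
  proof -
    have "ord_ge ((i + 1) * 1 + i * 1) (F ^ (i + 1) * G ^ i)"
      by (intro ord_ge_mult ord_ge_power assms)
    then show ?thesis by (rule ord_geD) (use that in simp)
  qed
  have "resonant_sum p F G $ k $ l = (\<Sum>i=1..m + (k + l). p i * (F ^ (i + 1) * G ^ i) $ k $ l)"
    unfolding resonant_sum_nth
  proof (rule sum.mono_neutral_left)
    show "\<forall>i\<in>{1..m + (k + l)} - {1..k + l}. p i * (F ^ (i + 1) * G ^ i) $ k $ l = 0"
      by (intro ballI, subst zero) auto
  qed auto
  also have "\<dots> = (\<Sum>i=1..m. p i * (F ^ (i + 1) * G ^ i) $ k $ l)"
  proof (rule sum.mono_neutral_right)
    show "\<forall>i\<in>{1..m + (k + l)} - {1..m}. p i * (F ^ (i + 1) * G ^ i) $ k $ l = 0"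
      by (intro ballI, subst zero) (use kl in auto)
  qed auto
  also have "\<dots> = (\<Sum>i=1..m. cst (p i) * (F ^ (i + 1) * G ^ i)) $ k $ l"
    by (simp only: fps_sum_nth cst_mult_nth)
  finally show "(resonant_sum p F G - (\<Sum>i=1..m. cst (p i) * (F ^ (i + 1) * G ^ i))) $ k $ l = 0"
    by simp
qed

text \<open>Since \<open>X\<close> is comparable to \<open>z\<close> from below, a division by it
  costs exactly one order.\<close>

lemma bigo_divide_lead:
  fixes f X :: "complex \<Rightarrow> complex"
  assumes f: "f \<in> O[at 0](\<lambda>z. z ^ Suc N)" and X: "eventually (\<lambda>z. norm z \<le> 2 * norm (X z)) (at 0)"
  shows "(\<lambda>z. f z / X z) \<in> O[at 0](\<lambda>z. z ^ N)"
proof -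
  obtain C where C: "C > 0" "eventually (\<lambda>z. norm (f z) \<le> C * norm (z ^ Suc N)) (at 0)"
    using f by (auto elim: landau_o.bigE)
  have nz: "eventually (\<lambda>z::complex. z \<noteq> 0) (at 0)" by (simp add: eventually_at_filter)
  show ?thesis
  proof (rule bigoI)
    from C(2) X nz show "eventually (\<lambda>z. norm (f z / X z) \<le> (2 * C) * norm (z ^ N)) (at 0)"
    proof eventually_elim
      case (elim z)
      then have "norm (X z) > 0" using zero_less_norm_iff[of z] by linarith
      moreover have "norm (f z) \<le> (2 * C * norm (z ^ N)) * norm (X z)"
      proof -
        have "norm (f z) \<le> (C * norm (z ^ N)) * norm z" using elim(1) by (simp add: norm_mult norm_power mult_ac)
        also have "\<dots> \<le> (C * norm (z ^ N)) * (2 * norm (X z))"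
          using elim(2) C(1) by (intro mult_left_mono) auto
        finally show ?thesis by (simp add: mult_ac)
      qed
      ultimately show ?case by (simp add: norm_divide divide_le_eq)
    qed
  qed
qed

lemma lead_lower_bound:
  assumes "(\<lambda>z. X z - c z) \<in> O[at 0](\<lambda>z :: complex. z ^ 2)" and c: "\<And>z. norm (c z) = norm z"
  shows "eventually (\<lambda>z. norm z \<le> 2 * norm (X z :: complex)) (at 0)"
    and "eventually (\<lambda>z. norm (X z - c z) \<le> norm z / 2) (at 0)"
proof -
  obtain C where C: "C > 0" "eventually (\<lambda>z. norm (X z - c z) \<le> C * norm (z ^ 2)) (at 0)"
    using assms(1) by (auto elim: landau_o.bigE)
  have "eventually (\<lambda>z::complex. z \<in> ball 0 (1 / (2 * C))) (at 0)"
    by (rule eventually_at_in_open') (use C in auto)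
  with C(2) show half: "eventually (\<lambda>z. norm (X z - c z) \<le> norm z / 2) (at 0)"
  proof eventually_elim
    case (elim z)
    have "C * norm z \<le> 1 / 2" using elim(2) C(1) by (simp add: field_simps)
    then have "C * norm z * norm z \<le> 1 / 2 * norm z" by (rule mult_right_mono) simp
    with elim(1) show ?case unfolding power2_eq_square norm_mult by (simp add: mult.assoc)
  qed
  then show "eventually (\<lambda>z. norm z \<le> 2 * norm (X z)) (at 0)"
  proof eventually_elim
    case (elim z)
    have "norm z - norm (X z) \<le> norm (c z - X z)" using norm_triangle_ineq2[of "c z" "X z"] c by simp
    then show ?case using elim by (simp add: norm_minus_commute)
  qed
qed

text \<open>The two quotients are the logarithmic derivatives of \<open>X\<close> and
  \<open>Y\<close> with respect to \<open>T\<close>. By the normal form they are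
  \<open>1 + P\<close> and \<open>- (1 + Q)\<close> with \<open>P\<close> and \<open>Q\<close>
  polynomials in \<open>X * Y\<close>, so in the difference only the sums \<open>p i + q i\<close>
  remain. The choice \<open>N = 2 * j + 1\<close> makes the error smaller than the first surviving
  term.\<close>

lemma normal_form_rate:
  assumes nf: "normal_form lam xi eta p q" and j: "j \<ge> 1"
    and low: "\<And>i. 1 \<le> i \<Longrightarrow> i < j \<Longrightarrow> p i + q i = 0"
  defines "N \<equiv> 2 * j + 1"
  defines "X \<equiv> taylor (Suc N) xi" and "Y \<equiv> taylor (Suc N) eta"
  shows "(\<lambda>z. taylor_T N lam xi z / X z - taylor_T N lam eta z / Y z
      - (2 + (p j + q j) * (z * cnj z) ^ j)) \<in> O[at 0](\<lambda>z. z ^ N)"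
    and "eventually (\<lambda>z. norm (X z - z) \<le> norm z / 2) (at 0)"
    and "eventually (\<lambda>z. norm (Y z - cnj z) \<le> norm z / 2) (at 0)"
proof -
  have N: "N \<ge> 1" by (simp add: N_def)
  have xi: "ord_ge 2 (xi - var_z)"
    unfolding ord_ge_def
  proof (intro allI impI)
    fix k l :: nat assume "k + l < 2"
    then consider "k = 0" "l = 0" | "k = 1" "l = 0" | "k = 0" "l = 1" by fastforce
    then show "(xi - var_z) $ k $ l = 0"
      by cases (use nf in \<open>auto simp: normal_form_def var_z_nth\<close>)
  qed
  have eta: "ord_ge 2 (eta - var_w)"
    unfolding ord_ge_def
  proof (intro allI impI)
    fix k l :: nat assume "k + l < 2"
    then consider "k = 0" "l = 0" | "k = 1" "l = 0" | "k = 0" "l = 1" by fastforce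
    then show "(eta - var_w) $ k $ l = 0"
      by cases (use nf in \<open>auto simp: normal_form_def var_w_nth\<close>)
  qed
  note xi1 = ord_ge_of_lead[OF xi ord_ge_var(1)] and eta1 = ord_ge_of_lead[OF eta ord_ge_var(2)]
  have aX: "approx N X xi" and aY: "approx N Y eta"
    unfolding X_def Y_def by (rule approx_taylor_Suc)+
  have "(\<lambda>z. X z - z) \<in> O[at 0](\<lambda>z. z ^ 2)"
    by (rule approx_diff_bigo[OF aX approx_var_z[OF N] xi]) (use j in \<open>simp add: N_def\<close>)
  note X = lead_lower_bound[OF this refl]
  have "(\<lambda>z. Y z - cnj z) \<in> O[at 0](\<lambda>z. z ^ 2)"
    by (rule approx_diff_bigo[OF aY approx_var_w[OF N] eta]) (use j in \<open>simp add: N_def\<close>)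
  note Y = lead_lower_bound[OF this complex_mod_cnj]
  show "eventually (\<lambda>z. norm (X z - z) \<le> norm z / 2) (at 0)" by (rule X(2))
  show "eventually (\<lambda>z. norm (Y z - cnj z) \<le> norm z / 2) (at 0)" by (rule Y(2))
  define P where "P = (\<lambda>z. \<Sum>i=1..j. p i * (X z * Y z) ^ i)"
  define Q where "Q = (\<lambda>z. \<Sum>i=1..j. q i * (X z * Y z) ^ i)"
  have "(\<lambda>z. taylor_T N lam xi z - (X z + (\<Sum>i=1..j. p i * (X z ^ (i + 1) * Y z ^ i)))) \<in> O[at 0](\<lambda>z. z ^ (N + 1))"
  proof (rule approx_diff_bigo[OF approx_taylor_T[OF N]])
    show "approx N (\<lambda>z. X z + (\<Sum>i=1..j. p i * (X z ^ (i + 1) * Y z ^ i)))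
        (xi + (\<Sum>i=1..j. cst (p i) * (xi ^ (i + 1) * eta ^ i)))"
      by (intro approx_add approx_sum approx_mult approx_cst approx_power aX aY)
    show "ord_ge (N + 1) (deriv_T lam xi - (xi + (\<Sum>i=1..j. cst (p i) * (xi ^ (i + 1) * eta ^ i))))"
      using resonant_sum_truncate[OF xi1 eta1, of j p] nf by (simp add: normal_form_def N_def)
  qed simp
  moreover have "X z + (\<Sum>i=1..j. p i * (X z ^ (i + 1) * Y z ^ i)) = X z * (1 + P z)" for z
    by (simp add: P_def sum_distrib_left distrib_left power_mult_distrib mult_ac)
  ultimately have "(\<lambda>z. taylor_T N lam xi z - X z * (1 + P z)) \<in> O[at 0](\<lambda>z. z ^ Suc N)" by simp
  note A = bigo_divide_lead[OF this X(1)]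
  have "(\<lambda>z. taylor_T N lam eta z - (- Y z - (\<Sum>i=1..j. q i * (Y z ^ (i + 1) * X z ^ i)))) \<in> O[at 0](\<lambda>z. z ^ (N + 1))"
  proof (rule approx_diff_bigo[OF approx_taylor_T[OF N]])
    show "approx N (\<lambda>z. - Y z - (\<Sum>i=1..j. q i * (Y z ^ (i + 1) * X z ^ i)))
        (- eta - (\<Sum>i=1..j. cst (q i) * (eta ^ (i + 1) * xi ^ i)))"
      by (intro approx_diff approx_uminus approx_sum approx_mult approx_cst approx_power aX aY)
    have "ord_ge (N + 1) (- (resonant_sum q eta xi - (\<Sum>i=1..j. cst (q i) * (eta ^ (i + 1) * xi ^ i))))"
      using ord_ge_uminus[OF resonant_sum_truncate[OF eta1 xi1, of j q]] by (simp add: N_def)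
    moreover have "deriv_T lam eta = - eta - resonant_sum q eta xi" using nf by (simp add: normal_form_def)
    ultimately show "ord_ge (N + 1) (deriv_T lam eta - (- eta - (\<Sum>i=1..j. cst (q i) * (eta ^ (i + 1) * xi ^ i))))"
      by simp
  qed simp
  moreover have "- Y z - (\<Sum>i=1..j. q i * (Y z ^ (i + 1) * X z ^ i)) = - (Y z * (1 + Q z))" for z
    by (simp add: Q_def sum_distrib_left distrib_left power_mult_distrib mult_ac)
  ultimately have "(\<lambda>z. taylor_T N lam eta z + Y z * (1 + Q z)) \<in> O[at 0](\<lambda>z. z ^ Suc N)" by simp
  note B = bigo_divide_lead[OF this Y(1)]
  have PQ: "P z + Q z = (p j + q j) * (X z * Y z) ^ j" for z
  proof -
    have "P z + Q z = (\<Sum>i=1..j. (p i + q i) * (X z * Y z) ^ i)"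
      by (simp add: P_def Q_def sum.distrib distrib_right)
    also have "\<dots> = (\<Sum>i\<in>{j}. (p i + q i) * (X z * Y z) ^ i)"
      by (rule sum.mono_neutral_right) (use j low in auto)
    finally show ?thesis by simp
  qed
  have C: "(\<lambda>z. (X z * Y z) ^ j - (z * cnj z) ^ j) \<in> O[at 0](\<lambda>z. z ^ N)"
  proof (rule approx_diff_bigo[where F = "(xi * eta) ^ j" and G = "(var_z * var_w) ^ j"])
    show "approx N (\<lambda>z. (X z * Y z) ^ j) ((xi * eta) ^ j)"
      by (intro approx_power approx_mult aX aY)
    show "approx N (\<lambda>z. (z * cnj z) ^ j) ((var_z * var_w) ^ j)"
      by (intro approx_power approx_mult approx_var_z approx_var_w N)
    have "rel_ord 1 1 xi var_z" "rel_ord 1 1 eta var_w"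
      using xi eta xi1 eta1 ord_ge_var by (simp_all add: rel_ord_def numeral_2_eq_2)
    then have "rel_ord 1 (j * (1 + 1)) ((xi * eta) ^ j) ((var_z * var_w) ^ j)"
      by (intro rel_ord_power rel_ord_mult)
    moreover have "N = 1 + j * (1 + 1)" by (simp add: N_def)
    ultimately show "ord_ge N ((xi * eta) ^ j - (var_z * var_w) ^ j)"
      by (simp only: rel_ord_def)
  qed simp
  have D: "(\<lambda>z. (p j + q j) * ((X z * Y z) ^ j - (z * cnj z) ^ j)) \<in> O[at 0](\<lambda>z. z ^ N)"
    using C by (cases "p j + q j = 0") simp_all
  have "(\<lambda>z. (taylor_T N lam xi z - X z * (1 + P z)) / X z - (taylor_T N lam eta z + Y z * (1 + Q z)) / Y z
      + (p j + q j) * ((X z * Y z) ^ j - (z * cnj z) ^ j)) \<in> O[at 0](\<lambda>z. z ^ N)"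
    by (rule sum_in_bigo(1)[OF sum_in_bigo(2)[OF A B] D])
  moreover have "eventually (\<lambda>z. (taylor_T N lam xi z - X z * (1 + P z)) / X z
      - (taylor_T N lam eta z + Y z * (1 + Q z)) / Y z
      + (p j + q j) * ((X z * Y z) ^ j - (z * cnj z) ^ j) =
      taylor_T N lam xi z / X z - taylor_T N lam eta z / Y z - (2 + (p j + q j) * (z * cnj z) ^ j)) (at 0)"
  proof -
    have "eventually (\<lambda>z::complex. z \<noteq> 0) (at 0)" by (simp add: eventually_at_filter)
    with X(1) Y(1) show ?thesis
    proof eventually_elim
      case (elim z)
      then have nz: "X z \<noteq> 0" "Y z \<noteq> 0" by auto
      have "(taylor_T N lam xi z - X z * (1 + P z)) / X z - (taylor_T N lam eta z + Y z * (1 + Q z)) / Y z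
          = taylor_T N lam xi z / X z - taylor_T N lam eta z / Y z - (2 + (P z + Q z))"
        using nz by (simp add: diff_divide_distrib add_divide_distrib)
      then show ?case unfolding PQ by (simp add: algebra_simps)
    qed
  qed
  ultimately show "(\<lambda>z. taylor_T N lam xi z / X z - taylor_T N lam eta z / Y z
      - (2 + (p j + q j) * (z * cnj z) ^ j)) \<in> O[at 0](\<lambda>z. z ^ N)"
    by (subst (asm) landau_o.big.in_cong)
qed

section \<open>Identities and estimates for following the logarithm along an orbit\<close>

lemma log_derivative_identity:
  fixes X Y Z W A B h k :: complex
  assumes "X \<noteq> 0" "Y \<noteq> 0" "Z \<noteq> 0" "W \<noteq> 0"
  shows "(X * (- \<i> * h * W) + \<i> * A * W) * inverse (X * W) - (Y * (\<i> * h * Z) + \<i> * B * Z) * inverse (Y * Z)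
    + 2 * \<i> * h - \<i> * k * of_real 1 = \<i> * (A / X - B / Y - k)"
proof -
  have "(X * (- \<i> * h * W) + \<i> * A * W) * inverse (X * W) = - \<i> * h + \<i> * (A / X)"
    using assms by (simp add: field_simps)
  moreover have "(Y * (\<i> * h * Z) + \<i> * B * Z) * inverse (Y * Z) = \<i> * h + \<i> * (B / Y)"
    using assms by (simp add: field_simps)
  ultimately show ?thesis by (simp add: algebra_simps)
qed

text \<open>The constants: \<open>norm z \<le> 5/16 * norm Z\<close>, so \<open>X\<close> is within
  5/32 + 1/16 = 7/32 of \<open>Z / 4\<close> in units of \<open>norm Z\<close>, which is less than
  1/4.\<close>

lemma scaled_close:
  fixes X z Z :: complex
  assumes "norm Z > 0" "norm (X - z) \<le> norm z / 2" "dist (z / Z) (1/4) < 1/16"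
  shows "norm (4 * X - Z) < norm Z"
proof -
  have "Z \<noteq> 0" using assms(1) by auto
  then have "z - Z / 4 = (z / Z - 1/4) * Z" by (simp add: left_diff_distrib)
  then have "norm (z - Z / 4) = norm (z / Z - 1/4) * norm Z" by (simp only: norm_mult)
  also have "\<dots> \<le> 1/16 * norm Z"
    using assms(3) unfolding dist_norm by (intro mult_right_mono) auto
  finally have 1: "norm (z - Z / 4) \<le> norm Z / 16" by simp
  have "norm z \<le> norm (Z / 4) + norm (z - Z / 4)" by (rule norm_triangle_sub)
  moreover have "norm (Z / 4) = norm Z / 4" by (simp add: norm_divide)
  ultimately have 2: "norm z \<le> 5/16 * norm Z" using 1 by linarith
  have "norm (X - Z / 4) \<le> norm (X - z) + norm (z - Z / 4)"
    using dist_triangle[of X "Z / 4" z] by (simp only: dist_norm)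
  then have "norm (X - Z / 4) < norm Z / 4" using 1 2 assms by linarith
  moreover have "norm (4 * (X - Z / 4)) = 4 * norm (X - Z / 4)" by (simp only: norm_mult norm_numeral)
  moreover have "4 * (X - Z / 4) = 4 * X - Z" by simp
  ultimately show ?thesis by simp
qed

text \<open>\<open>4 * a * b\<close> differs from the positive number \<open>norm b ^ 2\<close> by
  less than that number. The product thus stays in the right half-plane, where \<open>Ln\<close> is
  differentiable.\<close>

lemma Re_mult_pos:
  fixes a b :: complex
  assumes "norm (4 * a - cnj b) < norm b"
  shows "Re (a * b) > 0"
proof -
  have "norm b > 0" using assms norm_ge_zero[of "4 * a - cnj b"] by linarith
  then have "norm ((4 * a - cnj b) * b) < norm b * norm b"
    unfolding norm_mult by (rule mult_strict_right_mono[OF assms])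
  moreover have "- Re ((4 * a - cnj b) * b) \<le> norm ((4 * a - cnj b) * b)"
    using abs_Re_le_cmod[of "(4 * a - cnj b) * b"] by linarith
  moreover have "Re ((4 * a - cnj b) * b) = 4 * Re (a * b) - norm b * norm b"
  proof -
    have "(4 * a - cnj b) * b = 4 * (a * b) - b * cnj b" by (simp add: algebra_simps)
    also have "b * cnj b = of_real (norm b * norm b)" by (simp add: complex_norm_square[symmetric] power2_eq_square)
    finally show ?thesis by simp
  qed
  ultimately show ?thesis by simp
qed

text \<open>Applied with \<open>x = pi\<close>, \<open>y = R^(2 * j)\<close>,
  \<open>u = 16^j\<close>, \<open>s = p j + q j\<close> and \<open>T\<close> the period.\<close>

lemma period_defect_identity:
  fixes x y u s T :: complex
  assumes "y \<noteq> 0" "u \<noteq> 0"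
  shows "4 * x - (2 + s * (y / u)) * T = - 2 * y * ((T - 2 * x) / y + s * T / (2 * u))"
  using assms by (simp add: field_simps)

subsection \<open>Period constants as coefficients of the period\<close>

context morse_chart
begin

text \<open>The chart in complex notation: \<open>Z = p + \<i> * q\<close> goes to the coordinate
  \<open>x + \<i> * y\<close> of the system translated to the origin.\<close>

definition zeta :: "complex \<Rightarrow> complex" where
  "zeta Z = Complex (fst (chart (Re Z) (Im Z)) - 1) (snd (chart (Re Z) (Im Z)))"

lemma zeta_0: "zeta 0 = 0"
  by (simp add: zeta_def chart_0 complex_eq_iff)

text \<open>Both \<open>l\<close> and \<open>v\<close> have derivative 1 at 0, and both enter the
  chart divided by 4, so the real derivative at the origin is a multiple of the identity. Complex
  differentiability is claimed at this one point.\<close>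

lemma zeta_deriv: "(zeta has_field_derivative 1/4) (at 0)"
proof -
  have dl0: "(l has_real_derivative 1) (at 0)" using dl[of 0] r zero by simp
  have dv0: "(v has_real_derivative 1) (at 0)" using dv[of 0] r zero by simp
  have l': "((\<lambda>Z. l (Re Z)) has_derivative (\<lambda>h. 1 * Re h)) (at 0)"
    using has_derivative_compose[of Re Re 0 UNIV l "(*) 1"] dl0
      bounded_linear_imp_has_derivative[OF bounded_linear_Re] by (simp add: has_field_derivative_def)
  have v': "((\<lambda>Z. v (Im Z)) has_derivative (\<lambda>h. 1 * Im h)) (at 0)"
    using has_derivative_compose[of Im Im 0 UNIV v "(*) 1"] dv0
      bounded_linear_imp_has_derivative[OF bounded_linear_Im] by (simp add: has_field_derivative_def)
  have "((\<lambda>Z. of_real (exp (l (Re Z) / 4) - 1) + \<i> * of_real (exp (l (Re Z) / 4) * v (Im Z) / 4))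
      has_derivative (\<lambda>h. h * (1/4))) (at (0 :: complex))"
    by (rule derivative_eq_intros l' v' refl | simp add: zero)+
       (auto simp: fun_eq_iff complex_eq_iff)
  moreover have "zeta = (\<lambda>Z. of_real (exp (l (Re Z) / 4) - 1) + \<i> * of_real (exp (l (Re Z) / 4) * v (Im Z) / 4))"
    by (simp add: fun_eq_iff zeta_def chart_def complex_eq_iff)
  moreover have "(\<lambda>h :: complex. h * (1/4)) = (*) (1/4)" by (simp add: fun_eq_iff)
  ultimately show ?thesis unfolding has_field_derivative_def by (simp only:)
qed

lemma zeta_lim: "((\<lambda>Z. zeta Z / Z) \<longlongrightarrow> 1/4) (at 0)"
  using zeta_deriv by (simp add: has_field_derivative_iff zeta_0)

lemma filterlim_zeta: "filterlim zeta (at 0) (at 0)"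
proof -
  have "eventually (\<lambda>Z. zeta Z / Z \<noteq> 0) (at 0)"
    by (rule tendsto_imp_eventually_ne[OF zeta_lim]) simp
  then have "eventually (\<lambda>Z. zeta Z \<noteq> 0) (at 0)" by eventually_elim auto
  moreover have "(zeta \<longlongrightarrow> 0) (at 0)"
    using DERIV_isCont[OF zeta_deriv] by (simp add: isCont_def zeta_0)
  ultimately show ?thesis by (simp add: filterlim_at)
qed

text \<open>Replacing \<open>z * cnj z\<close> by \<open>(norm Z / 4)^2\<close> costs only lower
  order terms. The new main term depends on \<open>norm Z\<close> alone and is therefore constant
  along an orbit.\<close>

lemma rate_lim:
  assumes E: "(\<lambda>z. L z - (2 + s * (z * cnj z) ^ j)) \<in> O[at 0](\<lambda>z. z ^ (2 * j + 1))"
  shows "((\<lambda>Z. (L (zeta Z) - (2 + s * (of_real (norm Z) / 4) ^ (2 * j))) / of_real (norm Z) ^ (2 * j)) \<longlongrightarrow> 0) (at 0)"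
proof -
  define f where "f = (\<lambda>z. L z - (2 + s * (z * cnj z) ^ j))"
  have nz: "eventually (\<lambda>Z::complex. Z \<noteq> 0) (at 0)" by (simp add: eventually_at_filter)
  have lim1: "((\<lambda>Z. f (zeta Z) / of_real (norm Z) ^ (2 * j)) \<longlongrightarrow> 0) (at 0)"
  proof -
    obtain C where C: "C > 0" "eventually (\<lambda>z. norm (f z) \<le> C * norm (z ^ (2 * j + 1))) (at 0)"
      using E unfolding f_def by (auto elim: landau_o.bigE)
    have "eventually (\<lambda>Z. norm (f (zeta Z)) \<le> C * norm (zeta Z ^ (2 * j + 1))) (at 0)"
      using eventually_compose_filterlim[OF C(2) filterlim_zeta] .
    moreover have "((\<lambda>Z. norm (zeta Z / Z)) \<longlongrightarrow> norm (1/4 :: complex)) (at 0)"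
      by (intro tendsto_norm zeta_lim)
    then have "eventually (\<lambda>Z. norm (zeta Z / Z) < 1) (at 0)"
      by (rule order_tendstoD) simp
    ultimately have "eventually (\<lambda>Z. norm (f (zeta Z) / of_real (norm Z) ^ (2 * j)) \<le> C * norm Z) (at 0)"
      using nz
    proof eventually_elim
      case (elim Z)
      have "norm (zeta Z) \<le> norm Z" using elim(2,3) by (simp add: norm_divide divide_less_eq)
      then have "norm (zeta Z) ^ (2 * j + 1) \<le> norm Z ^ (2 * j + 1)" by (intro power_mono) auto
      then have "C * norm (zeta Z ^ (2 * j + 1)) \<le> C * (norm Z * norm Z ^ (2 * j))"
        using C(1) by (simp add: norm_power norm_mult mult_left_mono)
      then have "norm (f (zeta Z)) \<le> C * norm Z * norm Z ^ (2 * j)" using elim(1) by (simp add: mult.assoc)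
      then show ?case using elim(3) by (simp add: norm_divide norm_power divide_le_eq)
    qed
    moreover have "((\<lambda>Z::complex. C * norm Z) \<longlongrightarrow> 0) (at 0)"
      by (intro tendsto_mult_right_zero tendsto_norm_zero tendsto_ident_at)
    ultimately show ?thesis by (rule Lim_null_comparison)
  qed
  have "((\<lambda>Z. s * (of_real (norm (zeta Z / Z)) ^ (2 * j) - (1/4) ^ (2 * j))) \<longlongrightarrow>
      s * (of_real (norm (1/4 :: complex)) ^ (2 * j) - (1/4) ^ (2 * j))) (at 0)"
    by (intro tendsto_intros zeta_lim)
  then have "((\<lambda>Z. s * (of_real (norm (zeta Z / Z)) ^ (2 * j) - (1/4) ^ (2 * j))) \<longlongrightarrow> 0) (at 0)"
    by simp
  from tendsto_add[OF lim1 this]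
  have "((\<lambda>Z. f (zeta Z) / of_real (norm Z) ^ (2 * j) + s * (of_real (norm (zeta Z / Z)) ^ (2 * j) - (1/4) ^ (2 * j))) \<longlongrightarrow> 0) (at 0)"
    by simp
  then show ?thesis
  proof (rule Lim_transform_eventually)
    show "eventually (\<lambda>Z. f (zeta Z) / of_real (norm Z) ^ (2 * j) + s * (of_real (norm (zeta Z / Z)) ^ (2 * j) - (1/4) ^ (2 * j)) =
      (L (zeta Z) - (2 + s * (of_real (norm Z) / 4) ^ (2 * j))) / of_real (norm Z) ^ (2 * j)) (at 0)"
      using nz
    proof eventually_elim
      case (elim Z)
      define n where "n = (of_real (norm Z) :: complex) ^ (2 * j)"
      have n: "n \<noteq> 0" using elim by (simp add: n_def)
      have 1: "of_real (norm (zeta Z / Z)) ^ (2 * j) = (zeta Z * cnj (zeta Z)) ^ j / n"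
        by (simp add: n_def norm_divide power_divide power_mult flip: complex_norm_square)
      have 2: "(of_real (norm Z) / 4) ^ (2 * j) = n * (1/4) ^ (2 * j)"
        by (simp add: n_def power_divide)
      show ?case unfolding 1 2 n_def[symmetric] f_def using n by (simp add: field_simps)
    qed
  qed
qed

text \<open>Over one turn \<open>Ln (X / Y)\<close> grows by \<open>4 * pi * \<i>\<close>, while its
  rate is \<open>\<i>\<close> times nearly the constant \<open>\<kappa> R\<close>. Solving
  \<open>4 * pi = (2 + (p j + q j) * R^(2 * j) / 16^j) * T\<close> for \<open>T\<close> to first
  order gives the limit.\<close>

lemma period_expansion:
  assumes nf: "normal_form lam xi eta p q" and j: "j \<ge> 1"
    and low: "\<And>i. 1 \<le> i \<Longrightarrow> i < j \<Longrightarrow> p i + q i = 0"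
    and T: "(period_integral \<longlongrightarrow> 2 * pi) (at_right 0)"
  shows "((\<lambda>R. complex_of_real ((period_integral R - 2 * pi) / R ^ (2 * j))) \<longlongrightarrow> - of_real pi * (p j + q j) / 16 ^ j) (at_right 0)"
proof -
  define N where "N = 2 * j + 1"
  define X where "X = taylor (Suc N) xi"
  define Y where "Y = taylor (Suc N) eta"
  define L where "L z = taylor_T N lam xi z / X z - taylor_T N lam eta z / Y z" for z
  define s where "s = p j + q j"
  note rate = normal_form_rate[OF nf j low, folded N_def, folded X_def Y_def, folded L_def s_def]
  define \<kappa> where "\<kappa> R = 2 + s * (of_real R / 4) ^ (2 * j)" for R :: real
  \<comment> \<open>Actual minus predicted growth of the argument of \<open>X / Y\<close> over one
    period.\<close>
  have key: "eventually (\<lambda>R. norm (4 * of_real pi - \<kappa> R * of_real (period_integral R))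
      \<le> e * R ^ (2 * j) * period_integral R) (at_right 0)" if e: "e > 0" for e
  proof -
    have ev1: "eventually (\<lambda>Z. norm ((L (zeta Z) - \<kappa> (norm Z)) / of_real (norm Z) ^ (2 * j)) < e) (at 0)"
      using rate_lim[OF rate(1)[unfolded N_def]] e unfolding tendsto_iff \<kappa>_def by (simp add: dist_norm)
    have ev2: "eventually (\<lambda>Z. norm (X (zeta Z) - zeta Z) \<le> norm (zeta Z) / 2) (at 0)"
        "eventually (\<lambda>Z. norm (Y (zeta Z) - cnj (zeta Z)) \<le> norm (zeta Z) / 2) (at 0)"
      using eventually_compose_filterlim[OF rate(2) filterlim_zeta]
        eventually_compose_filterlim[OF rate(3) filterlim_zeta] by auto
    have ev3: "eventually (\<lambda>Z. dist (zeta Z / Z) (1/4) < 1/16) (at 0)"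
      using zeta_lim by (rule tendstoD) simp
    from ev1 ev2 ev3 have "eventually (\<lambda>Z. norm ((L (zeta Z) - \<kappa> (norm Z)) / of_real (norm Z) ^ (2 * j)) < e \<and>
        norm (X (zeta Z) - zeta Z) \<le> norm (zeta Z) / 2 \<and> norm (Y (zeta Z) - cnj (zeta Z)) \<le> norm (zeta Z) / 2 \<and>
        dist (zeta Z / Z) (1/4) < 1/16) (at 0)"
      by eventually_elim blast
    then obtain \<delta> where \<delta>: "\<delta> > 0" "\<And>Z. Z \<noteq> 0 \<Longrightarrow> norm Z < \<delta> \<Longrightarrow>
        norm ((L (zeta Z) - \<kappa> (norm Z)) / of_real (norm Z) ^ (2 * j)) < e \<and>
        norm (X (zeta Z) - zeta Z) \<le> norm (zeta Z) / 2 \<and> norm (Y (zeta Z) - cnj (zeta Z)) \<le> norm (zeta Z) / 2 \<and>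
        dist (zeta Z / Z) (1/4) < 1/16"
      unfolding eventually_at by (auto simp: dist_norm)
    have main: "norm (4 * of_real pi - \<kappa> R * of_real (period_integral R)) \<le> e * R ^ (2 * j) * period_integral R"
      if R: "0 < R" "R < min r \<delta>" for R
    proof -
      have Rr: "0 < R" "R < r" using R by auto
      obtain \<theta> where \<theta>: "\<And>t. (\<theta> has_real_derivative 1 / omega R (\<theta> t)) (at t)" "\<theta> 0 = 0"
        "\<And>t. \<theta> (t + period_integral R) = \<theta> t + 2 * pi" "period_integral R > 0"
        "is_solution (system_S lam) (\<lambda>t. polar R (\<theta> t))"
        "minimal_period (\<lambda>t. polar R (\<theta> t)) (period_integral R)"
        by (rule orbit[OF Rr, of 0]) (rule that)
      \<comment> \<open>In chart coordinates the orbit is the circle of radius \<open>R\<close>,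
        traversed once per period. \<open>Z\<close> and \<open>cnj Z\<close> serve as reference
        curves for the winding of \<open>X\<close> and \<open>Y\<close>.\<close>
      define Z where "Z t = complex_of_real R * exp (\<i> * of_real (\<theta> t))" for t
      have Zcs: "Re (Z t) = R * cos (\<theta> t)" "Im (Z t) = R * sin (\<theta> t)" for t
        by (simp_all add: Z_def Re_exp Im_exp)
      have normZ: "norm (Z t) = R" for t using R by (simp add: Z_def norm_mult)
      have Z0: "Z t \<noteq> 0" for t using normZ[of t] R by auto
      define z where "z t = zeta (Z t)" for t
      define th where "th t = complex_of_real (1 / omega R (\<theta> t))" for t
      have d\<theta>: "((\<lambda>t. complex_of_real (\<theta> t)) has_vector_derivative th t) (at t)" for t
        unfolding th_def by (rule has_vector_derivative_of_real[OF \<theta>(1)])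
      have dZ: "(Z has_vector_derivative \<i> * th t * Z t) (at t)" for t
      proof -
        have "((\<lambda>t. \<i> * of_real (\<theta> t)) has_vector_derivative \<i> * th t) (at t)"
          by (rule has_vector_derivative_mult_right[OF d\<theta>])
        from field_vector_diff_chain_at[OF this DERIV_exp]
        have "((\<lambda>t. exp (\<i> * of_real (\<theta> t))) has_vector_derivative \<i> * th t * exp (\<i> * of_real (\<theta> t))) (at t)"
          by (simp add: o_def)
        from has_vector_derivative_mult_right[OF this, of "of_real R"]
        show ?thesis unfolding Z_def[abs_def] by (simp add: mult_ac)
      qed
      have dcZ: "((\<lambda>t. cnj (Z t)) has_vector_derivative - \<i> * th t * cnj (Z t)) (at t)" for t
        using has_vector_derivative_cnj[OF dZ[of t]] by (simp add: th_def)
      have dz: "(z has_vector_derivative field_complex lam (z t)) (at t)" for t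
      proof -
        define g where "g t = polar R (\<theta> t)" for t
        have g: "(g has_vector_derivative system_S lam (g t)) (at t)"
          using \<theta>(5) unfolding is_solution_def g_def by (rule spec)
        have zg: "z t = of_real (fst (g t) - 1) + \<i> * of_real (snd (g t))" for t
          by (rule complex_eqI) (simp_all add: z_def zeta_def Zcs g_def)
        have d1: "((\<lambda>t. fst (g t) - 1) has_real_derivative fst (system_S lam (g t)) - 0) (at t)"
          by (rule DERIV_diff[OF _ DERIV_const])
             (rule bounded_linear.has_vector_derivative[OF bounded_linear_fst g, folded has_real_derivative_iff_has_vector_derivative])
        have d2: "((\<lambda>t. snd (g t)) has_real_derivative snd (system_S lam (g t))) (at t)"
          by (rule bounded_linear.has_vector_derivative[OF bounded_linear_snd g, folded has_real_derivative_iff_has_vector_derivative])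
        have "(z has_vector_derivative of_real (fst (system_S lam (g t)) - 0) + \<i> * of_real (snd (system_S lam (g t)))) (at t)"
          unfolding zg[abs_def]
          by (rule has_vector_derivative_add[OF has_vector_derivative_of_real[OF d1]
                has_vector_derivative_mult_right[OF has_vector_derivative_of_real[OF d2]]])
        moreover have "translated_S lam (Re (z t), Im (z t)) = system_S lam (g t)"
          by (simp add: zg translated_S_def)
        ultimately show ?thesis by (simp add: field_complex_def case_prod_unfold Complex_eq)
      qed
      have bounds: "norm (L (z t) - \<kappa> R) \<le> e * R ^ (2 * j)"
          "norm (4 * X (z t) - Z t) < R" "norm (4 * Y (z t) - cnj (Z t)) < R" for t
      proof -
        have *: "norm ((L (z t) - \<kappa> R) / of_real R ^ (2 * j)) < e"
            "norm (X (z t) - z t) \<le> norm (z t) / 2" "norm (Y (z t) - cnj (z t)) \<le> norm (z t) / 2"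
            "dist (z t / Z t) (1/4) < 1/16"
          using \<delta>(2)[OF Z0[of t]] R unfolding normZ z_def by auto
        show "norm (L (z t) - \<kappa> R) \<le> e * R ^ (2 * j)"
          using *(1) R by (simp add: norm_divide norm_power divide_less_eq)
        have "norm (Z t) > 0" using normZ R by simp
        from scaled_close[OF this *(2) *(4)] show "norm (4 * X (z t) - Z t) < R"
          unfolding normZ .
        have "cnj (z t) / cnj (Z t) - 1/4 = cnj (z t / Z t - 1/4)" by simp
        then have "dist (cnj (z t) / cnj (Z t)) (1/4) < 1/16"
          using *(4) unfolding dist_norm by (simp only: complex_mod_cnj)
        from scaled_close[OF _ _ this, of "Y (z t)"] *(3) \<open>norm (Z t) > 0\<close>
        show "norm (4 * Y (z t) - cnj (Z t)) < R"
          unfolding complex_mod_cnj normZ by blast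
      qed
      have XZ: "Re (X (z t) * cnj (Z t)) > 0" and YZ: "Re (Y (z t) * Z t) > 0" for t
        using Re_mult_pos[of "X (z t)" "cnj (Z t)"] Re_mult_pos[of "Y (z t)" "Z t"] bounds(2,3)[of t] normZ[of t]
        unfolding complex_mod_cnj complex_cnj_cnj by blast+
      \<comment> \<open>\<open>M\<close> is \<open>Ln (X / Y)\<close> minus its expected growth, with the winding number split off so that
        \<open>Ln\<close> is differentiable. It has a small derivative, and over one period it changes by
        \<open>\<i> * (4 * pi - \<kappa> R * period_integral R)\<close>.\<close>
      define M where "M t = Ln (X (z t) * cnj (Z t)) - Ln (Y (z t) * Z t) + 2 * \<i> * of_real (\<theta> t) - \<i> * \<kappa> R * of_real t" for t
      have dM: "(M has_vector_derivative \<i> * (L (z t) - \<kappa> R)) (at t)" for t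
      proof -
        have dLn: "((\<lambda>t. Ln (f t)) has_vector_derivative f' * inverse (f t)) (at t)"
          if "(f has_vector_derivative f') (at t)" "Re (f t) > 0" for f f'
        proof -
          have "f t \<notin> \<real>\<^sub>\<le>\<^sub>0" using that(2) by (auto simp: complex_nonpos_Reals_iff)
          from field_vector_diff_chain_at[OF that(1) has_field_derivative_Ln[OF this]]
          show ?thesis unfolding o_def .
        qed
        have dX: "((\<lambda>t. X (z t)) has_vector_derivative \<i> * taylor_T N lam xi (z t)) (at t)"
          and dY: "((\<lambda>t. Y (z t)) has_vector_derivative \<i> * taylor_T N lam eta (z t)) (at t)"
          unfolding X_def Y_def by (rule taylor_T_derivative[OF dz])+
        note d1 = dLn[OF has_vector_derivative_mult[OF dX dcZ] XZ]
        note d2 = dLn[OF has_vector_derivative_mult[OF dY dZ] YZ]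
        have "((\<lambda>t. \<i> * \<kappa> R * of_real t) has_vector_derivative \<i> * \<kappa> R * of_real 1) (at t)"
          by (intro has_vector_derivative_mult_right has_vector_derivative_of_real DERIV_ident)
        from has_vector_derivative_diff[OF has_vector_derivative_add[OF has_vector_derivative_diff[OF d1 d2]
            has_vector_derivative_mult_right[OF d\<theta>, of "2 * \<i>"]] this]
        have "(M has_vector_derivative
            (X (z t) * (- \<i> * th t * cnj (Z t)) + \<i> * taylor_T N lam xi (z t) * cnj (Z t)) * inverse (X (z t) * cnj (Z t))
            - (Y (z t) * (\<i> * th t * Z t) + \<i> * taylor_T N lam eta (z t) * Z t) * inverse (Y (z t) * Z t)
            + 2 * \<i> * th t - \<i> * \<kappa> R * of_real 1) (at t)"
          unfolding M_def[abs_def] .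
        moreover have "(X (z t) * (- \<i> * th t * cnj (Z t)) + \<i> * taylor_T N lam xi (z t) * cnj (Z t)) * inverse (X (z t) * cnj (Z t))
            - (Y (z t) * (\<i> * th t * Z t) + \<i> * taylor_T N lam eta (z t) * Z t) * inverse (Y (z t) * Z t)
            + 2 * \<i> * th t - \<i> * \<kappa> R * of_real 1 = \<i> * (L (z t) - \<kappa> R)"
          unfolding L_def
        proof (rule log_derivative_identity)
          show "X (z t) \<noteq> 0" "Y (z t) \<noteq> 0" using XZ[of t] YZ[of t] by auto
          show "Z t \<noteq> 0" "cnj (Z t) \<noteq> 0" using Z0[of t] by simp_all
        qed
        ultimately show ?thesis
          by (rule back_subst[where P = "\<lambda>d. (M has_vector_derivative d) (at t)"])
      qed
      have "norm (M (period_integral R) - M 0) \<le> e * R ^ (2 * j) * norm (period_integral R - 0)"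
      proof (rule differentiable_bound[of UNIV])
        show "(M has_derivative (\<lambda>h. h *\<^sub>R (\<i> * (L (z t) - \<kappa> R)))) (at t within UNIV)" for t
          using dM[of t] by (simp add: has_vector_derivative_def)
        show "onorm (\<lambda>h. h *\<^sub>R (\<i> * (L (z t) - \<kappa> R))) \<le> e * R ^ (2 * j)" for t
        proof (rule onorm_le)
          fix h :: real
          have "norm (h *\<^sub>R (\<i> * (L (z t) - \<kappa> R))) = norm (L (z t) - \<kappa> R) * norm h"
            by (simp add: norm_mult)
          also have "\<dots> \<le> e * R ^ (2 * j) * norm h"
            by (rule mult_right_mono[OF bounds(1) norm_ge_zero])
          finally show "norm (h *\<^sub>R (\<i> * (L (z t) - \<kappa> R))) \<le> e * R ^ (2 * j) * norm h" .
        qed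
      qed auto
      moreover have "M (period_integral R) - M 0 = \<i> * (4 * of_real pi - \<kappa> R * of_real (period_integral R))"
      proof -
        have "\<theta> (period_integral R) = \<theta> 0 + 2 * pi" using \<theta>(3)[of 0] by simp
        then have \<theta>T: "complex_of_real (\<theta> (period_integral R)) = of_real (\<theta> 0) + 2 * of_real pi"
          and "Z (period_integral R) = Z 0"
          by (simp_all add: complex_eq_iff Zcs)
        then have eq: "z (period_integral R) = z 0" "Z (period_integral R) = Z 0" by (simp_all add: z_def)
        have ring: "(u - w + 2 * \<i> * (x + 2 * y) - \<i> * k * T) - (u - w + 2 * \<i> * x - \<i> * k * 0) = \<i> * (4 * y - k * T)"
          for u w x y k T :: complex
          by (simp add: algebra_simps)
        show ?thesis unfolding M_def \<theta>T eq of_real_0 by (rule ring)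
      qed
      ultimately show ?thesis using \<theta>(4) by (simp add: norm_mult)
    qed
    have "eventually (\<lambda>R::real. 0 < R \<and> R < min r \<delta>) (at_right 0)"
      by (intro eventually_conj eventually_at_right_less order_tendstoD(2)[OF tendsto_ident_at])
         (simp add: r \<delta>(1))
    then show ?thesis by (rule eventually_mono) (rule main; simp)
  qed
  \<comment> \<open>The error of the claimed asymptotics, with the period still standing where its
    limit \<open>2 * pi\<close> belongs; the hypothesis \<open>T\<close> repairs this at the
    end.\<close>
  define f where "f R = complex_of_real ((period_integral R - 2 * pi) / R ^ (2 * j))
      + s * of_real (period_integral R) / (2 * 16 ^ j)" for R
  have "(f \<longlongrightarrow> 0) (at_right 0)"
  proof (rule tendstoI)
    fix e :: real assume e: "e > 0"
    \<comment> \<open>Since \<open>2 * pi < 8\<close>, the estimate \<open>key\<close>, whose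
      right-hand side contains the period, becomes one by a multiple of
      \<open>R^(2 * j)\<close>.\<close>
    have Tb: "eventually (\<lambda>R. period_integral R < 8) (at_right 0)"
      by (rule order_tendstoD(2)[OF T]) (use pi_less_4 in simp)
    have "eventually (\<lambda>R::real. R > 0) (at_right 0)" by (rule eventually_at_right_less)
    moreover have "eventually (\<lambda>R. norm (4 * of_real pi - \<kappa> R * of_real (period_integral R))
        \<le> e / 8 * R ^ (2 * j) * period_integral R) (at_right 0)"
      by (rule key) (use e in simp)
    ultimately show "eventually (\<lambda>R. dist (f R) 0 < e) (at_right 0)"
      using Tb
    proof eventually_elim
      fix R :: real
      assume k: "norm (4 * of_real pi - \<kappa> R * of_real (period_integral R)) \<le> e / 8 * R ^ (2 * j) * period_integral R"
        and "0 < R" "period_integral R < 8"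
      then have R: "period_integral R < 8 \<and> R > 0" by simp
      have pw: "(of_real R / 4) ^ (2 * j) = (of_real (R ^ (2 * j)) :: complex) / 16 ^ j"
        by (simp add: power_divide power_mult)
      have nz: "of_real (R ^ (2 * j)) \<noteq> (0 :: complex)" "(16 :: complex) ^ j \<noteq> 0"
        using R by simp_all
      have "4 * of_real pi - \<kappa> R * of_real (period_integral R) = - 2 * of_real (R ^ (2 * j)) * f R"
        unfolding \<kappa>_def f_def pw of_real_divide of_real_diff of_real_mult of_real_numeral
        by (rule period_defect_identity[OF nz])
      then have "norm (4 * of_real pi - \<kappa> R * of_real (period_integral R)) = 2 * R ^ (2 * j) * norm (f R)"
        using R by (simp only: norm_mult norm_of_real norm_minus_cancel norm_numeral power_abs abs_of_pos)
      then have "2 * R ^ (2 * j) * norm (f R) \<le> e / 8 * R ^ (2 * j) * period_integral R"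
        using k by (simp only:)
      also have "\<dots> \<le> e / 8 * R ^ (2 * j) * 8"
        by (rule mult_left_mono) (use R e in simp_all)
      also have "\<dots> = R ^ (2 * j) * e" by simp
      also have "2 * R ^ (2 * j) * norm (f R) = R ^ (2 * j) * (2 * norm (f R))" by simp
      finally have "R ^ (2 * j) * (2 * norm (f R)) \<le> R ^ (2 * j) * e" .
      then have "2 * norm (f R) \<le> e"
        by (rule mult_left_le_imp_le) (use R in simp)
      then show "dist (f R) 0 < e" using e by simp
    qed
  qed
  moreover have "((\<lambda>R. s * of_real (period_integral R) / (2 * 16 ^ j)) \<longlongrightarrow> s * of_real (2 * pi) / (2 * 16 ^ j)) (at_right 0)"
    by (intro tendsto_intros T) simp
  ultimately have "((\<lambda>R. f R - s * of_real (period_integral R) / (2 * 16 ^ j)) \<longlongrightarrow> 0 - s * of_real (2 * pi) / (2 * 16 ^ j)) (at_right 0)"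
    by (rule tendsto_diff)
  then show ?thesis by (simp add: f_def s_def mult.commute)
qed

end

subsection \<open>Existence of the Morse chart\<close>

lemma fps_expansion_unique_real:
  fixes f :: "real \<Rightarrow> real"
  assumes "f has_fps_expansion F" "f has_fps_expansion G"
  shows "F = G"
  using fps_nth_fps_expansion_real[OF assms(1)] fps_nth_fps_expansion_real[OF assms(2)]
  by (simp add: fps_eq_iff)

lemma fps_expansion_isCont:
  fixes f :: "real \<Rightarrow> real"
  assumes "f has_fps_expansion F"
  shows "eventually (\<lambda>x. isCont f x) (nhds 0)"
  using has_real_derivative_of_fps_expansion[OF assms] by eventually_elim (rule DERIV_isCont)

lemma fps_expansion_nth_1:
  fixes f :: "real \<Rightarrow> real"
  assumes "f has_fps_expansion F" "(f has_real_derivative D) (at 0)"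
  shows "F $ 1 = D"
  using DERIV_unique[OF eventually_nhds_x_imp_x[OF has_real_derivative_of_fps_expansion[OF assms(1)]] assms(2)]
  by (simp add: eval_fps_at_0)

lemma eval_fps_deriv_expansion:
  fixes G :: "real fps"
  assumes "f has_fps_expansion G"
  shows "eval_fps (fps_deriv G) has_fps_expansion fps_deriv G"
  using assms fps_conv_radius_deriv[of G]
  by (intro eval_fps_has_fps_expansion) (auto simp: has_fps_expansion_def)

text \<open>The potential is \<open>l + exp (- l) - 1\<close>. In the variable
  \<open>V = 1 - exp (- l)\<close> the equations are those of \<open>morse_coeffs\<close> at
  \<open>a = -1\<close>, \<open>b = c = d = 0\<close>. The same potential occurs in Laplace's method
  for the Gamma function: the listed coefficients are the Stirling coefficients 1/12, 1/288,
  -139/51840 divided by 1, 3, 15.\<close>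

lemma x_coordinate:
  obtains l P al :: "real \<Rightarrow> real" and A H :: "real fps" where
    "eventually (\<lambda>p. (l has_real_derivative al p * exp (l p)) (at p)) (nhds 0)"
    "eventually (\<lambda>p. al p * (exp (l p) - 1) = p) (nhds 0)"
    "l 0 = 0" "al has_fps_expansion A"
    "A $ 0 = 1" "A $ 2 = 1/12" "A $ 4 = 1/864" "A $ 6 = - 139/777600"
    "P has_fps_expansion H" "H $ 0 = 0" "H $ 1 = 1" "eventually (\<lambda>x. l (P x) = x) (nhds 0)"
proof -
  have phi: "(\<lambda>x::real. 1 - exp (- x)) has_fps_expansion 1 - fps_exp (-1)"
    by (intro fps_expansion_intros)
  have phi0: "(1 - fps_exp (-1) :: real fps) $ 0 = 0" and phi1: "(1 - fps_exp (-1) :: real fps) $ 1 = 1"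
    by simp_all
  show ?thesis
  proof (rule morse_coordinate[OF phi phi0 phi1])
    fix l P :: "real \<Rightarrow> real" and G H :: "real fps"
    assume l: "l has_fps_expansion G" "G $ 0 = 0" "G $ 1 = 1"
      and P: "P has_fps_expansion H" "H $ 0 = 0" "H $ 1 = 1" "eventually (\<lambda>x. l (P x) = x) (nhds 0)"
      and ode: "eventually (\<lambda>x. eval_fps (fps_deriv G) x * (1 - exp (- l x)) = x) (nhds 0)"
  have l0: "l 0 = 0" using l by (simp add: has_fps_expansion_imp_0_eq_fps_nth_0)
  obtain V where V: "(\<lambda>p. 1 - exp (- l p)) has_fps_expansion V"
    using has_fps_expansion_compose_real[OF phi l(1,2)] by blast
  have V0: "V $ 0 = 0" using has_fps_expansion_imp_0_eq_fps_nth_0[OF V] l0 by simp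
  define al where "al = (\<lambda>p. eval_fps (fps_deriv G) p * exp (- l p))"
  note dG = eval_fps_deriv_expansion[OF l(1)]
  have "(\<lambda>p. eval_fps (fps_deriv G) p * (1 - (1 - exp (- l p)))) has_fps_expansion fps_deriv G * (1 - V)"
    by (intro fps_expansion_intros dG V)
  then have al: "al has_fps_expansion fps_deriv G * (1 - V)" by (simp add: al_def)
  note dl = has_real_derivative_of_fps_expansion[OF l(1)]
  have "eventually (\<lambda>p. deriv (\<lambda>p. 1 - exp (- l p)) p = al p) (nhds 0)"
    using dl
  proof eventually_elim
    case (elim p)
    have "((\<lambda>p. 1 - exp (- l p)) has_real_derivative al p) (at p)"
      unfolding al_def by (rule derivative_eq_intros elim refl | simp)+
    then show ?case by (rule DERIV_imp_deriv)
  qed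
  then have "al has_fps_expansion fps_deriv V"
    using has_fps_expansion_deriv[OF V] by (subst (asm) has_fps_expansion_cong) auto
  then have BV: "fps_deriv G * (1 - V) = fps_deriv V" by (rule fps_expansion_unique_real[OF al])
  have "(\<lambda>x. eval_fps (fps_deriv G) x * (1 - exp (- l x))) has_fps_expansion fps_deriv G * V"
    by (intro fps_expansion_intros dG V)
  then have "(\<lambda>x. x) has_fps_expansion fps_deriv G * V"
    using ode by (subst (asm) has_fps_expansion_cong) auto
  then have BX: "fps_deriv G * V = fps_X"
    by (rule fps_expansion_unique_real) (intro fps_expansion_intros)
  have V1: "V $ 1 = 1"
    using arg_cong[OF BV, of "\<lambda>F. F $ 0"] l(3) V0 by simp
  have B1: "fps_deriv G * (1 + fps_const (- 1) * V) = fps_deriv V"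
    using BV by (simp flip: fps_const_neg)
  have B2: "fps_deriv G * (V - fps_const 0 * V ^ 2 - fps_const 0 * V ^ 3 - fps_const 0 * V ^ 4) = fps_X"
    using BX by simp
  note coeffs = morse_coeffs[OF V0 V1 B1 B2]
  \<comment> \<open>So \<open>al\<close> is the derivative of \<open>l\<close> minus the identity,
    and its even coefficients can be read off from \<open>coeffs\<close>.\<close>
  have "fps_deriv G * (1 - V) = fps_deriv G - fps_X" using BX by (simp add: right_diff_distrib)
  then have A: "(fps_deriv G * (1 - V)) $ 0 = 1" "(fps_deriv G * (1 - V)) $ 2 = 1/12"
    "(fps_deriv G * (1 - V)) $ 4 = 1/864" "(fps_deriv G * (1 - V)) $ 6 = - 139/777600"
    by (simp_all only: fps_sub_nth coeffs be_coeff2_def be_coeff4_def be_coeff6_def fps_X_nth) simp_all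
  have al_exp: "al p * exp (l p) = eval_fps (fps_deriv G) p" for p
    unfolding al_def mult.assoc exp_minus by simp
  have "al p * (exp (l p) - 1) = eval_fps (fps_deriv G) p * (1 - exp (- l p))" for p
    unfolding right_diff_distrib al_exp by (simp add: al_def)
  then have eq: "eventually (\<lambda>p. al p * (exp (l p) - 1) = p) (nhds 0)"
    using ode by (simp only:)
  have "eventually (\<lambda>p. (l has_real_derivative al p * exp (l p)) (at p)) (nhds 0)"
    unfolding al_exp by (rule dl)
  from that[OF this eq l0 al A P] show thesis .
  qed
qed

lemma y_coordinate:
  fixes a b c d :: real
  obtains v be :: "real \<Rightarrow> real" and V B :: "real fps" where
    "eventually (\<lambda>q. (v has_real_derivative be q * (1 + a * v q)) (at q)) (nhds 0)"
    "eventually (\<lambda>q. be q * (v q - b * v q ^ 2 - c * v q ^ 3 - d * v q ^ 4) = q) (nhds 0)"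
    "eventually (\<lambda>q. 1 + a * v q > 0) (nhds 0)"
    "v 0 = 0" "be has_fps_expansion B" "B $ 0 = 1"
    "V $ 0 = 0" "V $ 1 = 1" "B * (1 + fps_const a * V) = fps_deriv V"
    "B * (V - fps_const b * V^2 - fps_const c * V^3 - fps_const d * V^4) = fps_X"
proof -
  define phi where "phi = (\<lambda>x::real. (x - b * x ^ 2 - c * x ^ 3 - d * x ^ 4) / (1 + a * x))"
  define F where "F = (fps_X - fps_const b * fps_X ^ 2 - fps_const c * fps_X ^ 3 - fps_const d * fps_X ^ 4) / (1 + fps_const a * fps_X)"
  have phi: "phi has_fps_expansion F"
    unfolding phi_def F_def by (intro fps_expansion_intros) simp
  have "F $ 0 = 0" using has_fps_expansion_imp_0_eq_fps_nth_0[OF phi] by (simp add: phi_def)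
  moreover have "(phi has_real_derivative 1) (at 0)"
    unfolding phi_def by (rule derivative_eq_intros refl | simp)+
  then have "F $ 1 = 1" by (rule fps_expansion_nth_1[OF phi])
  ultimately have F1: "F $ 0 = 0" "F $ 1 = 1" by simp_all
  show ?thesis
  proof (rule morse_coordinate[OF phi F1])
    fix v Y :: "real \<Rightarrow> real" and G H :: "real fps"
    assume v: "v has_fps_expansion G" "G $ 0 = 0" "G $ 1 = 1"
      and ode: "eventually (\<lambda>x. eval_fps (fps_deriv G) x * phi (v x) = x) (nhds 0)"
  have v0: "v 0 = 0" using v by (simp add: has_fps_expansion_imp_0_eq_fps_nth_0)
  note dG = eval_fps_deriv_expansion[OF v(1)]
  define be where "be = (\<lambda>q. eval_fps (fps_deriv G) q / (1 + a * v q))"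
  define B where "B = fps_deriv G / (1 + fps_const a * G)"
  have den: "(\<lambda>q. 1 + a * v q) has_fps_expansion 1 + fps_const a * G"
    by (intro fps_expansion_intros v)
  have be: "be has_fps_expansion B"
    unfolding be_def B_def by (intro has_fps_expansion_divide' dG den) (simp add: v)
  have pos: "eventually (\<lambda>q. 1 + a * v q > 0) (nhds 0)"
    by (rule fps_expansion_pos[OF den]) (simp add: v)
  have dv: "eventually (\<lambda>q. (v has_real_derivative be q * (1 + a * v q)) (at q)) (nhds 0)"
    using has_real_derivative_of_fps_expansion[OF v(1)] pos by eventually_elim (simp add: be_def)
  have eq: "eventually (\<lambda>q. be q * (v q - b * v q ^ 2 - c * v q ^ 3 - d * v q ^ 4) = q) (nhds 0)"
    using ode pos by eventually_elim (simp add: be_def phi_def)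
  have "(\<lambda>q. be q * (1 + a * v q)) has_fps_expansion B * (1 + fps_const a * G)"
    by (intro has_fps_expansion_mult be den)
  moreover have "eventually (\<lambda>q. be q * (1 + a * v q) = eval_fps (fps_deriv G) q) (nhds 0)"
    using pos by eventually_elim (simp add: be_def)
  ultimately have "eval_fps (fps_deriv G) has_fps_expansion B * (1 + fps_const a * G)"
    by (subst (asm) has_fps_expansion_cong) auto
  then have B1: "B * (1 + fps_const a * G) = fps_deriv G"
    by (rule fps_expansion_unique_real[OF _ dG])
  have pow: "(\<lambda>q. v q ^ n) has_fps_expansion G ^ n" for n
    by (induction n) (auto intro!: fps_expansion_intros v)
  have "(\<lambda>q. be q * (v q - b * v q ^ 2 - c * v q ^ 3 - d * v q ^ 4)) has_fps_expansion
      B * (G - fps_const b * G ^ 2 - fps_const c * G ^ 3 - fps_const d * G ^ 4)"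
    by (intro has_fps_expansion_mult has_fps_expansion_diff has_fps_expansion_cmult_left be v pow)
  then have "(\<lambda>q. q) has_fps_expansion B * (G - fps_const b * G ^ 2 - fps_const c * G ^ 3 - fps_const d * G ^ 4)"
    using eq by (subst (asm) has_fps_expansion_cong) auto
  then have B2: "B * (G - fps_const b * G ^ 2 - fps_const c * G ^ 3 - fps_const d * G ^ 4) = fps_X"
    by (rule fps_expansion_unique_real) (intro fps_expansion_intros)
  have "B $ 0 = 1" using arg_cong[OF B1, of "\<lambda>F. F $ 0"] v by simp
  from that[OF dv eq pos v0 be this v(2,3) B1 B2] show thesis .
  qed
qed

lemma morse_chart_exists:
  fixes a b c d :: real
  obtains r l v al be P A B V H where "morse_chart a b c d r l v al be"
    "al has_fps_expansion A" "be has_fps_expansion B"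
    "A $ 0 = 1" "A $ 2 = 1/12" "A $ 4 = 1/864" "A $ 6 = - 139/777600" "B $ 0 = 1"
    "V $ 0 = 0" "V $ 1 = 1" "B * (1 + fps_const a * V) = fps_deriv V"
    "B * (V - fps_const b * V^2 - fps_const c * V^3 - fps_const d * V^4) = fps_X"
    "P has_fps_expansion H" "H $ 0 = 0" "H $ 1 = 1" "eventually (\<lambda>x. l (P x) = x) (nhds 0)"
proof -
  obtain l P al A H where l: "eventually (\<lambda>p. (l has_real_derivative al p * exp (l p)) (at p)) (nhds 0)"
    "eventually (\<lambda>p. al p * (exp (l p) - 1) = p) (nhds 0)" "l 0 = 0" "al has_fps_expansion A"
    "A $ 0 = 1" "A $ 2 = 1/12" "A $ 4 = 1/864" "A $ 6 = - 139/777600"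
    "P has_fps_expansion H" "H $ 0 = 0" "H $ 1 = 1" "eventually (\<lambda>x. l (P x) = x) (nhds 0)"
    by (rule x_coordinate)
  obtain v be V B where v: "eventually (\<lambda>q. (v has_real_derivative be q * (1 + a * v q)) (at q)) (nhds 0)"
    "eventually (\<lambda>q. be q * (v q - b * v q ^ 2 - c * v q ^ 3 - d * v q ^ 4) = q) (nhds 0)"
    "eventually (\<lambda>q. 1 + a * v q > 0) (nhds 0)" "v 0 = 0" "be has_fps_expansion B" "B $ 0 = 1"
    "V $ 0 = 0" "V $ 1 = 1" "B * (1 + fps_const a * V) = fps_deriv V"
    "B * (V - fps_const b * V^2 - fps_const c * V^3 - fps_const d * V^4) = fps_X"
    by (rule y_coordinate[of a b c d])
  have al: "eventually (\<lambda>p. al p > 0) (nhds 0)" "eventually (\<lambda>p. isCont al p) (nhds 0)"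
    using fps_expansion_pos[OF l(4)] fps_expansion_isCont[OF l(4)] l(5) by simp_all
  have be: "eventually (\<lambda>p. be p > 0) (nhds 0)" "eventually (\<lambda>p. isCont be p) (nhds 0)"
    using fps_expansion_pos[OF v(5)] fps_expansion_isCont[OF v(5)] v(6) by simp_all
  have "eventually (\<lambda>p. ((l has_real_derivative al p * exp (l p)) (at p) \<and> al p * (exp (l p) - 1) = p \<and>
      al p > 0 \<and> isCont al p) \<and> ((v has_real_derivative be p * (1 + a * v p)) (at p) \<and>
      be p * (v p - b * v p ^ 2 - c * v p ^ 3 - d * v p ^ 4) = p \<and> be p > 0 \<and> isCont be p \<and> 1 + a * v p > 0)) (nhds 0)"
    by (intro eventually_conj l(1,2) v(1,2,3) al be)
  then obtain r where r: "r > 0" "\<And>p. \<bar>p\<bar> < r \<Longrightarrow> ((l has_real_derivative al p * exp (l p)) (at p) \<and> al p * (exp (l p) - 1) = p \<and>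
      al p > 0 \<and> isCont al p) \<and> ((v has_real_derivative be p * (1 + a * v p)) (at p) \<and>
      be p * (v p - b * v p ^ 2 - c * v p ^ 3 - d * v p ^ 4) = p \<and> be p > 0 \<and> isCont be p \<and> 1 + a * v p > 0)"
    unfolding eventually_nhds_metric dist_real_def by auto
  have "al 0 = 1" "be 0 = 1"
    using has_fps_expansion_imp_0_eq_fps_nth_0[OF l(4)] has_fps_expansion_imp_0_eq_fps_nth_0[OF v(5)] l(5) v(6) by simp_all
  then have "morse_chart a b c d r l v al be"
    using r l(3) v(4) by unfold_locales blast+
  from that[OF this l(4) v(5) l(5-8) v(6-10) l(9-12)] show ?thesis .
qed

section \<open>Orders of vanishing and one-sided comparison of expansions\<close>

text \<open>Write \<open>f x = x^m * u x\<close>; then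
  \<open>f (g x) = x^m * (g x / x)^m * u (g x)\<close>, and the last two factors do not vanish at 0.
  This lets the order of the period be read in the radius instead of in \<open>h\<close>.\<close>

lemma fps_compose_subdegree:
  fixes f g :: "real \<Rightarrow> real"
  assumes f: "f has_fps_expansion F" "F \<noteq> 0" and g: "g has_fps_expansion G" "G $ 0 = 0" "G $ 1 \<noteq> 0"
  obtains H where "(\<lambda>x. f (g x)) has_fps_expansion H" "H \<noteq> 0" "subdegree H = subdegree F"
proof -
  define m where "m = subdegree F"
  have f1: "(\<lambda>x. if x = 0 then F $ m else f x / x ^ m) has_fps_expansion fps_shift m F"
    by (intro has_fps_expansion_shift f) (simp_all add: m_def)
  obtain K where K: "(\<lambda>x. if g x = 0 then F $ m else f (g x) / g x ^ m) has_fps_expansion K"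
    using has_fps_expansion_compose_real[OF f1 g(1,2)] by blast
  have "1 \<le> subdegree G" by (rule subdegree_geI) (use g in auto)
  then have g1: "(\<lambda>x. if x = 0 then G $ 1 else g x / x ^ 1) has_fps_expansion fps_shift 1 G"
    by (intro has_fps_expansion_shift g) simp_all
  have g0: "g 0 = 0" using g by (simp add: has_fps_expansion_imp_0_eq_fps_nth_0)
  have K0: "K $ 0 = F $ m" using has_fps_expansion_imp_0_eq_fps_nth_0[OF K] g0 by simp
  have pow: "(\<lambda>x. (if x = 0 then G $ 1 else g x / x ^ 1) ^ n) has_fps_expansion fps_shift 1 G ^ n" for n
    by (induction n; unfold power_0 power_Suc) (rule has_fps_expansion_1 has_fps_expansion_mult[OF g1] | assumption)+
  define H where "H = fps_X ^ m * (fps_shift 1 G ^ m * K)"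
  have exp: "(\<lambda>x. x ^ m * ((if x = 0 then G $ 1 else g x / x ^ 1) ^ m * (if g x = 0 then F $ m else f (g x) / g x ^ m)))
      has_fps_expansion H"
    unfolding H_def by (intro has_fps_expansion_mult has_fps_expansion_fps_X_power pow K)
  have fm: "f 0 = 0" if "m > 0"
    using that nth_less_subdegree_zero[of 0 F] has_fps_expansion_imp_0_eq_fps_nth_0[OF f(1)] unfolding m_def by metis
  have "f (g x) = x ^ m * ((if x = 0 then G $ 1 else g x / x ^ 1) ^ m * (if g x = 0 then F $ m else f (g x) / g x ^ m))" for x
  proof (cases "m = 0")
    case True
    then show ?thesis using has_fps_expansion_imp_0_eq_fps_nth_0[OF f(1)] by simp
  next
    case False
    then show ?thesis using fm g0 by (auto simp: power_divide)
  qed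
  then have "(\<lambda>x. f (g x)) has_fps_expansion H" using exp by simp
  moreover have nz: "(fps_shift 1 G ^ m * K) $ 0 \<noteq> 0"
    using g(3) f(2) K0 by (simp add: m_def)
  then have "fps_shift 1 G ^ m * K \<noteq> 0" by (metis fps_zero_nth)
  moreover have "subdegree (fps_shift 1 G ^ m * K) = 0" using nz by simp
  ultimately show ?thesis
    using that[of H] by (simp add: H_def m_def subdegree_mult)
qed

text \<open>The extension in \<open>weak_bicenter\<close> is tied to the period only for
  \<open>h > 0\<close>. Dividing the difference by its leading power shows that this side already
  determines the germ.\<close>

lemma fps_expansion_eq_at_right:
  fixes f g :: "real \<Rightarrow> real"
  assumes f: "f has_fps_expansion F" and g: "g has_fps_expansion G" and eq: "eventually (\<lambda>x. f x = g x) (at_right 0)"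
  shows "F = G"
proof (rule ccontr)
  assume "F \<noteq> G"
  define m where "m = subdegree (F - G)"
  have "(\<lambda>x. if x = 0 then (F - G) $ m else (f x - g x) / x ^ m) has_fps_expansion fps_shift m (F - G)"
    by (intro has_fps_expansion_shift has_fps_expansion_diff f g) (simp_all add: m_def)
  from has_fps_expansion_imp_continuous[OF this, of UNIV]
  have "((\<lambda>x. if x = 0 then (F - G) $ m else (f x - g x) / x ^ m) \<longlongrightarrow> (F - G) $ m) (at 0)"
    by (simp add: continuous_within)
  then have "((\<lambda>x. if x = 0 then (F - G) $ m else (f x - g x) / x ^ m) \<longlongrightarrow> (F - G) $ m) (at_right 0)"
    by (rule filterlim_mono) (auto intro: at_le)
  moreover have "((\<lambda>x. if x = 0 then (F - G) $ m else (f x - g x) / x ^ m) \<longlongrightarrow> 0) (at_right 0)"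
  proof (rule Lim_transform_eventually[OF tendsto_const])
    show "eventually (\<lambda>x. 0 = (if x = 0 then (F - G) $ m else (f x - g x) / x ^ m)) (at_right 0)"
      using eq eventually_at_right_less[of "0::real"] by eventually_elim simp
  qed
  ultimately have "(F - G) $ m = 0" using tendsto_unique trivial_limit_at_right_real by blast
  then show False using \<open>F \<noteq> G\<close> nth_subdegree_nonzero[of "F - G"] by (simp add: m_def)
qed

text \<open>Allowing \<open>n\<close> below the subdegree, where the limit is 0, lets
  \<open>tau_first\<close> treat the vanishing coefficients too.\<close>

lemma fps_quotient_lim:
  fixes f :: "real \<Rightarrow> real"
  assumes f: "f has_fps_expansion F" and n: "n \<le> subdegree F"
  shows "((\<lambda>x. f x / x ^ n) \<longlongrightarrow> F $ n) (at_right 0)"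
proof -
  have "(\<lambda>x. if x = 0 then F $ n else f x / x ^ n) has_fps_expansion fps_shift n F"
    by (intro has_fps_expansion_shift f n) simp
  from has_fps_expansion_imp_continuous[OF this, of UNIV]
  have "((\<lambda>x. if x = 0 then F $ n else f x / x ^ n) \<longlongrightarrow> F $ n) (at 0)"
    by (simp add: continuous_within)
  then have "((\<lambda>x. if x = 0 then F $ n else f x / x ^ n) \<longlongrightarrow> F $ n) (at_right 0)"
    by (rule filterlim_mono) (auto intro: at_le)
  then show ?thesis
  proof (rule Lim_transform_eventually)
    show "eventually (\<lambda>x. (if x = 0 then F $ n else f x / x ^ n) = f x / x ^ n) (at_right 0)"
      using eventually_at_right_less[of "0::real"] by eventually_elim simp
  qed
qed

subsection \<open>The order of the weak center\<close>

text \<open>\<open>4 * ln (1 + h)\<close> is the coordinate \<open>l\<close> of the point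
  \<open>(1 + h, 0)\<close>.\<close>

lemma log_expansion:
  obtains L where "(\<lambda>h::real. 4 * ln (1 + h)) has_fps_expansion L" "L $ 0 = 0" "L $ 1 = 4"
proof -
  have "(\<lambda>z. 4 * Ln (1 + z)) analytic_on {0}"
    by (intro analytic_intros) simp
  then obtain G where "(\<lambda>z. 4 * Ln (1 + z)) has_fps_expansion G"
    using analytic_at_imp_has_fps_expansion_0 by blast
  moreover have "eventually (\<lambda>x::real. x \<in> {-1<..}) (nhds 0)"
    by (rule eventually_nhds_in_open) simp_all
  then have "eventually (\<lambda>x. 4 * Ln (1 + of_real x) = of_real (4 * ln (1 + x))) (nhds 0)"
  proof eventually_elim
    case (elim x)
    then have "Ln (of_real (1 + x)) = of_real (ln (1 + x))" by (intro Ln_of_real) simp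
    then show ?case by simp
  qed
  ultimately have L: "(\<lambda>h::real. 4 * ln (1 + h)) has_fps_expansion Abs_fps (\<lambda>n. Re (G $ n))"
    by (rule has_fps_expansion_realify)
  have "((\<lambda>h::real. 4 * ln (1 + h)) has_real_derivative 4) (at 0)"
    by (rule derivative_eq_intros refl | simp)+
  from that[OF L _ fps_expansion_nth_1[OF L this]] has_fps_expansion_imp_0_eq_fps_nth_0[OF L]
  show ?thesis by simp
qed

text \<open>Only products of two even coefficients survive the averaging, since a moment with an odd
  exponent vanishes.\<close>

lemma circle_moment_sums:
  fixes A B :: "real fps"
  assumes A: "A $ 0 = 1" and B: "B $ 0 = 1"
  defines "F \<equiv> Abs_fps (\<lambda>n. \<Sum>i\<le>n. A $ i * B $ (n - i) * trig_moment i (n - i))"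
  shows "F $ 0 = 2 * pi" "odd n \<Longrightarrow> F $ n = 0" "F $ 2 = pi * (A $ 2 + B $ 2)"
    "F $ 4 = pi * (3/4 * (A $ 4 + B $ 4) + 1/4 * (A $ 2 * B $ 2))"
    "F $ 6 = pi * (5/8 * (A $ 6 + B $ 6) + 1/8 * (A $ 4 * B $ 2 + A $ 2 * B $ 4))"
proof -
  have *: "{..2::nat} = {0, 1, 2}" "{..4::nat} = {0, 1, 2, 3, 4}" "{..6::nat} = {0, 1, 2, 3, 4, 5, 6}"
    by auto
  show "F $ 0 = 2 * pi" by (simp add: F_def A B trig_moment_base)
  show "F $ n = 0" if "odd n"
    unfolding F_def fps_nth_Abs_fps by (rule sum.neutral) (use that in \<open>simp add: trig_moment_odd\<close>)
  show "F $ 2 = pi * (A $ 2 + B $ 2)"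
    "F $ 4 = pi * (3/4 * (A $ 4 + B $ 4) + 1/4 * (A $ 2 * B $ 2))"
    "F $ 6 = pi * (5/8 * (A $ 6 + B $ 6) + 1/8 * (A $ 4 * B $ 2 + A $ 2 * B $ 4))"
    unfolding F_def fps_nth_Abs_fps *
    by (simp_all add: A B trig_moment_values[unfolded One_nat_def] algebra_simps)
qed

text \<open>\<open>D\<close> will be the expansion of the period minus \<open>2 * pi\<close> in the
  radius. It has even degrees only, and by \<open>no_real_solution\<close> not all of its
  coefficients in degrees 2, 4, 6 vanish.\<close>

lemma period_order:
  fixes A B V D :: "real fps"
  assumes A: "A $ 0 = 1" "A $ 2 = 1/12" "A $ 4 = 1/864" "A $ 6 = - 139/777600" and B0: "B $ 0 = 1"
    and V: "V $ 0 = 0" "V $ 1 = 1" "B * (1 + fps_const a * V) = fps_deriv V"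
    "B * (V - fps_const b * V^2 - fps_const c * V^3 - fps_const d * V^4) = fps_X"
  defines "D \<equiv> Abs_fps (\<lambda>n. \<Sum>i\<le>n. A $ i * B $ (n - i) * trig_moment i (n - i)) - fps_const (2 * pi)"
  shows "D \<noteq> 0" "\<exists>k\<in>{1, 2, 3}. subdegree D = 2 * k"
proof -
  note F = circle_moment_sums[OF A(1) B0]
  have D: "D $ 0 = 0" "\<And>n. odd n \<Longrightarrow> D $ n = 0" "D $ 2 = pi * (A $ 2 + B $ 2)"
    "D $ 4 = pi * (3/4 * (A $ 4 + B $ 4) + 1/4 * (A $ 2 * B $ 2))"
    "D $ 6 = pi * (5/8 * (A $ 6 + B $ 6) + 1/8 * (A $ 4 * B $ 2 + A $ 2 * B $ 4))"
    using F unfolding D_def fps_sub_nth fps_nth_fps_const by (auto elim!: oddE)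
  have "D $ 2 \<noteq> 0 \<or> D $ 4 \<noteq> 0 \<or> D $ 6 \<noteq> 0"
  proof (rule ccontr)
    assume "\<not> ?thesis"
    then have "A $ 2 + B $ 2 = 0" "3/4 * (A $ 4 + B $ 4) + 1/4 * (A $ 2 * B $ 2) = 0"
      "5/8 * (A $ 6 + B $ 6) + 1/8 * (A $ 4 * B $ 2 + A $ 2 * B $ 4) = 0"
      unfolding D(3-5) by simp_all
    then show False
      unfolding A morse_coeffs(2-4)[OF V] by (rule no_real_solution)
  qed
  then have ex: "D $ (2 * 1) \<noteq> 0 \<or> D $ (2 * 2) \<noteq> 0 \<or> D $ (2 * 3) \<noteq> 0" by simp
  define k where "k = (LEAST k. D $ (2 * k) \<noteq> 0)"
  have k0: "D $ (2 * k) \<noteq> 0" unfolding k_def using ex by (metis (mono_tags, lifting) LeastI)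
  have low: "D $ (2 * i) = 0" if "i < k" for i using not_less_Least[of i] that unfolding k_def by blast
  have "k \<noteq> 0" using k0 D(1) by (intro notI) simp
  moreover have "k \<le> 3"
  proof (rule ccontr)
    assume "\<not> k \<le> 3"
    then show False using low[of 1] low[of 2] low[of 3] ex by simp
  qed
  ultimately have k: "k \<in> {1, 2, 3}" by auto
  show "D \<noteq> 0" using k0 by auto
  have "subdegree D = 2 * k"
  proof (rule subdegreeI)
    show "D $ i = 0" if "i < 2 * k" for i
      using that low[of "i div 2"] D(2)[of i] by (cases "even i") auto
  qed (fact k0)
  with k show "\<exists>k\<in>{1, 2, 3}. subdegree D = 2 * k" by blast
qed

context morse_chart
begin

lemma period_integral_expansion:
  assumes "al has_fps_expansion A" "be has_fps_expansion B"
  shows "period_integral has_fps_expansion Abs_fps (\<lambda>n. \<Sum>i\<le>n. A $ i * B $ (n - i) * trig_moment i (n - i))"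
  unfolding period_integral_def[abs_def] omega_def[abs_def] by (rule circle_integral_expansion[OF assms])

text \<open>Because \<open>P\<close> inverts \<open>l\<close>, the orbit through
  \<open>(h, 0)\<close> has radius \<open>P (4 * ln (1 + h))\<close>. Its derivative at
  \<open>h = 0\<close> is 4, so substituting it keeps the order of vanishing.\<close>

lemma period_expansion_at_0:
  assumes D: "(\<lambda>R. period_integral R - 2 * pi) has_fps_expansion D" "D \<noteq> 0"
    and P: "P has_fps_expansion H" "H $ 0 = 0" "H $ 1 = 1" "eventually (\<lambda>x. l (P x) = x) (nhds 0)"
  obtains \<phi> F where "\<phi> has_fps_expansion F" "F \<noteq> 0" "subdegree F = subdegree D"
    "eventually (\<lambda>h. \<phi> h = period h lam - 2 * pi) (at_right 0)"
proof -
  obtain L where L: "(\<lambda>h::real. 4 * ln (1 + h)) has_fps_expansion L" "L $ 0 = 0" "L $ 1 = 4"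
    by (rule log_expansion)
  define R where "R h = P (4 * ln (1 + h))" for h
  obtain K where K: "R has_fps_expansion K"
    using has_fps_expansion_compose_real[OF P(1) L(1,2)] unfolding R_def[abs_def] by blast
  have P0: "P 0 = 0" using has_fps_expansion_imp_0_eq_fps_nth_0[OF P(1)] P(2) by simp
  have dP: "(P has_real_derivative 1) (at 0)"
    using eventually_nhds_x_imp_x[OF has_real_derivative_of_fps_expansion[OF P(1)]] P(3)
    by (simp add: eval_fps_at_0)
  have dR: "(R has_real_derivative 4) (at 0)"
  proof -
    have d: "((\<lambda>h::real. 4 * ln (1 + h)) has_real_derivative 4) (at 0)"
      by (rule derivative_eq_intros refl | simp)+
    have "(P has_real_derivative 1) (at (4 * ln (1 + 0)))" using dP by simp
    from DERIV_chain2[OF this d] show ?thesis unfolding R_def[abs_def] by (simp only: mult_1)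
  qed
  have R0: "R 0 = 0" by (simp add: R_def P0)
  have K0: "K $ 0 = 0" and K1: "K $ 1 \<noteq> 0"
    using has_fps_expansion_imp_0_eq_fps_nth_0[OF K] R0 fps_expansion_nth_1[OF K dR] by simp_all
  obtain F where F: "(\<lambda>h. period_integral (R h) - 2 * pi) has_fps_expansion F" "F \<noteq> 0" "subdegree F = subdegree D"
    by (rule fps_compose_subdegree[OF D K K0 K1])
  have pos: "eventually (\<lambda>h. R h > 0) (at_right 0)"
  proof -
    obtain e where "e > 0" "\<And>h. 0 < h \<Longrightarrow> h < e \<Longrightarrow> R 0 < R (0 + h)"
      using DERIV_pos_inc_right[OF dR] by auto
    then show ?thesis unfolding eventually_at_right_field R0 by auto
  qed
  have lim: "filterlim R (nhds 0) (at_right 0)"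
    using DERIV_isCont[OF dR] unfolding isCont_def R0 by (rule filterlim_mono) (auto intro: at_le)
  have lim4: "filterlim (\<lambda>h::real. 4 * ln (1 + h)) (nhds 0) (at_right 0)"
  proof -
    have "((\<lambda>h::real. 4 * ln (1 + h)) \<longlongrightarrow> 4 * ln (1 + 0)) (at_right 0)"
      by (intro tendsto_intros) simp_all
    then show ?thesis by simp
  qed
  have small: "eventually (\<lambda>h. R h < r) (at_right 0)"
    by (rule order_tendstoD(2)[OF lim r])
  have "eventually (\<lambda>h::real. h > 0) (at_right 0)" by (rule eventually_at_right_less)
  with pos small eventually_compose_filterlim[OF P(4) lim4]
  have "eventually (\<lambda>h. period_integral (R h) - 2 * pi = period h lam - 2 * pi) (at_right 0)"
  proof eventually_elim
    case (elim h)
    have "exp (l (R h) / 4) = 1 + h" using elim(3,4) by (simp add: R_def)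
    from period_eq[OF elim(1,2) this] show ?case by simp
  qed
  with F show ?thesis by (rule that)
qed

text \<open>The definition asks for some analytic extension. All extensions share one germ, so the
  one constructed above decides, and its order of vanishing is that of \<open>D\<close>.\<close>

lemma weak_bicenter_iff:
  assumes "(\<lambda>R. period_integral R - 2 * pi) has_fps_expansion D" "D \<noteq> 0"
    and "P has_fps_expansion H" "H $ 0 = 0" "H $ 1 = 1" "eventually (\<lambda>x. l (P x) = x) (nhds 0)"
  shows "weak_bicenter lam k \<longleftrightarrow> subdegree D = 2 * k + 2"
proof -
  obtain \<phi> F where F: "\<phi> has_fps_expansion F" "F \<noteq> 0" "subdegree F = subdegree D"
    "eventually (\<lambda>h. \<phi> h = period h lam - 2 * pi) (at_right 0)"
    by (rule period_expansion_at_0[OF assms])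
  have iff: "(\<forall>j\<le>2 * k + 1. (deriv ^^ j) \<phi> 0 = 0) \<and> (deriv ^^ (2 * k + 2)) \<phi> 0 \<noteq> 0 \<longleftrightarrow> subdegree D = 2 * k + 2"
    unfolding fps_nth_fps_expansion_real[OF F(1)] F(3)[symmetric]
  proof
    assume *: "(\<forall>j\<le>2 * k + 1. fact j * F $ j = 0) \<and> fact (2 * k + 2) * F $ (2 * k + 2) \<noteq> 0"
    then show "subdegree F = 2 * k + 2" by (intro subdegreeI) auto
  next
    assume *: "subdegree F = 2 * k + 2"
    have "F $ (2 * k + 2) \<noteq> 0" using nth_subdegree_nonzero[OF F(2)] unfolding * .
    moreover have "F $ j = 0" if "j \<le> 2 * k + 1" for j
      by (rule nth_less_subdegree_zero) (use that * in simp)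
    ultimately show "(\<forall>j\<le>2 * k + 1. fact j * F $ j = 0) \<and> fact (2 * k + 2) * F $ (2 * k + 2) \<noteq> 0"
      by simp
  qed
  have "(\<forall>j\<le>2 * k + 1. (deriv ^^ j) \<psi> 0 = 0) \<and> (deriv ^^ (2 * k + 2)) \<psi> 0 \<noteq> 0 \<longleftrightarrow> subdegree D = 2 * k + 2"
    if G: "\<psi> has_fps_expansion G" and eq: "eventually (\<lambda>h. \<psi> h = period h lam - 2 * pi) (at_right 0)" for \<psi> G
  proof -
    have "eventually (\<lambda>h. \<psi> h = \<phi> h) (at_right 0)" using eq F(4) by eventually_elim simp
    then have "G = F" by (rule fps_expansion_eq_at_right[OF G F(1)])
    then have "(deriv ^^ j) \<psi> 0 = (deriv ^^ j) \<phi> 0" for j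
      using fps_nth_fps_expansion_real[OF G] fps_nth_fps_expansion_real[OF F(1)] by simp
    then show ?thesis using iff by (simp only:)
  qed
  then show ?thesis unfolding weak_bicenter_def using F(1,4) is_bicenter by blast
qed

text \<open>For \<open>i < k\<close> the vanishing coefficient of \<open>R^(2 * i)\<close> gives
  \<open>p i + q i = 0\<close>, which in turn admits the next index in
  \<open>period_expansion\<close>; at \<open>k\<close> the coefficient is nonzero. The period
  thereby fixes the value of \<open>p k + q k\<close> for every normal form, which settles the
  description operator in \<open>tau\<close>.\<close>

lemma tau_first:
  assumes D: "(\<lambda>R. period_integral R - 2 * pi) has_fps_expansion D" "D \<noteq> 0"
    and k: "subdegree D = 2 * k" "k \<ge> 1"
  shows "tau k lam \<noteq> 0"
proof -
  have "D $ 0 = 0" using nth_less_subdegree_zero[of 0 D] k by simp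
  then have p0: "period_integral 0 = 2 * pi"
    using has_fps_expansion_imp_0_eq_fps_nth_0[OF D(1)] by simp
  have "((\<lambda>R. period_integral R - 2 * pi) \<longlongrightarrow> period_integral 0 - 2 * pi) (at 0)"
    using has_fps_expansion_imp_continuous[OF D(1), of UNIV] by (simp add: continuous_within)
  then have "((\<lambda>R. period_integral R - 2 * pi) \<longlongrightarrow> 0) (at_right 0)"
    unfolding p0 by (simp add: filterlim_mono at_le)
  from tendsto_add[OF this tendsto_const[of "2 * pi"]]
  have T: "(period_integral \<longlongrightarrow> 2 * pi) (at_right 0)" by simp
  define s where "s = complex_of_real (- (16 ^ k * D $ (2 * k) / pi))"
  have sum: "p k + q k = s" if nf: "normal_form lam xi eta p q" for xi eta p q
  proof -
    have step: "of_real (D $ (2 * j)) = - of_real pi * (p j + q j) / 16 ^ j"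
      if "1 \<le> j" "j \<le> k" "\<And>i. 1 \<le> i \<Longrightarrow> i < j \<Longrightarrow> p i + q i = 0" for j
    proof -
      have "2 * j \<le> subdegree D" using that(2) k by simp
      from tendsto_of_real[OF fps_quotient_lim[OF D(1) this], where 'a = complex]
        period_expansion[OF nf that(1,3) T]
      show ?thesis by (rule tendsto_unique[OF trivial_limit_at_right_real])
    qed
    have low: "1 \<le> i \<Longrightarrow> i < k \<Longrightarrow> p i + q i = 0" for i
    proof (induction i rule: less_induct)
      case (less i)
      then have "of_real (D $ (2 * i)) = - of_real pi * (p i + q i) / 16 ^ i"
        by (intro step) auto
      moreover have "D $ (2 * i) = 0" by (rule nth_less_subdegree_zero) (use less k in simp)
      ultimately show ?case by simp
    qed
    have solve: "z = - (w * x / y)" if "x = - y * z / w" "y \<noteq> 0" "w \<noteq> 0" for w x y z :: complex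
      using that by (simp add: field_simps)
    have "p k + q k = - (16 ^ k * of_real (D $ (2 * k)) / of_real pi)"
      by (rule solve, rule step) (use k(2) low in simp_all)
    then show ?thesis by (simp add: s_def)
  qed
  obtain xi eta p q where nf: "normal_form lam xi eta p q" using normal_form_exists by blast
  have "tau k lam = s"
    unfolding tau_def by (rule the_equality) (use nf sum in blast)+
  moreover have "D $ (2 * k) \<noteq> 0" using D(2) k by (metis nth_subdegree_nonzero)
  ultimately show ?thesis by (simp add: s_def)
qed

end

theorem theorem3p7:
  fixes lam :: params
  assumes "lam \<in> Lambda4"
  shows "(\<exists>k\<le>3. weak_bicenter lam k) \<and> (weak_bicenter lam 3 \<longleftrightarrow> gamma4 lam \<in> Gamma4)"
proof -
  obtain a2 a3 a4 a6 where lam: "lam = (a2, a3, a4, a6, -1, a2, a3, a4)"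
    using assms by (auto simp: Lambda4_def)
  obtain r l v al be P A B V H where chart: "morse_chart a6 (a2/4) (a3/16) (a4/64) r l v al be"
    and exp: "al has_fps_expansion A" "be has_fps_expansion B"
    and A: "A $ 0 = 1" "A $ 2 = 1/12" "A $ 4 = 1/864" "A $ 6 = - 139/777600" and B: "B $ 0 = 1"
    and V: "V $ 0 = 0" "V $ 1 = 1" "B * (1 + fps_const a6 * V) = fps_deriv V"
    "B * (V - fps_const (a2/4) * V^2 - fps_const (a3/16) * V^3 - fps_const (a4/64) * V^4) = fps_X"
    and P: "P has_fps_expansion H" "H $ 0 = 0" "H $ 1 = 1" "eventually (\<lambda>x. l (P x) = x) (nhds 0)"
    by (rule morse_chart_exists[of a6 "a2/4" "a3/16" "a4/64"]) (rule that)
  interpret morse_chart a6 "a2/4" "a3/16" "a4/64" r l v al be by (rule chart)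
  have lam': "morse_chart.lam a6 (a2/4) (a3/16) (a4/64) = lam"
    unfolding lam lam_def by simp
  define D where "D = Abs_fps (\<lambda>n. \<Sum>i\<le>n. A $ i * B $ (n - i) * trig_moment i (n - i)) - fps_const (2 * pi)"
  have D: "(\<lambda>R. period_integral R - 2 * pi) has_fps_expansion D"
    unfolding D_def by (intro has_fps_expansion_diff period_integral_expansion exp has_fps_expansion_const)
  have D0: "D \<noteq> 0" and "\<exists>k\<in>{1, 2, 3}. subdegree D = 2 * k"
    using period_order[OF A B V] unfolding D_def by blast+
  then obtain k where k: "k \<in> {1, 2, 3}" "subdegree D = 2 * k" by blast
  \<comment> \<open>Order \<open>n\<close> means that the first coefficient stands in degree
    \<open>2 * n + 2\<close>. With \<open>k \<le> 3\<close> the only possible order is thus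
    \<open>k - 1 \<le> 2\<close>, and the first nonzero constant \<open>tau k\<close> is among the
    three that define \<open>Gamma4\<close>.\<close>
  have weak: "weak_bicenter lam n \<longleftrightarrow> n + 1 = k" for n
    using weak_bicenter_iff[OF D D0 P, of n] k(2) unfolding lam' by auto
  have "tau k lam \<noteq> 0" using tau_first[OF D D0 k(2)] k(1) unfolding lam' by auto
  then have "gamma4 lam \<notin> Gamma4"
    using k(1) by (auto simp: lam Gamma4_def)
  moreover have "\<exists>n\<le>3. weak_bicenter lam n"
    unfolding weak using k(1) by (intro exI[of _ "k - 1"]) auto
  moreover have "\<not> weak_bicenter lam 3" unfolding weak using k(1) by auto
  ultimately show ?thesis by blast
qed

end
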